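(* Let $n=1$, $s \geq \tfrac12$, and let $p:\mathbb{R}\to\mathbb{R}$ be a continuous function satisfying $A|\xi|^{2s} + c \leq p(\xi) \leq B|\xi|^{2s}$ for all $\xi \in \mathbb{R}$, with constants $A>0$, $B>0$, $c\in\mathbb{R}$. Let $v \in \mathbb{R}$, where if $s = \tfrac12$ we additionally assume $|v| < A$. Let $\Sigma_v := \inf_{\xi\in\mathbb{R}}\{p(\xi) - v\xi\}$, let $\omega > -\Sigma_v$, and let $\sigma \in \mathbb{N}$ be an integer with $0 < \sigma < \sigma_*(s,1)$. Then every boosted ground state $Q_{\omega,v} \in H^s(\mathbb{R})$ is of the form $$Q_{\omega,v}(x) = e^{\mathrm{i}\alpha}\, Q_{\omega,v}^{\bullet}(x + x_0) \quad \text{for a.e. } x \in \mathbb{R},$$ for some constants $\alpha\in\mathbb{R}$ and $x_0 \in \mathbb{R}$. In particular, up to translation and multiplication by a constant phase, every such $Q_{\omega,v}$ satisfies $Q_{\omega,v}(x) = \overline{Q_{\omega,v}(-x)}$ for a.e. $x\in\mathbb{R}$.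
   Context: Fourier transform: $\widehat{u}(\xi) = (2\pi)^{-1/2}\int_{\mathbb{R}} u(x)e^{-\mathrm{i}\xi x}\,dx$, extended to $L^2$. $\sigma_*(s,1) = \frac{2s}{1-2s}$ if $s<1/2$ and $+\infty$ if $s \geq 1/2$ (so here $\sigma_*=+\infty$). For $u \in H^s(\mathbb{R})$, $u\not\equiv 0$, define $$\mathcal{J}_{v,\omega,\sigma}(u) = \frac{\left(\int_{\mathbb{R}}(p(\xi) - v\xi + \omega)|\widehat{u}(\xi)|^2\,d\xi\right)^{\sigma+1}}{\|u\|_{L^{2\sigma+2}}^{2\sigma+2}};$$ a boosted ground state is a minimizer of $\mathcal{J}_{v,\omega,\sigma}$ over $H^s(\mathbb{R})\setminus\{0\}$. For $f \in L^2(\mathbb{R})$, $f^\bullet := \mathcal{F}^{-1}\{|\mathcal{F}f|\}$. *)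

theory Defs
  imports "HOL-Analysis.Analysis"
begin

definition square_integrable :: "(real \<Rightarrow> complex) \<Rightarrow> bool" where
  "square_integrable f \<longleftrightarrow>
     f \<in> borel_measurable lborel \<and> integrable lborel (\<lambda>x. (cmod (f x))^2)"

definition fourier_L1 :: "(real \<Rightarrow> complex) \<Rightarrow> real \<Rightarrow> complex" where
  "fourier_L1 u \<xi> =
     complex_of_real (1 / sqrt (2 * pi)) * (LINT x|lborel. u x * cis (- (\<xi> * x)))"

text \<open>Extension to L^2 (Plancherel): uh is a Fourier transform of u if uh is in L^2 and
  the Fourier transforms of the truncations of u to [-R,R] converge to uh in L^2.\<close>
definition is_fourier :: "(real \<Rightarrow> complex) \<Rightarrow> (real \<Rightarrow> complex) \<Rightarrow> bool" where
  "is_fourier u uh \<longleftrightarrow> square_integrable uh \<and>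
     ((\<lambda>R::nat. \<integral>\<^sup>+ \<xi>. ennreal ((cmod (uh \<xi> -
          fourier_L1 (\<lambda>x. indicator {- real R .. real R} x * u x) \<xi>))^2) \<partial>lborel)
      \<longlonglongrightarrow> 0)"

definition fourier_L2 :: "(real \<Rightarrow> complex) \<Rightarrow> real \<Rightarrow> complex" where
  "fourier_L2 u = (SOME uh. is_fourier u uh)"

definition fourier_inv_L2 :: "(real \<Rightarrow> complex) \<Rightarrow> real \<Rightarrow> complex" where
  "fourier_inv_L2 g = fourier_L2 (\<lambda>\<xi>. g (- \<xi>))"

definition bullet :: "(real \<Rightarrow> complex) \<Rightarrow> real \<Rightarrow> complex" where
  "bullet f = fourier_inv_L2 (\<lambda>\<xi>. complex_of_real (cmod (fourier_L2 f \<xi>)))"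

definition sobolev_H :: "real \<Rightarrow> (real \<Rightarrow> complex) \<Rightarrow> bool" where
  "sobolev_H s u \<longleftrightarrow> square_integrable u \<and>
     integrable lborel (\<lambda>\<xi>. (1 + \<xi>^2) powr s * (cmod (fourier_L2 u \<xi>))^2)"

definition J_fun :: "(real \<Rightarrow> real) \<Rightarrow> real \<Rightarrow> real \<Rightarrow> nat \<Rightarrow> (real \<Rightarrow> complex) \<Rightarrow> real" where
  "J_fun p v \<omega> \<sigma> u =
     (LINT \<xi>|lborel. (p \<xi> - v * \<xi> + \<omega>) * (cmod (fourier_L2 u \<xi>))^2) ^ (\<sigma> + 1) /
     (LINT x|lborel. (cmod (u x)) ^ (2 * \<sigma> + 2))"

definition boosted_ground_state ::
  "real \<Rightarrow> (real \<Rightarrow> real) \<Rightarrow> real \<Rightarrow> real \<Rightarrow> nat \<Rightarrow> (real \<Rightarrow> complex) \<Rightarrow> bool" where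
  "boosted_ground_state s p v \<omega> \<sigma> Q \<longleftrightarrow>
     sobolev_H s Q \<and> \<not> (AE x in lborel. Q x = 0) \<and>
     (\<forall>u. sobolev_H s u \<and> \<not> (AE x in lborel. u x = 0) \<longrightarrow>
          J_fun p v \<omega> \<sigma> Q \<le> J_fun p v \<omega> \<sigma> u)"

end

theory Submission
  imports Defs "HOL-Probability.Probability"
begin

text \<open>Write \<open>g = |Fourier transform of Q|\<close> and \<open>k = \<sigma> + 1\<close>. By Plancherel the numerator of the functional
  depends on \<open>g\<close> only, while \<open>\<parallel>Q\<parallel>\<close> in \<open>L\<^bsup>2k\<^esup>\<close> is the \<open>L\<^sup>2\<close> norm of the \<open>k\<close>-fold convolution of the
  transform, which increases when the transform is replaced by \<open>g\<close>. Minimality forces equality in this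
  majorization. Perturbing \<open>g\<close> by \<open>t\<close> times the indicator of a bounded part of \<open>{g = 0}\<close> changes the numerator
  only at order \<open>t\<^sup>2\<close>, so the linear gain in the denominator has to vanish; since \<open>g\<close> convolved with a function
  that is positive near the origin occurs in it, \<open>{g = 0}\<close> is invariant under small shifts, hence null. Equality
  in the majorization now says that the phase \<open>\<phi>\<close> of the transform satisfies a Pexider equation
  \<open>\<phi>(y) \<psi>(z) = \<Theta>(y + z)\<close> almost everywhere, so that \<open>\<phi>(y) = cis (\<alpha> + l y)\<close>, i.e. \<open>Q\<close> is the inverse
  transform of \<open>g\<close> up to a phase and a translation.\<close>

subsection \<open>Square-integrable functions\<close>

text \<open>Integrality of \<open>\<sigma>\<close> makes the denominator accessible: |Q|^(2k) =
  |Q^k|^2, and Q^k has a k-fold convolution as transform. At s = 1/2 the obstacle is that the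
  transform need not be integrable. The convolution powers are therefore controlled by weighted L^2
  bounds that lose a little weight at each step, and the convolution theorem is reached through
  truncations. Zeros have to be excluded before phases are compared, because the transform has no
  phase where it vanishes. No Euler-Lagrange equation is derived: all terms of the perturbed
  convolution are nonnegative, so one-sided perturbations and a lower bound that keeps a single
  linear term suffice. Since \<open>fourier_L2\<close> is a choice, identities between transforms
  hold only almost everywhere, and the phase equation relates functions that are merely measurable;
  it is made continuous by integration before it is solved. Plancherel rests on a Gaussian-damped
  energy identity. It yields inversion, and inversion is what realizes an arbitrary profile as the
  transform of a competitor.\<close>

lemmas lebesgue_integral_cong = Bochner_Integration.integral_cong
lemmas integrable_dominated = Bochner_Integration.integrable_bound

text \<open>The squared L^2 norm is kept in \<open>ennreal\<close>, so that Fatou, Tonelli and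
  limits apply before integrability is known.\<close>

definition nsq :: "(real \<Rightarrow> complex) \<Rightarrow> ennreal" where
  "nsq f = (\<integral>\<^sup>+ x. ennreal ((cmod (f x))\<^sup>2) \<partial>lborel)"

lemma square_integrable_iff: "square_integrable f \<longleftrightarrow> f \<in> borel_measurable borel \<and> nsq f < \<infinity>"
proof -
  have "integrable lborel (\<lambda>x. (cmod (f x))\<^sup>2) \<longleftrightarrow> nsq f < \<infinity>" if [measurable]: "f \<in> borel_measurable borel"
    unfolding nsq_def by (subst integrable_iff_bounded) auto
  then show ?thesis unfolding square_integrable_def by auto
qed

lemma square_integrable_measurable [measurable_dest]: "square_integrable f \<Longrightarrow> f \<in> borel_measurable borel"
  by (simp add: square_integrable_iff)

lemma nsq_cong_AE: "AE x in lborel. cmod (f x) = cmod (g x) \<Longrightarrow> nsq f = nsq g"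
  unfolding nsq_def by (rule nn_integral_cong_AE) auto

lemma nsq_mono: "(\<And>x. cmod (f x) \<le> cmod (g x)) \<Longrightarrow> nsq f \<le> nsq g"
  unfolding nsq_def by (rule nn_integral_mono) (auto intro!: ennreal_leI power_mono)

lemma nsq_minus_commute: "nsq (\<lambda>x. f x - g x) = nsq (\<lambda>x. g x - f x)"
  unfolding nsq_def by (simp add: norm_minus_commute)

lemma nsq_cmult: "f \<in> borel_measurable borel \<Longrightarrow> nsq (\<lambda>x. a * f x) = ennreal ((cmod a)\<^sup>2) * nsq f"
  unfolding nsq_def
  by (subst nn_integral_cmult[symmetric]) (auto simp: norm_mult power_mult_distrib ennreal_mult)

lemma nsq_shift:
  assumes [measurable]: "f \<in> borel_measurable borel"
  shows "nsq (\<lambda>x. f (x + a)) = nsq f"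
  unfolding nsq_def
  using nn_integral_real_affine[of "\<lambda>x. ennreal ((cmod (f x))\<^sup>2)" 1 a] by (simp add: add.commute)

lemma nsq_reflect:
  assumes [measurable]: "f \<in> borel_measurable borel"
  shows "nsq (\<lambda>x. f (- x)) = nsq f"
  unfolding nsq_def
  using nn_integral_real_affine[of "\<lambda>x. ennreal ((cmod (f x))\<^sup>2)" "-1" 0] by simp

text \<open>The two sides differ by a perfect square (Young's inequality). The free parameter
  matters: letting it tend to 0 makes the coefficient of the first term sharp, which replaces the
  triangle inequality for squared norms.\<close>

lemma cmod_add_sq_le:
  fixes a b :: complex
  assumes "\<delta> > 0"
  shows "(cmod (a + b))\<^sup>2 \<le> (1 + \<delta>) * (cmod a)\<^sup>2 + (1 + 1 / \<delta>) * (cmod b)\<^sup>2"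
proof -
  let ?a = "cmod a" and ?b = "cmod b"
  have "(cmod (a + b))\<^sup>2 \<le> (?a + ?b)\<^sup>2"
    by (simp add: norm_triangle_ineq power_mono)
  also have "\<dots> = (1 + \<delta>) * ?a\<^sup>2 + (1 + 1 / \<delta>) * ?b\<^sup>2 - (\<delta> * ?a - ?b)\<^sup>2 / \<delta>"
    using assms by (simp add: field_simps power2_eq_square)
  also have "\<dots> \<le> (1 + \<delta>) * ?a\<^sup>2 + (1 + 1 / \<delta>) * ?b\<^sup>2"
    using assms by simp
  finally show ?thesis .
qed

lemma nsq_add_le:
  assumes [measurable]: "f \<in> borel_measurable borel" "g \<in> borel_measurable borel" and "\<delta> > 0"
  shows "nsq (\<lambda>x. f x + g x) \<le> ennreal (1 + \<delta>) * nsq f + ennreal (1 + 1 / \<delta>) * nsq g"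
proof -
  have "nsq (\<lambda>x. f x + g x) \<le> (\<integral>\<^sup>+x. ennreal (1 + \<delta>) * ennreal ((cmod (f x))\<^sup>2)
      + ennreal (1 + 1 / \<delta>) * ennreal ((cmod (g x))\<^sup>2) \<partial>lborel)"
    unfolding nsq_def using assms(3) cmod_add_sq_le[OF assms(3)]
    by (intro nn_integral_mono) (simp add: ennreal_mult[symmetric] ennreal_plus[symmetric] ennreal_leI del: ennreal_plus)
  also have "\<dots> = ennreal (1 + \<delta>) * nsq f + ennreal (1 + 1 / \<delta>) * nsq g"
    unfolding nsq_def by (simp add: nn_integral_add nn_integral_cmult)
  finally show ?thesis .
qed

lemma nsq_add_le2:
  assumes "f \<in> borel_measurable borel" "g \<in> borel_measurable borel"
  shows "nsq (\<lambda>x. f x + g x) \<le> 2 * nsq f + 2 * nsq g"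
  using nsq_add_le[OF assms, of 1] by simp

lemma nsq_triangle:
  assumes "f \<in> borel_measurable borel" "g \<in> borel_measurable borel" "h \<in> borel_measurable borel"
  shows "nsq (\<lambda>x. f x - h x) \<le> 2 * nsq (\<lambda>x. f x - g x) + 2 * nsq (\<lambda>x. g x - h x)"
  using nsq_add_le2[of "\<lambda>x. f x - g x" "\<lambda>x. g x - h x"] assms by simp

lemma nsq_zero_iff:
  assumes [measurable]: "f \<in> borel_measurable borel"
  shows "nsq f = 0 \<longleftrightarrow> (AE x in lborel. f x = 0)"
  unfolding nsq_def by (subst nn_integral_0_iff_AE) auto

lemma square_integrable_add:
  assumes "square_integrable f" "square_integrable g"
  shows "square_integrable (\<lambda>x. f x + g x)"
proof -
  have [measurable]: "f \<in> borel_measurable borel" "g \<in> borel_measurable borel"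
    using assms by (auto simp: square_integrable_iff)
  have "nsq (\<lambda>x. f x + g x) \<le> 2 * nsq f + 2 * nsq g" by (rule nsq_add_le2) auto
  also have "\<dots> < \<infinity>" using assms by (auto simp: square_integrable_iff ennreal_mult_less_top)
  finally show ?thesis by (simp add: square_integrable_iff)
qed

lemma square_integrable_cmult: "square_integrable f \<Longrightarrow> square_integrable (\<lambda>x. a * f x)"
  by (auto simp: square_integrable_iff nsq_cmult ennreal_mult_less_top)

lemma square_integrable_diff:
  assumes "square_integrable f" "square_integrable g"
  shows "square_integrable (\<lambda>x. f x - g x)"
  using square_integrable_add[OF assms(1) square_integrable_cmult[OF assms(2), of "-1"]] by simp

lemma square_integrable_bound:
  assumes "square_integrable g" and "f \<in> borel_measurable borel" and "\<And>x. cmod (f x) \<le> cmod (g x)"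
  shows "square_integrable f"
  using assms(1,2) le_less_trans[OF nsq_mono[of f g, OF assms(3)]] by (simp add: square_integrable_iff)

lemma ennreal_lincomb:
  assumes "0 \<le> p" "0 \<le> q" "0 \<le> x" "0 \<le> y"
  shows "ennreal p * ennreal x + ennreal q * ennreal y = ennreal (p * x + q * y)"
  using assms by (simp add: ennreal_mult ennreal_plus)

lemma tendsto_ennreal_0I:
  fixes X :: "'a \<Rightarrow> ennreal"
  assumes "\<And>e::real. e > 0 \<Longrightarrow> eventually (\<lambda>n. X n \<le> ennreal e) F"
  shows "(X \<longlongrightarrow> 0) F"
proof (rule order_tendstoI)
  fix a :: ennreal assume "0 < a"
  then obtain b where b: "0 < b" "b < a" using dense by blast
  then have "b < top" by (auto intro: less_le_trans)
  with b have "b = ennreal (enn2real b)" "enn2real b > 0"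
    by (auto simp: enn2real_positive_iff)
  then show "eventually (\<lambda>n. X n < a) F"
    using assms[of "enn2real b"] b by (auto elim!: eventually_mono)
qed simp

text \<open>Square-summable increments \<open>|F\<^sub>n\<^sub>+\<^sub>1 - F\<^sub>n|\<^sup>2\<close> with weight \<open>2\<^sup>n\<close> are bounded by some \<open>C\<close>, so the
  increments themselves are dominated by \<open>sqrt C * (1 / sqrt 2) ^ n\<close>.\<close>
lemma convergent_of_weighted_increments:
  fixes F :: "nat \<Rightarrow> complex"
  assumes "(\<Sum>n. ennreal (2 ^ n * (cmod (F (Suc n) - F n))\<^sup>2)) < \<infinity>"
  shows "convergent F"
proof -
  let ?a = "\<lambda>n. 2 ^ n * (cmod (F (Suc n) - F n))\<^sup>2"
  have s: "summable ?a"
    using assms by (intro summable_suminf_not_top) (auto simp: less_top)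
  define C where "C = suminf ?a"
  have C: "?a n \<le> C" for n
    unfolding C_def using sum_le_suminf[OF s, of "{n}"] by auto
  have "norm (F (Suc n) - F n) \<le> sqrt C * (1 / sqrt 2) ^ n" for n
  proof -
    have "(cmod (F (Suc n) - F n))\<^sup>2 \<le> C * (1 / 2) ^ n"
      using C[of n] by (simp add: field_simps power_divide)
    then have "cmod (F (Suc n) - F n) \<le> sqrt (C * (1 / 2) ^ n)"
      using real_le_rsqrt by blast
    then show ?thesis by (simp add: real_sqrt_mult real_sqrt_power real_sqrt_divide)
  qed
  moreover have "summable (\<lambda>n. sqrt C * (1 / sqrt 2) ^ n)"
    by (intro summable_mult summable_geometric) (auto simp: real_sqrt_gt_1_iff)
  ultimately have "summable (\<lambda>n. F (Suc n) - F n)"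
    by (blast intro: summable_comparison_test')
  then have "convergent (\<lambda>n. \<Sum>i<n. F (Suc i) - F i)"
    by (simp add: summable_iff_convergent)
  then have "convergent (\<lambda>n. F n - F 0)"
    by (simp add: sum_lessThan_telescope)
  then have "convergent (\<lambda>n. (F n - F 0) + F 0)"
    by (intro convergent_add convergent_const)
  then show ?thesis by simp
qed

text \<open>Riesz-Fischer. A subsequence with increments at most (1/4)^j stays summable in mean
  after weighting by 2^j, hence converges pointwise a.e.; Fatou then gives convergence of the full
  sequence to that limit.\<close>

lemma L2_complete:
  fixes F :: "nat \<Rightarrow> real \<Rightarrow> complex"
  assumes F: "\<And>n. square_integrable (F n)"
    and Cauchy: "\<And>e. e > 0 \<Longrightarrow> \<exists>N. \<forall>m\<ge>N. \<forall>n\<ge>N. nsq (\<lambda>x. F m x - F n x) \<le> ennreal e"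
  shows "\<exists>f. square_integrable f \<and> (\<lambda>n. nsq (\<lambda>x. f x - F n x)) \<longlonglongrightarrow> 0"
proof -
  have [measurable]: "F n \<in> borel_measurable borel" for n
    using F by (simp add: square_integrable_iff)
  obtain N where N: "\<And>j m n. m \<ge> N j \<Longrightarrow> n \<ge> N j \<Longrightarrow> nsq (\<lambda>x. F m x - F n x) \<le> ennreal ((1/4) ^ j)"
    using Cauchy[of "(1/4)^_"] by (metis zero_less_power zero_less_divide_1_iff zero_less_numeral)
  \<comment> \<open>The recursion takes a maximum so that the indices both increase strictly and
    stay beyond the Cauchy threshold \<open>N j\<close>.\<close>
  define r where "r = rec_nat (N 0) (\<lambda>j k. max (Suc k) (N (Suc j)))"
  have r_ge: "r j \<ge> N j" for j by (cases j) (auto simp: r_def)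
  have r_Suc: "r (Suc j) > r j" for j by (auto simp: r_def)
  have r_mono: "strict_mono r" using r_Suc by (simp add: strict_mono_Suc_iff)
  have "nsq (\<lambda>x. F (r (Suc j)) x - F (r j) x) \<le> ennreal ((1/4) ^ j)" for j
    using N[of j "r (Suc j)" "r j"] r_ge[of j] r_Suc[of j] by auto
  note inc = this
  have "(\<integral>\<^sup>+x. (\<Sum>j. ennreal (2 ^ j * (cmod (F (r (Suc j)) x - F (r j) x))\<^sup>2)) \<partial>lborel)
      = (\<Sum>j. ennreal (2 ^ j) * nsq (\<lambda>x. F (r (Suc j)) x - F (r j) x))"
    unfolding nsq_def by (subst nn_integral_suminf) (auto simp: ennreal_mult nn_integral_cmult)
  also have "\<dots> \<le> (\<Sum>j. ennreal ((1/2) ^ j))"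
  proof (intro suminf_le summableI)
    fix j
    have "ennreal (2 ^ j) * nsq (\<lambda>x. F (r (Suc j)) x - F (r j) x) \<le> ennreal (2 ^ j) * ennreal ((1/4) ^ j)"
      by (intro mult_left_mono inc) auto
    also have "\<dots> = ennreal ((1/2) ^ j)"
      by (subst ennreal_mult[symmetric]) (auto simp: power_mult_distrib[symmetric])
    finally show "ennreal (2 ^ j) * nsq (\<lambda>x. F (r (Suc j)) x - F (r j) x) \<le> ennreal ((1/2) ^ j)" .
  qed
  also have "\<dots> < \<infinity>"
    by (subst suminf_ennreal2) (auto simp: summable_geometric)
  finally have "AE x in lborel. (\<Sum>j. ennreal (2 ^ j * (cmod (F (r (Suc j)) x - F (r j) x))\<^sup>2)) \<noteq> \<infinity>"
    by (intro nn_integral_PInf_AE) auto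
  then have conv: "AE x in lborel. convergent (\<lambda>j. F (r j) x)"
    by eventually_elim (rule convergent_of_weighted_increments, auto simp: less_top)
  define f where "f = (\<lambda>x. lim (\<lambda>j. F (r j) x))"
  have [measurable]: "f \<in> borel_measurable borel" unfolding f_def by measurable
  have lim: "AE x in lborel. (\<lambda>j. F (r j) x) \<longlonglongrightarrow> f x"
    using conv by eventually_elim (simp add: f_def convergent_LIMSEQ_iff)
  have fatou: "nsq (\<lambda>x. f x - F n x) \<le> ennreal e" if e: "e > 0" and
      n: "\<forall>m\<ge>M. nsq (\<lambda>x. F m x - F n x) \<le> ennreal e" for e n M
  proof -
    have "nsq (\<lambda>x. f x - F n x) = (\<integral>\<^sup>+x. liminf (\<lambda>j. ennreal ((cmod (F (r j) x - F n x))\<^sup>2)) \<partial>lborel)"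
      unfolding nsq_def using lim
    proof (intro nn_integral_cong_AE, eventually_elim)
      case (elim x)
      then have "(\<lambda>j. ennreal ((cmod (F (r j) x - F n x))\<^sup>2)) \<longlonglongrightarrow> ennreal ((cmod (f x - F n x))\<^sup>2)"
        by (intro tendsto_ennrealI tendsto_intros)
      then show ?case by (rule lim_imp_Liminf[OF sequentially_bot, symmetric])
    qed
    also have "\<dots> \<le> liminf (\<lambda>j. nsq (\<lambda>x. F (r j) x - F n x))"
      unfolding nsq_def by (rule nn_integral_liminf) auto
    also have "\<dots> \<le> liminf (\<lambda>j. ennreal e)"
    proof (rule Liminf_mono)
      have "eventually (\<lambda>j. r j \<ge> M) sequentially"
        using filterlim_subseq[OF r_mono] by (simp add: filterlim_at_top)
      then show "eventually (\<lambda>j. nsq (\<lambda>x. F (r j) x - F n x) \<le> ennreal e) sequentially"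
        by eventually_elim (use n in auto)
    qed
    finally show ?thesis by (simp add: Liminf_const)
  qed
  \<comment> \<open>The limit is square integrable because it lies at finite distance from one
    member of the sequence.\<close>
  obtain N1 where "\<forall>m\<ge>N1. \<forall>n\<ge>N1. nsq (\<lambda>x. F m x - F n x) \<le> ennreal 1" using Cauchy[of 1] by auto
  then have "nsq (\<lambda>x. f x - F N1 x) \<le> ennreal 1" by (intro fatou) auto
  then have "square_integrable (\<lambda>x. f x - F N1 x)"
    by (auto simp: square_integrable_iff intro: le_less_trans)
  from square_integrable_add[OF this F[of N1]] have "square_integrable f" by simp
  moreover have "(\<lambda>n. nsq (\<lambda>x. f x - F n x)) \<longlonglongrightarrow> 0"
  proof (rule tendsto_ennreal_0I)
    fix e :: real assume e: "e > 0"
    obtain M where "\<forall>m\<ge>M. \<forall>n\<ge>M. nsq (\<lambda>x. F m x - F n x) \<le> ennreal e" using Cauchy[OF e] by auto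
    then show "eventually (\<lambda>n. nsq (\<lambda>x. f x - F n x) \<le> ennreal e) sequentially"
      by (intro eventually_sequentiallyI[of M] fatou[OF e, of M]) auto
  qed
  ultimately show ?thesis by blast
qed

section \<open>Cauchy-Schwarz and consequences of L^2 convergence\<close>

lemma square_integrable_mult_integrable:
  assumes "square_integrable f" "square_integrable g"
  shows "integrable lborel (\<lambda>x. f x * g x)"
    and "(ennreal (cmod (LINT x|lborel. f x * g x)))\<^sup>2 \<le> nsq f * nsq g"
proof -
  have [measurable]: "f \<in> borel_measurable borel" "g \<in> borel_measurable borel"
    and fin: "nsq f < \<infinity>" "nsq g < \<infinity>"
    using assms by (auto simp: square_integrable_iff)
  have cs: "(\<integral>\<^sup>+x. ennreal (cmod (f x)) * ennreal (cmod (g x)) \<partial>lborel)\<^sup>2 \<le> nsq f * nsq g"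
    unfolding nsq_def
    using Cauchy_Schwarz_nn_integral[of "\<lambda>x. ennreal (cmod (f x))" lborel "\<lambda>x. ennreal (cmod (g x))"]
    by (simp add: ennreal_power)
  also have "\<dots> < \<infinity>" using fin by (simp add: ennreal_mult_less_top)
  finally have lt: "(\<integral>\<^sup>+x. ennreal (cmod (f x)) * ennreal (cmod (g x)) \<partial>lborel) < \<infinity>"
    by (simp add: power_less_top_ennreal)
  then show i: "integrable lborel (\<lambda>x. f x * g x)"
    by (subst integrable_iff_bounded) (auto simp: norm_mult ennreal_mult)
  have "ennreal (cmod (LINT x|lborel. f x * g x)) \<le> (\<integral>\<^sup>+x. ennreal (cmod (f x)) * ennreal (cmod (g x)) \<partial>lborel)"
    using integral_norm_bound_ennreal[OF i] by (simp add: norm_mult ennreal_mult)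
  then show "(ennreal (cmod (LINT x|lborel. f x * g x)))\<^sup>2 \<le> nsq f * nsq g"
    using cs power_mono[of "ennreal (cmod (LINT x|lborel. f x * g x))" _ 2] by (meson order_trans zero_le)
qed

lemma L2_inner_tendsto:
  assumes f: "square_integrable f" and g: "square_integrable g" and G: "\<And>n. square_integrable (G n)"
    and lim: "(\<lambda>n. nsq (\<lambda>x. g x - G n x)) \<longlonglongrightarrow> 0"
  shows "(\<lambda>n. LINT x|lborel. f x * G n x) \<longlonglongrightarrow> (LINT x|lborel. f x * g x)"
proof -
  have "(\<lambda>n. nsq f * nsq (\<lambda>x. g x - G n x)) \<longlonglongrightarrow> nsq f * 0"
    using f by (intro tendsto_mult_ennreal tendsto_const lim) (auto simp: square_integrable_iff)
  then have l0: "(\<lambda>n. nsq f * nsq (\<lambda>x. g x - G n x)) \<longlonglongrightarrow> 0" by simp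
  have "(\<lambda>n. ennreal ((cmod (LINT x|lborel. f x * (g x - G n x)))\<^sup>2)) \<longlonglongrightarrow> 0"
  proof (rule tendsto_sandwich[OF _ _ tendsto_const l0])
    show "\<forall>\<^sub>F n in sequentially. ennreal ((cmod (LINT x|lborel. f x * (g x - G n x)))\<^sup>2) \<le> nsq f * nsq (\<lambda>x. g x - G n x)"
      using square_integrable_mult_integrable(2)[OF f square_integrable_diff[OF g G]]
      by (auto simp: ennreal_power)
  qed simp
  then have "(\<lambda>n. (cmod (LINT x|lborel. f x * (g x - G n x)))\<^sup>2) \<longlonglongrightarrow> 0"
    by (subst (asm) ennreal_0[symmetric], subst (asm) tendsto_ennreal_iff) auto
  from tendsto_real_sqrt[OF this] have "(\<lambda>n. LINT x|lborel. f x * (g x - G n x)) \<longlonglongrightarrow> 0"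
    by (simp add: tendsto_norm_zero_iff)
  moreover have "(LINT x|lborel. f x * (g x - G n x)) = (LINT x|lborel. f x * g x) - (LINT x|lborel. f x * G n x)" for n
    using square_integrable_mult_integrable(1)[OF f g] square_integrable_mult_integrable(1)[OF f G]
    by (simp add: right_diff_distrib)
  ultimately have "(\<lambda>n. (LINT x|lborel. f x * g x) - ((LINT x|lborel. f x * g x) - (LINT x|lborel. f x * G n x)))
     \<longlonglongrightarrow> (LINT x|lborel. f x * g x) - 0"
    by (intro tendsto_diff tendsto_const) simp
  then show ?thesis by simp
qed

lemma L2_limit_unique:
  assumes [measurable]: "f \<in> borel_measurable borel" "g \<in> borel_measurable borel" "\<And>n. F n \<in> borel_measurable borel"
    and f: "(\<lambda>n. nsq (\<lambda>x. f x - F n x)) \<longlonglongrightarrow> 0" and g: "(\<lambda>n. nsq (\<lambda>x. g x - F n x)) \<longlonglongrightarrow> 0"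
  shows "AE x in lborel. f x = g x"
proof -
  have "(\<lambda>n. 2 * nsq (\<lambda>x. f x - F n x) + 2 * nsq (\<lambda>x. g x - F n x)) \<longlonglongrightarrow> 2 * 0 + 2 * 0"
    by (intro tendsto_add tendsto_mult_ennreal tendsto_const f g) auto
  moreover have "nsq (\<lambda>x. f x - g x) \<le> 2 * nsq (\<lambda>x. f x - F n x) + 2 * nsq (\<lambda>x. g x - F n x)" for n
    using nsq_triangle[of f "F n" g] nsq_minus_commute[of "F n" g] by simp
  ultimately have "nsq (\<lambda>x. f x - g x) \<le> 2 * 0 + 2 * 0"
    by (intro tendsto_lowerbound[where F=sequentially]) auto
  then have "AE x in lborel. f x - g x = 0"
    by (subst nsq_zero_iff[symmetric]) auto
  then show ?thesis by simp
qed

text \<open>Young's inequality in both directions squeezes the norms, with a parameter that tends to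
  0 more slowly than the squared distance.\<close>

lemma L2_tendsto_nsq:
  assumes f: "square_integrable f" and F: "\<And>n. square_integrable (F n)"
    and lim: "(\<lambda>n. nsq (\<lambda>x. f x - F n x)) \<longlonglongrightarrow> 0"
  shows "(\<lambda>n. nsq (F n)) \<longlonglongrightarrow> nsq f"
proof -
  define a where "a n = enn2real (nsq (F n))" for n
  define b where "b = enn2real (nsq f)"
  define d where "d n = enn2real (nsq (\<lambda>x. f x - F n x))" for n
  \<comment> \<open>The choice makes both \<open>\<delta> n\<close> and
    \<open>d n / \<delta> n\<close> tend to 0; the summand 1/(n+1) keeps \<open>\<delta> n\<close>
    positive when \<open>d n\<close> is 0.\<close>
  define \<delta> where "\<delta> n = sqrt (d n) + 1 / real (Suc n)" for n
  have [measurable]: "f \<in> borel_measurable borel" "F n \<in> borel_measurable borel" for n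
    using f F by (auto simp: square_integrable_iff)
  have a: "nsq (F n) = ennreal (a n)" for n
    using F[of n] by (simp add: a_def square_integrable_iff)
  have b: "nsq f = ennreal b" using f by (simp add: b_def square_integrable_iff)
  have d: "nsq (\<lambda>x. f x - F n x) = ennreal (d n)" for n
    using square_integrable_diff[OF f F[of n]] by (simp add: d_def square_integrable_iff)
  have d': "nsq (\<lambda>x. F n x - f x) = ennreal (d n)" for n
    using d[of n] nsq_minus_commute[of "F n" f] by simp
  have nn: "a n \<ge> 0" "b \<ge> 0" "d n \<ge> 0" for n by (auto simp: a_def b_def d_def)
  have \<delta>: "\<delta> n > 0" for n by (simp add: \<delta>_def nn add_nonneg_pos)
  have d0: "d \<longlonglongrightarrow> 0"
    using lim unfolding d by (subst (asm) ennreal_0[symmetric], subst (asm) tendsto_ennreal_iff) (auto simp: nn)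
  have \<delta>0: "\<delta> \<longlonglongrightarrow> 0"
    unfolding \<delta>_def using tendsto_add[OF tendsto_real_sqrt[OF d0] LIMSEQ_inverse_real_of_nat]
    by (simp add: inverse_eq_divide)
  have dd: "d n / \<delta> n \<le> sqrt (d n)" for n
  proof -
    have "d n = sqrt (d n) * sqrt (d n)" using nn by simp
    also have "\<dots> \<le> sqrt (d n) * \<delta> n"
      by (intro mult_left_mono) (auto simp: \<delta>_def nn)
    finally show ?thesis using \<delta>[of n] by (simp add: field_simps)
  qed
  have up: "a n \<le> (1 + \<delta> n) * b + (d n + sqrt (d n))" for n
  proof -
    have "ennreal (a n) \<le> ennreal (1 + \<delta> n) * ennreal b + ennreal (1 + 1 / \<delta> n) * ennreal (d n)"
      using nsq_add_le[of f "\<lambda>x. F n x - f x", OF _ _ \<delta>[of n]] by (simp add: a b d')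
    also have "\<dots> = ennreal ((1 + \<delta> n) * b + (1 + 1 / \<delta> n) * d n)"
      using \<delta>[of n] nn by (intro ennreal_lincomb) auto
    finally have "a n \<le> (1 + \<delta> n) * b + (1 + 1 / \<delta> n) * d n"
      using \<delta>[of n] nn(1,3)[of n] nn(2) by (subst (asm) ennreal_le_iff) auto
    then show ?thesis using dd[of n] by (simp add: algebra_simps)
  qed
  have lo: "b \<le> (1 + \<delta> n) * a n + (d n + sqrt (d n))" for n
  proof -
    have "ennreal b \<le> ennreal (1 + \<delta> n) * ennreal (a n) + ennreal (1 + 1 / \<delta> n) * ennreal (d n)"
      using nsq_add_le[of "F n" "\<lambda>x. f x - F n x", OF _ _ \<delta>[of n]] by (simp add: a b d)
    also have "\<dots> = ennreal ((1 + \<delta> n) * a n + (1 + 1 / \<delta> n) * d n)"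
      using \<delta>[of n] nn by (intro ennreal_lincomb) auto
    finally have "b \<le> (1 + \<delta> n) * a n + (1 + 1 / \<delta> n) * d n"
      using \<delta>[of n] nn(1,3)[of n] nn(2) by (subst (asm) ennreal_le_iff) auto
    then show ?thesis using dd[of n] by (simp add: algebra_simps)
  qed
  have "a \<longlonglongrightarrow> b"
  proof (rule tendsto_sandwich)
    show "\<forall>\<^sub>F n in sequentially. (b - (d n + sqrt (d n))) / (1 + \<delta> n) \<le> a n"
      using lo \<delta> by (intro always_eventually allI) (simp add: pos_divide_le_eq add_pos_pos algebra_simps)
    show "\<forall>\<^sub>F n in sequentially. a n \<le> (1 + \<delta> n) * b + (d n + sqrt (d n))"
      using up by simp
    show "(\<lambda>n. (b - (d n + sqrt (d n))) / (1 + \<delta> n)) \<longlonglongrightarrow> b"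
      using d0 \<delta>0 by (auto intro!: tendsto_eq_intros)
    show "(\<lambda>n. (1 + \<delta> n) * b + (d n + sqrt (d n))) \<longlonglongrightarrow> b"
      using d0 \<delta>0 by (auto intro!: tendsto_eq_intros)
  qed
  then show ?thesis unfolding a b by (rule tendsto_ennrealI)
qed

lemma L2_AE_subseq:
  assumes f: "square_integrable f" and F: "\<And>n. square_integrable (F n)"
    and lim: "(\<lambda>n. nsq (\<lambda>x. f x - F n x)) \<longlonglongrightarrow> 0"
  shows "\<exists>r::nat\<Rightarrow>nat. strict_mono r \<and> (AE x in lborel. (\<lambda>n. F (r n) x) \<longlonglongrightarrow> f x)"
proof -
  have int: "integrable lborel (\<lambda>x. (cmod (f x - F n x))\<^sup>2)" for n
    using square_integrable_diff[OF f F[of n]] by (simp add: square_integrable_def)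
  have "(\<lambda>n. ennreal (LINT x|lborel. (cmod (f x - F n x))\<^sup>2)) \<longlonglongrightarrow> ennreal 0"
    using lim int unfolding nsq_def by (simp add: nn_integral_eq_integral)
  then have "(\<lambda>n. LINT x|lborel. norm ((cmod (f x - F n x))\<^sup>2)) \<longlonglongrightarrow> 0"
    by (subst (asm) tendsto_ennreal_iff) auto
  from tendsto_L1_AE_subseq[OF int this] obtain r where r: "strict_mono r"
    "AE x in lborel. (\<lambda>n. (cmod (f x - F (r n) x))\<^sup>2) \<longlonglongrightarrow> 0" by auto
  from r(2) have "AE x in lborel. (\<lambda>n. F (r n) x) \<longlonglongrightarrow> f x"
  proof eventually_elim
    case (elim x)
    from tendsto_real_sqrt[OF this] have "(\<lambda>n. f x - F (r n) x) \<longlonglongrightarrow> 0"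
      by (simp add: tendsto_norm_zero_iff)
    from tendsto_diff[OF tendsto_const[of "f x"] this] show ?case by simp
  qed
  with r(1) show ?thesis by blast
qed

text \<open>The majorant takes values in \<open>ennreal\<close> because the later majorants are
  convolution powers, which may be infinite on a null set.\<close>

lemma nsq_dominated_tendsto_0:
  assumes [measurable]: "f \<in> borel_measurable borel" "\<And>n. F n \<in> borel_measurable borel"
    and w [measurable]: "w \<in> borel_measurable borel" and fin: "(\<integral>\<^sup>+x. (w x)\<^sup>2 \<partial>lborel) < \<infinity>"
    and bd: "\<And>n. AE x in lborel. ennreal (cmod (f x - F n x)) \<le> w x"
    and lim: "AE x in lborel. (\<lambda>n. F n x) \<longlonglongrightarrow> f x"
  shows "(\<lambda>n. nsq (\<lambda>x. f x - F n x)) \<longlonglongrightarrow> 0"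
proof -
  have "(\<lambda>n. \<integral>\<^sup>+x. ennreal ((cmod (f x - F n x))\<^sup>2) \<partial>lborel) \<longlonglongrightarrow> (\<integral>\<^sup>+(x::real). 0 \<partial>lborel)"
  proof (rule nn_integral_dominated_convergence[where w="\<lambda>x. (w x)\<^sup>2"])
    show "AE x in lborel. ennreal ((cmod (f x - F n x))\<^sup>2) \<le> (w x)\<^sup>2" for n
      using bd[of n]
    proof eventually_elim
      case (elim x)
      from power_mono[OF this, of 2] show ?case by (simp add: ennreal_power)
    qed
    show "AE x in lborel. (\<lambda>n. ennreal ((cmod (f x - F n x))\<^sup>2)) \<longlonglongrightarrow> 0"
      using lim
    proof eventually_elim
      case (elim x)
      then have "(\<lambda>n. (cmod (f x - F n x))\<^sup>2) \<longlonglongrightarrow> (cmod (f x - f x))\<^sup>2"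
        by (intro tendsto_intros)
      then have "(\<lambda>n. ennreal ((cmod (f x - F n x))\<^sup>2)) \<longlonglongrightarrow> ennreal ((cmod (f x - f x))\<^sup>2)"
        by (rule tendsto_ennrealI)
      then show ?case by simp
    qed
  qed (use fin in auto)
  then show ?thesis by (simp add: nsq_def)
qed

subsection \<open>Plancherel for integrable functions\<close>

lemma cis_measurable [measurable]: "cis \<in> borel_measurable borel"
  by (intro borel_measurable_continuous_onI continuous_intros)

lemma cnj_measurable [measurable]: "cnj \<in> borel_measurable borel"
  by (intro borel_measurable_continuous_onI continuous_intros)

lemma fourier_L1_measurable [measurable]:
  assumes [measurable]: "f \<in> borel_measurable borel"
  shows "fourier_L1 f \<in> borel_measurable borel"
  unfolding fourier_L1_def by measurable

lemma integrable_mult_cis: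
  fixes f :: "real \<Rightarrow> complex"
  assumes "integrable lborel f" and [measurable]: "k \<in> borel_measurable borel"
  shows "integrable lborel (\<lambda>x. f x * cis (k x))"
  using assms(1) by (rule integrable_dominated) (use assms(1) in \<open>auto simp: norm_mult\<close>)

lemma fourier_L1_diff:
  assumes "integrable lborel f" "integrable lborel g"
  shows "fourier_L1 (\<lambda>x. f x - g x) \<xi> = fourier_L1 f \<xi> - fourier_L1 g \<xi>"
  unfolding fourier_L1_def using assms
  by (simp add: integrable_mult_cis left_diff_distrib right_diff_distrib del: of_real_divide)

lemma fourier_L1_bound:
  assumes "integrable lborel f"
  shows "cmod (fourier_L1 f \<xi>) \<le> (LINT x|lborel. cmod (f x))"
proof -
  have 1: "1 / sqrt (2 * pi) \<le> 1"
    using pi_ge_two by (simp add: real_le_rsqrt)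
  have "cmod (fourier_L1 f \<xi>) = 1 / sqrt (2 * pi) * cmod (LINT x|lborel. f x * cis (- (\<xi> * x)))"
    unfolding fourier_L1_def by (simp add: norm_mult norm_divide)
  also have "\<dots> \<le> 1 * cmod (LINT x|lborel. f x * cis (- (\<xi> * x)))"
    by (intro mult_right_mono 1) auto
  also have "\<dots> \<le> (LINT x|lborel. cmod (f x))"
    using integral_norm_bound[of lborel "\<lambda>x. f x * cis (- (\<xi> * x))"] by (simp add: norm_mult)
  finally show ?thesis .
qed

text \<open>No integrability is assumed: the integral of a nonintegrable function is 0 by
  convention.\<close>

lemma norm_integral_le_nn:
  fixes f :: "'a \<Rightarrow> complex"
  shows "ennreal (cmod (integral\<^sup>L M f)) \<le> (\<integral>\<^sup>+x. ennreal (cmod (f x)) \<partial>M)"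
  by (cases "integrable M f") (auto simp: not_integrable_integral_eq intro: integral_norm_bound_ennreal)

lemma integrable_prod_mult:
  fixes f g :: "real \<Rightarrow> complex"
  assumes "integrable lborel f" "integrable lborel g"
  shows "integrable (lborel \<Otimes>\<^sub>M lborel) (\<lambda>(x, y). f x * g y)"
proof -
  have [measurable]: "f \<in> borel_measurable borel" "g \<in> borel_measurable borel"
    using assms by auto
  have "(\<integral>\<^sup>+p. ennreal (norm (case p of (x, y) \<Rightarrow> f x * g y)) \<partial>(lborel \<Otimes>\<^sub>M lborel))
      = (\<integral>\<^sup>+x. \<integral>\<^sup>+y. ennreal (norm (f x)) * ennreal (norm (g y)) \<partial>lborel \<partial>lborel)"
    by (subst lborel.nn_integral_fst[symmetric]) (auto simp: norm_mult ennreal_mult)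
  also have "\<dots> = (\<integral>\<^sup>+x. ennreal (norm (f x)) \<partial>lborel) * (\<integral>\<^sup>+y. ennreal (norm (g y)) \<partial>lborel)"
    by (simp add: nn_integral_cmult nn_integral_multc)
  also have "\<dots> < \<infinity>"
    using assms by (simp add: integrable_iff_bounded ennreal_mult_less_top)
  finally show ?thesis by (simp add: integrable_iff_bounded)
qed

text \<open>Fubini, since the kernel is symmetric in \<open>x\<close> and
  \<open>\<xi>\<close>.\<close>

lemma fourier_mult_formula:
  assumes f: "integrable lborel f" and g: "integrable lborel g"
  shows "(LINT \<xi>|lborel. fourier_L1 f \<xi> * g \<xi>) = (LINT x|lborel. f x * fourier_L1 g x)"
proof -
  have [measurable]: "f \<in> borel_measurable borel" "g \<in> borel_measurable borel"
    using assms by auto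
  let ?c = "complex_of_real (1 / sqrt (2 * pi))"
  have int: "integrable (lborel \<Otimes>\<^sub>M lborel) (\<lambda>(x, \<xi>). f x * g \<xi> * cis (- (\<xi> * x)))"
    by (rule integrable_dominated[OF integrable_prod_mult[OF f g]]) (auto simp: norm_mult)
  have "(LINT \<xi>|lborel. fourier_L1 f \<xi> * g \<xi>) = (LINT \<xi>|lborel. ?c * (LINT x|lborel. f x * g \<xi> * cis (- (\<xi> * x))))"
    unfolding fourier_L1_def
    by (intro lebesgue_integral_cong refl, subst mult.assoc, subst integral_mult_left_zero[symmetric])
       (simp add: mult_ac)
  also have "\<dots> = ?c * (LINT \<xi>|lborel. LINT x|lborel. f x * g \<xi> * cis (- (\<xi> * x)))"
    by simp
  also have "(LINT \<xi>|lborel. LINT x|lborel. f x * g \<xi> * cis (- (\<xi> * x)))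
      = (LINT x|lborel. LINT \<xi>|lborel. f x * g \<xi> * cis (- (\<xi> * x)))"
    using lborel_pair.Fubini_integral[of "\<lambda>x \<xi>. f x * g \<xi> * cis (- (\<xi> * x))"] int by simp
  also have "?c * \<dots> = (LINT x|lborel. f x * fourier_L1 g x)"
    unfolding fourier_L1_def
    by (subst integral_mult_right_zero[symmetric], intro lebesgue_integral_cong refl)
       (simp add: mult_ac flip: integral_mult_right_zero)
  finally show ?thesis .
qed

text \<open>A rescaling by \<open>h\<close> of the characteristic function of the standard normal
  distribution.\<close>

lemma gaussian_fourier:
  assumes h: "h > 0"
  shows "(LINT \<xi>|lborel. complex_of_real (exp (- (h * \<xi>)\<^sup>2 / 2)) * cis (\<xi> * z))
    = complex_of_real (sqrt (2 * pi) / h * exp (- (z / h)\<^sup>2 / 2))"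
proof -
  have "complex_of_real (exp (- ((z / h)\<^sup>2) / 2)) = char std_normal_distribution (z / h)"
    by (simp add: char_std_normal_distribution)
  also have "\<dots> = (LINT x|lborel. std_normal_density x *\<^sub>R iexp (z / h * x))"
    unfolding char_def by (subst integral_density) auto
  also have "\<dots> = h *\<^sub>R (LINT x|lborel. std_normal_density (h * x) *\<^sub>R iexp (z / h * (h * x)))"
    using lborel_integral_real_affine[of h "\<lambda>x. std_normal_density x *\<^sub>R iexp (z / h * x)" 0] h by simp
  also have "\<dots> = (h / sqrt (2 * pi)) *\<^sub>R (LINT x|lborel. complex_of_real (exp (- (h * x)\<^sup>2 / 2)) * cis (x * z))"
    using h by (simp add: std_normal_density_def cis_conv_exp scaleR_conv_of_real mult_ac flip: integral_mult_right_zero)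
  finally have "(sqrt (2 * pi) / h) *\<^sub>R complex_of_real (exp (- ((z / h)\<^sup>2) / 2))
      = (LINT x|lborel. complex_of_real (exp (- (h * x)\<^sup>2 / 2)) * cis (x * z))"
    using h by simp
  then show ?thesis by (simp add: scaleR_conv_of_real)
qed

text \<open>If it failed, the integral would have the default value 0, but the preceding formula at
  z = 0 gives a positive number.\<close>

lemma gaussian_integrable:
  assumes "h > 0"
  shows "integrable lborel (\<lambda>\<xi>. complex_of_real (exp (- (h * \<xi>)\<^sup>2 / 2)))"
proof (rule ccontr)
  assume "\<not> ?thesis"
  from not_integrable_integral_eq[OF this] show False
    using gaussian_fourier[OF assms, of 0] assms by simp
qed

text \<open>A regularized Plancherel identity. The transform is only known to be bounded, so
  Gaussian damping is what makes its square integrable; moving one transform across by the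
  multiplication formula turns the damping into an average of translates of \<open>f\<close> at
  scale \<open>h\<close>. For h tending to 0 the right side formally becomes the integral of
  |f|^2.\<close>

lemma fourier_gaussian_energy:
  assumes f: "integrable lborel f" and h: "h > 0"
  shows "(LINT \<xi>|lborel. complex_of_real ((cmod (fourier_L1 f \<xi>))\<^sup>2 * exp (- (h * \<xi>)\<^sup>2 / 2)))
    = (LINT x|lborel. f x * (LINT z|lborel. cnj (f (x + h * z)) * complex_of_real (std_normal_density z)))"
proof -
  have [measurable]: "f \<in> borel_measurable borel" using f by auto
  let ?\<gamma> = "\<lambda>z. complex_of_real (std_normal_density z)"
  let ?g = "\<lambda>\<xi>. complex_of_real (exp (- (h * \<xi>)\<^sup>2 / 2))"
  \<comment> \<open>Chosen so that its product with the transform of \<open>f\<close> is the damped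
    energy density.\<close>
  define \<phi> where "\<phi> \<xi> = cnj (fourier_L1 f \<xi>) * ?g \<xi>" for \<xi>
  have cnjf: "integrable lborel (\<lambda>x. cnj (f x))" using f by simp
  have [measurable]: "\<phi> \<in> borel_measurable borel" unfolding \<phi>_def by measurable
  have \<phi>_int: "integrable lborel \<phi>"
    by (rule integrable_dominated[OF integrable_mult_right[OF gaussian_integrable[OF h], where c="complex_of_real (LINT x|lborel. cmod (f x))"]])
       (auto simp: \<phi>_def norm_mult abs_of_nonneg intro!: fourier_L1_bound[OF f] mult_right_mono)
  have cnjF: "cnj (fourier_L1 f (- \<xi>)) = fourier_L1 (\<lambda>x. cnj (f x)) \<xi>" for \<xi>
    unfolding fourier_L1_def
    using integral_bounded_linear[OF bounded_linear_cnj integrable_mult_cis[OF f, of "\<lambda>x. \<xi> * x"]] by (simp add: cis_cnj)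
  \<comment> \<open>After a reflection, the multiplication formula moves the transform from
    \<open>cnj f\<close> onto a modulated Gaussian, whose transform is a Gaussian centred at
    \<open>x\<close>; the substitution y = x + h z normalizes it.\<close>
  have inner: "fourier_L1 \<phi> x = (LINT z|lborel. cnj (f (x + h * z)) * ?\<gamma> z)" for x
  proof -
    have "(LINT \<xi>|lborel. \<phi> \<xi> * cis (- (\<xi> * x))) = (LINT \<xi>|lborel. \<phi> (- \<xi>) * cis (\<xi> * x))"
      using lborel_integral_real_affine[of "-1" "\<lambda>\<xi>. \<phi> \<xi> * cis (- (\<xi> * x))" 0] by simp
    also have "\<dots> = (LINT \<xi>|lborel. fourier_L1 (\<lambda>x. cnj (f x)) \<xi> * (?g \<xi> * cis (\<xi> * x)))"
      by (simp add: \<phi>_def cnjF mult.assoc)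
    also have "\<dots> = (LINT y|lborel. cnj (f y) * fourier_L1 (\<lambda>\<xi>. ?g \<xi> * cis (\<xi> * x)) y)"
      by (intro fourier_mult_formula cnjf integrable_mult_cis gaussian_integrable h) auto
    also have "\<dots> = (LINT y|lborel. cnj (f y) * complex_of_real (1 / h * exp (- ((y - x) / h)\<^sup>2 / 2)))"
    proof (intro lebesgue_integral_cong refl)
      fix y
      have "(LINT \<xi>|lborel. ?g \<xi> * cis (\<xi> * x) * cis (- (y * \<xi>))) = (LINT \<xi>|lborel. ?g \<xi> * cis (\<xi> * (x - y)))"
        by (intro lebesgue_integral_cong refl) (simp add: mult.assoc cis_mult algebra_simps)
      also have "\<dots> = complex_of_real (sqrt (2 * pi) / h * exp (- ((x - y) / h)\<^sup>2 / 2))"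
        by (rule gaussian_fourier[OF h])
      finally have "fourier_L1 (\<lambda>\<xi>. ?g \<xi> * cis (\<xi> * x)) y = complex_of_real (1 / h * exp (- ((y - x) / h)\<^sup>2 / 2))"
        unfolding fourier_L1_def by (simp add: power_divide power2_commute)
      then show "cnj (f y) * fourier_L1 (\<lambda>\<xi>. ?g \<xi> * cis (\<xi> * x)) y = cnj (f y) * complex_of_real (1 / h * exp (- ((y - x) / h)\<^sup>2 / 2))"
        by simp
    qed
    also have "\<dots> = h *\<^sub>R (LINT z|lborel. cnj (f (x + h * z)) * complex_of_real (1 / h * exp (- z\<^sup>2 / 2)))"
      using h lborel_integral_real_affine[of h "\<lambda>y. cnj (f y) * complex_of_real (1 / h * exp (- ((y - x) / h)\<^sup>2 / 2))" x]
      by simp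
    also have "(LINT z|lborel. cnj (f (x + h * z)) * complex_of_real (1 / h * exp (- z\<^sup>2 / 2)))
        = complex_of_real (1 / h) * (LINT z|lborel. cnj (f (x + h * z)) * complex_of_real (exp (- z\<^sup>2 / 2)))"
      by (subst integral_mult_right_zero[symmetric]) (simp add: mult_ac)
    also have "h *\<^sub>R \<dots> = complex_of_real (sqrt (2 * pi)) * (complex_of_real (1 / sqrt (2 * pi)) *
        (LINT z|lborel. cnj (f (x + h * z)) * complex_of_real (exp (- z\<^sup>2 / 2))))"
      using h by (simp add: scaleR_conv_of_real)
    also have "complex_of_real (1 / sqrt (2 * pi)) * (LINT z|lborel. cnj (f (x + h * z)) * complex_of_real (exp (- z\<^sup>2 / 2)))
        = (LINT z|lborel. cnj (f (x + h * z)) * ?\<gamma> z)"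
      by (subst integral_mult_right_zero[symmetric]) (simp add: std_normal_density_def mult_ac)
    finally show ?thesis unfolding fourier_L1_def by (simp add: mult.commute[of x])
  qed
  have "(LINT \<xi>|lborel. complex_of_real ((cmod (fourier_L1 f \<xi>))\<^sup>2 * exp (- (h * \<xi>)\<^sup>2 / 2)))
      = (LINT \<xi>|lborel. fourier_L1 f \<xi> * \<phi> \<xi>)"
    unfolding \<phi>_def by (intro lebesgue_integral_cong refl)
       (simp add: mult.assoc[symmetric] complex_norm_square[symmetric])
  also have "\<dots> = (LINT x|lborel. f x * fourier_L1 \<phi> x)"
    by (rule fourier_mult_formula[OF f \<phi>_int])
  finally show ?thesis by (simp add: inner)
qed

lemma nn_integral_shift:
  fixes f :: "real \<Rightarrow> ennreal"
  assumes [measurable]: "f \<in> borel_measurable borel"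
  shows "(\<integral>\<^sup>+x. f (x + t) \<partial>lborel) = (\<integral>\<^sup>+x. f x \<partial>lborel)"
  using nn_integral_real_affine[of f 1 t] by (simp add: add.commute)

lemma nn_integral_std_normal: "(\<integral>\<^sup>+z. ennreal (std_normal_density z) \<partial>lborel) = 1"
  using prob_space_normal_density[of 1 0, THEN prob_space.emeasure_space_1]
  by (simp add: emeasure_density)

text \<open>The Gaussian-weighted energy is at most \<open>\<integral>\<integral> |f x| |f (x + h z)| \<gamma>(z) dx dz\<close>, which AM-GM bounds
  uniformly in \<open>h\<close>.\<close>
lemma fourier_Bessel:
  assumes f: "integrable lborel f"
  shows "nsq (fourier_L1 f) \<le> nsq f"
proof -
  have [measurable]: "f \<in> borel_measurable borel" using f by auto
  let ?\<gamma> = "\<lambda>z. complex_of_real (std_normal_density z)"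
  let ?F = "fourier_L1 f"
  have gauss: "(\<integral>\<^sup>+\<xi>. ennreal ((cmod (?F \<xi>))\<^sup>2 * exp (- (h * \<xi>)\<^sup>2 / 2)) \<partial>lborel) \<le> nsq f" if h: "h > 0" for h
  proof -
    let ?e = "\<lambda>\<xi>. (cmod (?F \<xi>))\<^sup>2 * exp (- (h * \<xi>)\<^sup>2 / 2)"
    let ?E = "\<lambda>x z. ((cmod (f x))\<^sup>2 / 2 + (cmod (f (x + h * z)))\<^sup>2 / 2) * std_normal_density z"
    let ?u = "\<lambda>x. LINT z|lborel. cnj (f (x + h * z)) * ?\<gamma> z"
    have int: "integrable lborel (\<lambda>\<xi>. ?e \<xi>)"
    proof (rule integrable_dominated)
      show "integrable lborel (\<lambda>\<xi>. (LINT x|lborel. cmod (f x))\<^sup>2 * cmod (complex_of_real (exp (- (h * \<xi>)\<^sup>2 / 2))))"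
        by (intro integrable_mult_right integrable_norm gaussian_integrable h)
      show "AE \<xi> in lborel. norm (?e \<xi>)
          \<le> norm ((LINT x|lborel. cmod (f x))\<^sup>2 * cmod (complex_of_real (exp (- (h * \<xi>)\<^sup>2 / 2))))"
        by (auto simp: abs_mult intro!: mult_right_mono power_mono fourier_L1_bound[OF f])
    qed measurable
    have "(\<integral>\<^sup>+\<xi>. ennreal (?e \<xi>) \<partial>lborel)
        = ennreal (LINT \<xi>|lborel. ?e \<xi>)"
      by (intro nn_integral_eq_integral int) auto
    also have "\<dots> = ennreal (cmod (LINT \<xi>|lborel. complex_of_real (?e \<xi>)))"
      by (subst integral_complex_of_real, subst norm_of_real) (simp add: abs_of_nonneg)
    also have "\<dots> = ennreal (cmod (LINT x|lborel. f x * ?u x))"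
      by (subst fourier_gaussian_energy[OF f h]) simp
    also have "\<dots> \<le> (\<integral>\<^sup>+x. ennreal (cmod (f x * ?u x)) \<partial>lborel)"
      by (rule norm_integral_le_nn)
    also have "\<dots> \<le> (\<integral>\<^sup>+x. \<integral>\<^sup>+z. ennreal (?E x z) \<partial>lborel \<partial>lborel)"
    proof (intro nn_integral_mono)
      fix x
      have "ennreal (cmod (f x * ?u x)) = ennreal (cmod (LINT z|lborel. f x * (cnj (f (x + h * z)) * ?\<gamma> z)))"
        by simp
      also have "\<dots> \<le> (\<integral>\<^sup>+z. ennreal (cmod (f x * (cnj (f (x + h * z)) * ?\<gamma> z))) \<partial>lborel)"
        by (rule norm_integral_le_nn)
      also have "\<dots> \<le> (\<integral>\<^sup>+z. ennreal (?E x z) \<partial>lborel)"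
      proof (intro nn_integral_mono ennreal_leI)
        fix z
        have "cmod (f x) * cmod (f (x + h * z)) \<le> (cmod (f x))\<^sup>2 / 2 + (cmod (f (x + h * z)))\<^sup>2 / 2"
          using sum_squares_bound[of "cmod (f x)" "cmod (f (x + h * z))"] by simp
        then show "cmod (f x * (cnj (f (x + h * z)) * ?\<gamma> z))
            \<le> ?E x z"
          by (simp add: norm_mult mult.assoc[symmetric] mult_right_mono)
      qed
      finally show "ennreal (cmod (f x * ?u x)) \<le> \<dots>" .
    qed
    also have "\<dots> = (\<integral>\<^sup>+z. \<integral>\<^sup>+x. ennreal (?E x z) \<partial>lborel \<partial>lborel)"
      by (rule lborel_pair.Fubini') measurable
    also have "\<dots> = (\<integral>\<^sup>+z. nsq f * ennreal (std_normal_density z) \<partial>lborel)"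
    proof (intro nn_integral_cong)
      fix z
      have sh: "(\<integral>\<^sup>+x. ennreal ((cmod (f (x + h * z)))\<^sup>2) \<partial>lborel) = nsq f"
        using nsq_shift[of f "h * z"] by (simp add: nsq_def)
      have "(\<integral>\<^sup>+x. ennreal (?E x z) \<partial>lborel)
          = (\<integral>\<^sup>+x. (ennreal (1/2) * ennreal ((cmod (f x))\<^sup>2) + ennreal (1/2) * ennreal ((cmod (f (x + h * z)))\<^sup>2)) * ennreal (std_normal_density z) \<partial>lborel)"
        by (intro nn_integral_cong, subst ennreal_lincomb) (auto simp: ennreal_mult[symmetric] simp del: ennreal_plus)
      also have "\<dots> = (ennreal (1/2) * nsq f + ennreal (1/2) * nsq f) * ennreal (std_normal_density z)"
        by (simp add: nn_integral_multc nn_integral_add nn_integral_cmult sh) (simp add: nsq_def)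
      also have "ennreal (1/2) * nsq f + ennreal (1/2) * nsq f = nsq f"
        by (subst distrib_right[symmetric], subst ennreal_plus[symmetric]) auto
      finally show "(\<integral>\<^sup>+x. ennreal (?E x z) \<partial>lborel)
          = nsq f * ennreal (std_normal_density z)" .
    qed
    also have "\<dots> = nsq f"
      by (simp add: nn_integral_cmult nn_integral_std_normal)
    finally show ?thesis .
  qed
  \<comment> \<open>The damping is removed by Fatou along h = 1/(n+1), which costs only the
    inequality.\<close>
  have "nsq ?F = (\<integral>\<^sup>+\<xi>. liminf (\<lambda>n. ennreal ((cmod (?F \<xi>))\<^sup>2 * exp (- (1 / real (Suc n) * \<xi>)\<^sup>2 / 2))) \<partial>lborel)"
    unfolding nsq_def
  proof (intro nn_integral_cong)
    fix \<xi>
    have "(\<lambda>n. (cmod (?F \<xi>))\<^sup>2 * exp (- (1 / real (Suc n) * \<xi>)\<^sup>2 / 2)) \<longlonglongrightarrow> (cmod (?F \<xi>))\<^sup>2 * exp (- (0 * \<xi>)\<^sup>2 / 2)"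
      using LIMSEQ_inverse_real_of_nat by (intro tendsto_intros) (auto simp: inverse_eq_divide)
    then show "ennreal ((cmod (?F \<xi>))\<^sup>2) = liminf (\<lambda>n. ennreal ((cmod (?F \<xi>))\<^sup>2 * exp (- (1 / real (Suc n) * \<xi>)\<^sup>2 / 2)))"
      by (intro lim_imp_Liminf[OF sequentially_bot, symmetric] tendsto_ennrealI) simp
  qed
  also have "\<dots> \<le> liminf (\<lambda>n. \<integral>\<^sup>+\<xi>. ennreal ((cmod (?F \<xi>))\<^sup>2 * exp (- (1 / real (Suc n) * \<xi>)\<^sup>2 / 2)) \<partial>lborel)"
    by (rule nn_integral_liminf) measurable
  also have "\<dots> \<le> liminf (\<lambda>n. nsq f)"
    by (intro Liminf_mono always_eventually allI gauss) simp
  finally show ?thesis by (simp add: Liminf_const)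
qed

text \<open>Supplies the inequality opposite to Bessel. Continuity gives pointwise convergence of
  the Gaussian averages to \<open>cnj (f x)\<close>, and boundedness gives the majorants for both
  dominated limits.\<close>

lemma fourier_Plancherel_continuous:
  assumes f: "integrable lborel f" and c: "continuous_on UNIV f" and M: "\<And>x. cmod (f x) \<le> M"
  shows "nsq (fourier_L1 f) = nsq f"
proof (rule antisym)
  have [measurable]: "f \<in> borel_measurable borel" using f by auto
  let ?\<gamma> = "\<lambda>z. complex_of_real (std_normal_density z)"
  have M0: "M \<ge> 0" using M[of 0] norm_ge_zero order_trans by blast
  let ?F = "fourier_L1 f"
  let ?u = "\<lambda>h x. LINT z|lborel. cnj (f (x + h * z)) * ?\<gamma> z"
  have dens: "integrable lborel std_normal_density" by (rule integrable_normal_density) simp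
  have dens1: "(LINT z|lborel. std_normal_density z) = 1" by (rule integral_normal_density) simp
  let ?h = "\<lambda>n. 1 / real (Suc n)"
  have h0: "?h \<longlonglongrightarrow> 0" using LIMSEQ_inverse_real_of_nat by (simp add: inverse_eq_divide)
  have u_lim: "(\<lambda>n. ?u (?h n) x) \<longlonglongrightarrow> cnj (f x)" for x
  proof -
    have "(\<lambda>n. ?u (?h n) x) \<longlonglongrightarrow> (LINT z|lborel. cnj (f x) * ?\<gamma> z)"
    proof (rule integral_dominated_convergence[where w="\<lambda>z. M * std_normal_density z"])
      show "AE z in lborel. (\<lambda>n. cnj (f (x + ?h n * z)) * ?\<gamma> z)
          \<longlonglongrightarrow> cnj (f x) * ?\<gamma> z"
      proof (intro AE_I2 tendsto_intros)
        fix z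
        have "(\<lambda>n. x + ?h n * z) \<longlonglongrightarrow> x + 0 * z" by (intro tendsto_intros h0)
        then show "(\<lambda>n. f (x + ?h n * z)) \<longlonglongrightarrow> f x"
          using c by (auto intro!: isCont_tendsto_compose[of _ f] simp: continuous_on_eq_continuous_at)
      qed
      show "AE z in lborel. norm (cnj (f (x + ?h n * z)) * ?\<gamma> z) \<le> M * std_normal_density z" for n
        by (auto simp: norm_mult intro!: mult_right_mono M)
    qed (use dens in auto)
    also have "(LINT z|lborel. cnj (f x) * ?\<gamma> z) = cnj (f x)"
      by (simp add: dens1)
    finally show ?thesis .
  qed
  have u_bd: "cmod (?u h x) \<le> M" for h x
  proof -
    have "cmod (?u h x) \<le> (LINT z|lborel. cmod (cnj (f (x + h * z)) * ?\<gamma> z))"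
      by (rule integral_norm_bound)
    also have "\<dots> \<le> (LINT z|lborel. M * std_normal_density z)"
      by (intro integral_mono') (use dens in \<open>auto simp: norm_mult M0 intro!: mult_right_mono M\<close>)
    finally show ?thesis by (simp add: dens1)
  qed
  have lim: "(\<lambda>n. LINT x|lborel. f x * ?u (?h n) x) \<longlonglongrightarrow> (LINT x|lborel. f x * cnj (f x))"
  proof (rule integral_dominated_convergence[where w="\<lambda>x. cmod (f x) * M"])
    show "AE x in lborel. (\<lambda>n. f x * ?u (?h n) x) \<longlonglongrightarrow> f x * cnj (f x)"
      by (intro AE_I2 tendsto_intros u_lim)
    show "AE x in lborel. norm (f x * ?u (?h n) x) \<le> cmod (f x) * M" for n
      by (auto simp only: norm_mult intro!: AE_I2 mult_left_mono u_bd norm_ge_zero)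
  qed (use f in auto)
  have int2: "integrable lborel (\<lambda>x. (cmod (f x))\<^sup>2)"
    by (rule integrable_dominated[OF integrable_mult_right[OF integrable_norm[OF f], where c=M]])
       (auto simp: power2_eq_square M0 intro!: mult_right_mono M)
  have "(\<lambda>n. cmod (LINT x|lborel. f x * ?u (?h n) x)) \<longlonglongrightarrow> (LINT x|lborel. (cmod (f x))\<^sup>2)"
  proof -
    have "(LINT x|lborel. f x * cnj (f x)) = complex_of_real (LINT x|lborel. (cmod (f x))\<^sup>2)"
      by (simp only: complex_norm_square[symmetric] integral_complex_of_real)
    then show ?thesis using tendsto_norm[OF lim] by (simp add: abs_of_nonneg del: of_nat_Suc)
  qed
  then have "(\<lambda>n. ennreal (cmod (LINT x|lborel. f x * ?u (?h n) x))) \<longlonglongrightarrow> nsq f"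
    unfolding nsq_def by (subst nn_integral_eq_integral[OF int2]) (auto intro: tendsto_ennrealI)
  then show "nsq f \<le> nsq ?F"
  proof (rule tendsto_upperbound)
    show "\<forall>\<^sub>F n in sequentially. ennreal (cmod (LINT x|lborel. f x * ?u (?h n) x)) \<le> nsq ?F"
    proof (intro always_eventually allI)
      fix n
      have hn: "?h n > 0" by simp
      have "ennreal (cmod (LINT x|lborel. f x * ?u (?h n) x))
          = ennreal (cmod (LINT \<xi>|lborel. complex_of_real ((cmod (?F \<xi>))\<^sup>2 * exp (- (?h n * \<xi>)\<^sup>2 / 2))))"
        by (subst fourier_gaussian_energy[OF f hn]) simp
      also have "\<dots> \<le> (\<integral>\<^sup>+\<xi>. ennreal (cmod (complex_of_real ((cmod (?F \<xi>))\<^sup>2 * exp (- (?h n * \<xi>)\<^sup>2 / 2)))) \<partial>lborel)"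
        by (rule norm_integral_le_nn)
      also have "\<dots> \<le> nsq ?F"
        unfolding nsq_def
        by (intro nn_integral_mono ennreal_leI, subst norm_of_real) (auto simp: abs_mult intro!: mult_left_le)
      finally show "ennreal (cmod (LINT x|lborel. f x * ?u (?h n) x)) \<le> nsq ?F" .
    qed
  qed simp
  show "nsq ?F \<le> nsq f" by (rule fourier_Bessel[OF f])
qed

text \<open>By Bessel the transform is a contraction in L^2, so both sides of Plancherel pass to an
  L^2 limit.\<close>

lemma fourier_Plancherel_limit:
  assumes f: "integrable lborel f" "square_integrable f"
    and F: "\<And>n. integrable lborel (F n)" "\<And>n. square_integrable (F n)"
    and P: "\<And>n. nsq (fourier_L1 (F n)) = nsq (F n)"
    and lim: "(\<lambda>n. nsq (\<lambda>x. f x - F n x)) \<longlonglongrightarrow> 0"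
  shows "nsq (fourier_L1 f) = nsq f"
proof -
  have [measurable]: "f \<in> borel_measurable borel" "F n \<in> borel_measurable borel" for n
    using f F by auto
  have sf: "square_integrable (fourier_L1 f)"
    using f fourier_Bessel[OF f(1)] by (auto simp: square_integrable_iff intro: le_less_trans)
  have sF: "square_integrable (fourier_L1 (F n))" for n
    using F P by (auto simp: square_integrable_iff)
  have "nsq (\<lambda>\<xi>. fourier_L1 f \<xi> - fourier_L1 (F n) \<xi>) \<le> nsq (\<lambda>x. f x - F n x)" for n
    using fourier_Bessel[of "\<lambda>x. f x - F n x"] f F by (simp add: fourier_L1_diff[symmetric])
  then have "(\<lambda>n. nsq (\<lambda>\<xi>. fourier_L1 f \<xi> - fourier_L1 (F n) \<xi>)) \<longlonglongrightarrow> 0"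
    by (intro tendsto_sandwich[OF _ _ tendsto_const lim]) auto
  from L2_tendsto_nsq[OF sf sF this] have "(\<lambda>n. nsq (F n)) \<longlonglongrightarrow> nsq (fourier_L1 f)" by (simp add: P)
  from LIMSEQ_unique[OF this L2_tendsto_nsq[OF f(2) F(2) lim]] show ?thesis .
qed

text \<open>A measurable function is an a.e. limit of continuous ones. Cutting these off in space
  and in modulus leaves the limit unchanged and provides a fixed compactly supported
  majorant.\<close>

lemma L2_approx_continuous:
  fixes f :: "real \<Rightarrow> complex"
  assumes [measurable]: "f \<in> borel_measurable borel" and M: "M > 0" "\<And>x. cmod (f x) \<le> M"
    and R: "\<And>x. \<bar>x\<bar> > R \<Longrightarrow> f x = 0"
  shows "\<exists>F. (\<forall>n. continuous_on UNIV (F n)) \<and> (\<forall>n x. cmod (F n x) \<le> M) \<and> (\<forall>n. integrable lborel (F n)) \<and>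
    (\<forall>n. square_integrable (F n)) \<and> (\<lambda>n. nsq (\<lambda>x. f x - F n x)) \<longlonglongrightarrow> 0"
proof -
  have "f measurable_on UNIV"
    by (intro lebesgue_measurable_imp_measurable_on) (auto intro: measurable_completion)
  then obtain N g where N: "negligible N" and g: "\<And>n. continuous_on UNIV (g n)"
    and lim: "\<And>x. x \<notin> N \<Longrightarrow> (\<lambda>n. g n x) \<longlonglongrightarrow> f x"
    unfolding measurable_on_def by auto
  \<comment> \<open>\<open>ct\<close> equals 1 where |x| is at most \<open>R\<close> and 0 where it
    is at least R + 1.\<close>
  define ct where "ct x = max 0 (min 1 (R + 1 - \<bar>x\<bar>))" for x :: real
  \<comment> \<open>The radial retraction onto the disc of radius \<open>M\<close>; it fixes all
    values of \<open>f\<close>.\<close>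
  define r where "r z = z / complex_of_real (max 1 (cmod z / M))" for z
  define F where "F n x = complex_of_real (ct x) * r (g n x)" for n x
  have mx: "max 1 (cmod z / M) > 0" for z by (rule less_le_trans[of _ 1]) auto
  have mx': "complex_of_real (max 1 (cmod z / M)) \<noteq> 0" for z
    unfolding of_real_eq_0_iff using mx[of z] by linarith
  have r_cont: "continuous_on UNIV r"
    unfolding r_def using mx' M(1) by (intro continuous_intros) auto
  have r_bd: "cmod (r z) \<le> M" for z
  proof -
    have "cmod z \<le> M * max 1 (cmod z / M)" using M(1) by (simp add: max_def field_simps)
    then show ?thesis
      unfolding r_def norm_divide norm_of_real using mx[of z] by (simp add: pos_divide_le_eq abs_of_pos)
  qed
  have r_id: "r z = z" if "cmod z \<le> M" for z
    using that M(1) by (auto simp: r_def max_def divide_le_eq)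
  have ct: "0 \<le> ct x" "ct x \<le> 1" for x by (auto simp: ct_def)
  have F_cont: "continuous_on UNIV (F n)" for n
    unfolding F_def ct_def
    by (intro continuous_intros continuous_on_compose2[OF r_cont g]) auto
  have [measurable]: "F n \<in> borel_measurable borel" for n
    by (intro borel_measurable_continuous_onI F_cont)
  have F_bd: "cmod (F n x) \<le> M" for n x
  proof -
    have "cmod (F n x) = ct x * cmod (r (g n x))"
      unfolding F_def norm_mult norm_of_real using ct by simp
    also have "\<dots> \<le> 1 * M"
      by (intro mult_mono r_bd ct) auto
    finally show ?thesis by simp
  qed
  have F_supp: "F n x = 0" if "\<bar>x\<bar> > R + 1" for n x
    using that by (simp add: F_def ct_def)
  let ?I = "indicator {- (R + 1)..R + 1} :: real \<Rightarrow> real"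
  have F_ind: "cmod (F n x) \<le> M * ?I x" for n x
    using F_bd[of n x] F_supp[of x n] by (auto simp: indicator_def not_le abs_le_iff split: if_splits)
  have Iint: "integrable lborel (\<lambda>x. c * ?I x)" for c
    by (intro integrable_mult_right) (simp add: integrable_real_indicator emeasure_lborel_Icc_eq)
  have F_int: "integrable lborel (F n)" for n
  proof (rule integrable_dominated[OF Iint[of M]])
    show "AE x in lborel. norm (F n x) \<le> norm (M * ?I x)"
      unfolding real_norm_def by (intro AE_I2 order_trans[OF F_ind abs_ge_self])
  qed simp
  have F_sq: "square_integrable (F n)" for n
    unfolding square_integrable_def
  proof
    show "integrable lborel (\<lambda>x. (cmod (F n x))\<^sup>2)"
    proof (rule integrable_dominated[OF Iint[of "M\<^sup>2"]])
      have "(cmod (F n x))\<^sup>2 \<le> M\<^sup>2 * ?I x" for x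
        using power_mono[OF F_ind[of n x], of 2] by (auto simp: indicator_def)
      then show "AE x in lborel. norm ((cmod (F n x))\<^sup>2) \<le> norm (M\<^sup>2 * ?I x)" by auto
    qed measurable
  qed simp
  have AE_N: "AE x in lborel. x \<notin> N"
    using AE_not_in[OF N[unfolded negligible_iff_null_sets]] by (simp add: AE_completion_iff)
  have F_lim: "AE x in lborel. (\<lambda>n. F n x) \<longlonglongrightarrow> f x"
    using AE_N
  proof eventually_elim
    case (elim x)
    have "(\<lambda>n. r (g n x)) \<longlonglongrightarrow> r (f x)"
      using r_cont lim[OF elim]
      by (auto intro!: isCont_tendsto_compose[of _ r] simp: continuous_on_eq_continuous_at)
    then have "(\<lambda>n. F n x) \<longlonglongrightarrow> complex_of_real (ct x) * r (f x)"
      unfolding F_def by (intro tendsto_intros)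
    also have "complex_of_real (ct x) * r (f x) = f x"
      using M(2)[of x] R[of x] by (cases "\<bar>x\<bar> > R") (auto simp: r_id ct_def min_def max_def)
    finally show ?case .
  qed
  have "(\<lambda>n. nsq (\<lambda>x. f x - F n x)) \<longlonglongrightarrow> 0"
  proof (rule nsq_dominated_tendsto_0[where w="\<lambda>x. ennreal (2 * M * ?I x)"])
    show "AE x in lborel. ennreal (cmod (f x - F n x)) \<le> ennreal (2 * M * ?I x)" for n
    proof (intro AE_I2 ennreal_leI)
      fix x
      have "cmod (f x) \<le> M * ?I x" using M(2)[of x] R[of x] by (auto simp: indicator_def)
      then show "cmod (f x - F n x) \<le> 2 * M * ?I x"
        using norm_triangle_ineq4[of "f x" "F n x"] F_ind[of n x] by linarith
    qed
    have "(\<integral>\<^sup>+x. (ennreal (2 * M * ?I x))\<^sup>2 \<partial>lborel) = (\<integral>\<^sup>+x. ennreal ((2 * M)\<^sup>2 * ?I x) \<partial>lborel)"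
      using M(1) by (intro nn_integral_cong) (auto simp: indicator_def ennreal_power)
    also have "\<dots> < \<infinity>"
      using Iint[of "(2 * M)\<^sup>2"] by (subst nn_integral_eq_integral) auto
    finally show "(\<integral>\<^sup>+x. (ennreal (2 * M * ?I x))\<^sup>2 \<partial>lborel) < \<infinity>" .
  qed (use F_lim in auto)
  with F_cont F_bd F_int F_sq show ?thesis by blast
qed

lemma fourier_Plancherel_bounded:
  assumes [measurable]: "f \<in> borel_measurable borel" and M: "M > 0" "\<And>x. cmod (f x) \<le> M"
    and R: "\<And>x. \<bar>x\<bar> > R \<Longrightarrow> f x = 0"
    and f: "integrable lborel f" "square_integrable f"
  shows "nsq (fourier_L1 f) = nsq f"
proof -
  from L2_approx_continuous[OF assms(1-4)] obtain F where F: "\<And>n. continuous_on UNIV (F n)"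
    "\<And>n x. cmod (F n x) \<le> M" "\<And>n. integrable lborel (F n)" "\<And>n. square_integrable (F n)"
    "(\<lambda>n. nsq (\<lambda>x. f x - F n x)) \<longlonglongrightarrow> 0" by blast
  show ?thesis
    by (rule fourier_Plancherel_limit[OF f F(3,4) fourier_Plancherel_continuous[OF F(3,1,2)] F(5)])
qed

lemma fourier_Plancherel_L1:
  assumes f: "integrable lborel f" "square_integrable f"
  shows "nsq (fourier_L1 f) = nsq f"
proof -
  have [measurable]: "f \<in> borel_measurable borel" using f by auto
  define F where "F n x = indicator {x. \<bar>x\<bar> \<le> real n \<and> cmod (f x) \<le> real n} x * f x" for n :: nat and x
  have [measurable]: "F n \<in> borel_measurable borel" for n unfolding F_def by measurable
  have le: "cmod (F n x) \<le> cmod (f x)" for n x by (simp add: F_def indicator_def)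
  have Fi: "integrable lborel (F n)" for n
    by (rule integrable_dominated[OF f(1)]) (auto simp: le)
  have Fs: "square_integrable (F n)" for n
    by (rule square_integrable_bound[OF f(2)]) (auto simp: le)
  have FP: "nsq (fourier_L1 (F n)) = nsq (F n)" for n
  \<comment> \<open>The bound n + 1 is used instead of n because a positive bound is required also
    for n = 0.\<close>
  proof (rule fourier_Plancherel_bounded[of _ "real n + 1" "real n"])
    show "cmod (F n x) \<le> real n + 1" for x by (auto simp: F_def indicator_def)
    show "F n x = 0" if "\<bar>x\<bar> > real n" for x using that by (auto simp: F_def indicator_def)
  qed (auto simp: Fi Fs)
  have "(\<lambda>n. nsq (\<lambda>x. f x - F n x)) \<longlonglongrightarrow> 0"
  proof (rule nsq_dominated_tendsto_0[where w="\<lambda>x. ennreal (cmod (f x))"])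
    show "(\<integral>\<^sup>+x. (ennreal (cmod (f x)))\<^sup>2 \<partial>lborel) < \<infinity>"
      using f(2) by (simp add: square_integrable_iff nsq_def ennreal_power)
    show "AE x in lborel. ennreal (cmod (f x - F n x)) \<le> ennreal (cmod (f x))" for n
      by (auto simp: F_def indicator_def)
    show "AE x in lborel. (\<lambda>n. F n x) \<longlonglongrightarrow> f x"
    proof (intro AE_I2)
      fix x
      obtain k :: nat where k: "max \<bar>x\<bar> (cmod (f x)) \<le> real k" using real_arch_simple by blast
      have "eventually (\<lambda>n. F n x = f x) sequentially"
        using eventually_ge_at_top[of k]
      proof eventually_elim
        case (elim n)
        with k have "\<bar>x\<bar> \<le> real n" "cmod (f x) \<le> real n" by auto
        then show ?case by (simp add: F_def)
      qed
      then show "(\<lambda>n. F n x) \<longlonglongrightarrow> f x" by (rule tendsto_eventually)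
    qed
  qed auto
  then show ?thesis by (rule fourier_Plancherel_limit[OF f Fi Fs FP])
qed

subsection \<open>The Fourier transform on \<open>L\<^sup>2\<close>\<close>

definition trunc :: "nat \<Rightarrow> (real \<Rightarrow> complex) \<Rightarrow> real \<Rightarrow> complex" where
  "trunc R u = (\<lambda>x. indicator {- real R .. real R} x * u x)"

lemma is_fourier_iff:
  "is_fourier u uh \<longleftrightarrow> square_integrable uh \<and> (\<lambda>R. nsq (\<lambda>\<xi>. uh \<xi> - fourier_L1 (trunc R u) \<xi>)) \<longlonglongrightarrow> 0"
  unfolding is_fourier_def nsq_def trunc_def ..

lemma trunc_measurable [measurable]: "u \<in> borel_measurable borel \<Longrightarrow> trunc R u \<in> borel_measurable borel"
  unfolding trunc_def by measurable

lemma cmod_trunc_le: "cmod (trunc R u x) \<le> cmod (u x)"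
  by (simp add: trunc_def indicator_def)

lemma square_integrable_trunc: "square_integrable u \<Longrightarrow> square_integrable (trunc R u)"
  by (rule square_integrable_bound[of u]) (auto simp: cmod_trunc_le square_integrable_iff)

lemma square_integrable_indicator: "square_integrable (\<lambda>x. indicator {- real R .. real R} x)"
proof -
  have "nsq (\<lambda>x. indicator {- real R .. real R} x) = (\<integral>\<^sup>+x. indicator {- real R .. real R} x \<partial>lborel)"
    unfolding nsq_def by (intro nn_integral_cong) (simp add: indicator_def)
  then show ?thesis by (simp add: square_integrable_iff emeasure_lborel_Icc_eq)
qed

lemma integrable_trunc:
  assumes "square_integrable u"
  shows "integrable lborel (trunc R u)"
  unfolding trunc_def
  by (rule square_integrable_mult_integrable(1)[OF square_integrable_indicator assms])

lemma trunc_tendsto: "(\<lambda>R. trunc R u x) \<longlonglongrightarrow> u x"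
proof (rule tendsto_eventually)
  obtain k :: nat where "\<bar>x\<bar> \<le> real k" using real_arch_simple by blast
  then show "eventually (\<lambda>R. trunc R u x = u x) sequentially"
    by (intro eventually_sequentiallyI[of k]) (auto simp: trunc_def indicator_def)
qed

lemma trunc_L2_tendsto:
  assumes "square_integrable u"
  shows "(\<lambda>R. nsq (\<lambda>x. u x - trunc R u x)) \<longlonglongrightarrow> 0"
proof (rule nsq_dominated_tendsto_0[where w="\<lambda>x. ennreal (cmod (u x))"])
  show "(\<integral>\<^sup>+x. (ennreal (cmod (u x)))\<^sup>2 \<partial>lborel) < \<infinity>"
    using assms by (simp add: square_integrable_iff nsq_def ennreal_power)
  show "AE x in lborel. ennreal (cmod (u x - trunc R u x)) \<le> ennreal (cmod (u x))" for R
    by (auto simp: trunc_def indicator_def)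
qed (use assms trunc_tendsto in \<open>auto simp: square_integrable_iff\<close>)

lemma square_integrable_fourier_trunc:
  assumes "square_integrable u"
  shows "square_integrable (fourier_L1 (trunc R u))"
  using fourier_Plancherel_L1[OF integrable_trunc[OF assms] square_integrable_trunc[OF assms]]
    square_integrable_trunc[OF assms, of R] by (auto simp: square_integrable_iff)

lemma fourier_trunc_diff:
  assumes u: "square_integrable u"
  shows "nsq (\<lambda>\<xi>. fourier_L1 (trunc m u) \<xi> - fourier_L1 (trunc n u) \<xi>) = nsq (\<lambda>x. trunc m u x - trunc n u x)"
  using fourier_Plancherel_L1[of "\<lambda>x. trunc m u x - trunc n u x"] integrable_trunc[OF u] square_integrable_trunc[OF u]
  by (simp add: square_integrable_diff fourier_L1_diff[symmetric])

text \<open>Truncations of a square-integrable function lie in L^1, and Plancherel carries their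
  Cauchy property over to their transforms; completeness provides the limit.\<close>

lemma is_fourier_exists:
  assumes u: "square_integrable u"
  shows "\<exists>uh. is_fourier u uh"
proof -
  note [measurable] = square_integrable_measurable[OF u]
  have "\<exists>f. square_integrable f \<and> (\<lambda>n. nsq (\<lambda>x. f x - fourier_L1 (trunc n u) x)) \<longlonglongrightarrow> 0"
  proof (rule L2_complete)
    fix e :: real assume e: "e > 0"
    \<comment> \<open>The quarter compensates the factors 2 in the triangle inequality for squared
      norms.\<close>
    have "eventually (\<lambda>R. nsq (\<lambda>x. u x - trunc R u x) < ennreal (e / 4)) sequentially"
      using e by (intro order_tendstoD(2)[OF trunc_L2_tendsto[OF u]]) simp
    then obtain N where N: "\<And>R. R \<ge> N \<Longrightarrow> nsq (\<lambda>x. u x - trunc R u x) < ennreal (e / 4)"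
      by (auto simp: eventually_sequentially)
    have "nsq (\<lambda>x. fourier_L1 (trunc m u) x - fourier_L1 (trunc n u) x) \<le> ennreal e" if "m \<ge> N" "n \<ge> N" for m n
    proof -
      have "nsq (\<lambda>x. trunc m u x - trunc n u x) \<le> 2 * nsq (\<lambda>x. trunc m u x - u x) + 2 * nsq (\<lambda>x. u x - trunc n u x)"
        by (rule nsq_triangle) auto
      also have "\<dots> \<le> 2 * ennreal (e / 4) + 2 * ennreal (e / 4)"
        using N[OF that(1)] N[OF that(2)] nsq_minus_commute[of "trunc m u" u]
        by (intro add_mono mult_left_mono) (auto simp: less_imp_le)
      also have "\<dots> = ennreal e"
        using e ennreal_lincomb[of 2 2 "e/4" "e/4"] by simp
      finally show ?thesis by (simp add: fourier_trunc_diff[OF u])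
    qed
    then show "\<exists>N. \<forall>m\<ge>N. \<forall>n\<ge>N. nsq (\<lambda>x. fourier_L1 (trunc m u) x - fourier_L1 (trunc n u) x) \<le> ennreal e" by blast
  qed (rule square_integrable_fourier_trunc[OF u])
  then show ?thesis by (auto simp: is_fourier_iff)
qed

lemma is_fourier_fourier_L2: "square_integrable u \<Longrightarrow> is_fourier u (fourier_L2 u)"
  unfolding fourier_L2_def using is_fourier_exists by (rule someI_ex)

lemma is_fourier_square_integrable: "is_fourier u uh \<Longrightarrow> square_integrable uh"
  by (simp add: is_fourier_iff)

lemma fourier_L2_measurable: "square_integrable u \<Longrightarrow> fourier_L2 u \<in> borel_measurable borel"
  by (blast intro: is_fourier_fourier_L2 is_fourier_square_integrable square_integrable_measurable)

lemma is_fourier_unique: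
  assumes [measurable]: "u \<in> borel_measurable borel" and "is_fourier u f" "is_fourier u g"
  shows "AE x in lborel. f x = g x"
  using assms by (intro L2_limit_unique[of f g "\<lambda>R. fourier_L1 (trunc R u)"]) (auto simp: is_fourier_iff square_integrable_iff)

lemma is_fourier_Plancherel:
  assumes u: "square_integrable u" and F: "is_fourier u uh"
  shows "nsq uh = nsq u"
proof -
  have "(\<lambda>R. nsq (fourier_L1 (trunc R u))) \<longlonglongrightarrow> nsq uh"
    using F by (intro L2_tendsto_nsq square_integrable_fourier_trunc u) (auto simp: is_fourier_iff)
  moreover have "nsq (fourier_L1 (trunc R u)) = nsq (trunc R u)" for R
    by (rule fourier_Plancherel_L1[OF integrable_trunc[OF u] square_integrable_trunc[OF u]])
  moreover have "(\<lambda>R. nsq (trunc R u)) \<longlonglongrightarrow> nsq u"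
    by (rule L2_tendsto_nsq[OF u square_integrable_trunc[OF u] trunc_L2_tendsto[OF u]])
  ultimately show ?thesis using LIMSEQ_unique by simp
qed

lemma fourier_L1_reflect: "fourier_L1 (\<lambda>x. f (- x)) \<xi> = fourier_L1 f (- \<xi>)"
  unfolding fourier_L1_def
  using lborel_integral_real_affine[of "-1" "\<lambda>x. f x * cis (\<xi> * x)" 0] by simp

lemma trunc_reflect: "trunc R (\<lambda>x. u (- x)) = (\<lambda>x. trunc R u (- x))"
  unfolding trunc_def by (rule ext) (auto simp: indicator_def)

lemma square_integrable_cnj: "square_integrable u \<Longrightarrow> square_integrable (\<lambda>x. cnj (u x))"
  by (auto simp: square_integrable_iff nsq_def)

lemma square_integrable_reflect: "square_integrable u \<Longrightarrow> square_integrable (\<lambda>x. u (- x))"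
  by (auto simp: square_integrable_iff nsq_reflect)

text \<open>The polarization identity; it reduces an L^2 distance to two norms and one inner
  product.\<close>

lemma nsq_diff_expand:
  assumes u: "square_integrable u" and w: "square_integrable w"
  shows "nsq (\<lambda>x. u x - w x) = ennreal (enn2real (nsq u) + enn2real (nsq w) - 2 * Re (LINT x|lborel. u x * cnj (w x)))"
proof -
  have i: "integrable lborel (\<lambda>x. u x * cnj (w x))"
    by (rule square_integrable_mult_integrable(1)[OF u square_integrable_cnj[OF w]])
  have iu: "integrable lborel (\<lambda>x. (cmod (u x))\<^sup>2)" and iw: "integrable lborel (\<lambda>x. (cmod (w x))\<^sup>2)"
    using u w by (auto simp: square_integrable_def)
  have eq: "enn2real (nsq u) = (LINT x|lborel. (cmod (u x))\<^sup>2)" "enn2real (nsq w) = (LINT x|lborel. (cmod (w x))\<^sup>2)"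
    unfolding nsq_def using iu iw by (simp_all add: nn_integral_eq_integral)
  have "(cmod (u x - w x))\<^sup>2 = (cmod (u x))\<^sup>2 + (cmod (w x))\<^sup>2 - 2 * Re (u x * cnj (w x))" for x
    unfolding cmod_power2 by (simp add: power2_eq_square algebra_simps)
  then have "nsq (\<lambda>x. u x - w x) = (\<integral>\<^sup>+x. ennreal ((cmod (u x))\<^sup>2 + (cmod (w x))\<^sup>2 - 2 * Re (u x * cnj (w x))) \<partial>lborel)"
    unfolding nsq_def by simp
  also have "\<dots> = ennreal (LINT x|lborel. (cmod (u x))\<^sup>2 + (cmod (w x))\<^sup>2 - 2 * Re (u x * cnj (w x)))"
  proof (rule nn_integral_eq_integral)
    show "integrable lborel (\<lambda>x. (cmod (u x))\<^sup>2 + (cmod (w x))\<^sup>2 - 2 * Re (u x * cnj (w x)))"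
      by (intro Bochner_Integration.integrable_diff Bochner_Integration.integrable_add integrable_mult_right integrable_Re iu iw i)
    show "AE x in lborel. 0 \<le> (cmod (u x))\<^sup>2 + (cmod (w x))\<^sup>2 - 2 * Re (u x * cnj (w x))"
      using \<open>\<And>x. (cmod (u x - w x))\<^sup>2 = _ x\<close> by (metis (lifting) AE_I2 zero_le_power2)
  qed
  also have "(LINT x|lborel. (cmod (u x))\<^sup>2 + (cmod (w x))\<^sup>2 - 2 * Re (u x * cnj (w x)))
      = enn2real (nsq u) + enn2real (nsq w) - 2 * Re (LINT x|lborel. u x * cnj (w x))"
    unfolding eq using integrable_Re[OF i] iu iw by (simp add: integral_Re[OF i] del: times_complex.sel)
  finally show ?thesis .
qed

text \<open>With \<open>w\<^sub>S\<close> the inverse transform of \<open>uh\<close> truncated to \<open>[-S, S]\<close>, the adjoint relation turns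
  \<open>\<langle>u, w\<^sub>S\<rangle>\<close> into \<open>\<integral>\<^bsub>[-S,S]\<^esub> |uh|\<^sup>2\<close>, so \<open>\<parallel>u - w\<^sub>S\<parallel>\<^sup>2 = \<parallel>u\<parallel>\<^sup>2 - \<integral>\<^bsub>[-S,S]\<^esub> |uh|\<^sup>2\<close>.\<close>
lemma is_fourier_inversion:
  assumes u: "square_integrable u" and F: "is_fourier u uh"
  shows "is_fourier (\<lambda>\<xi>. uh (- \<xi>)) u"
proof -
  have uh: "square_integrable uh" using F by (rule is_fourier_square_integrable)
  define w where "w S = fourier_L1 (trunc S (\<lambda>\<xi>. uh (- \<xi>)))" for S
  have w_sq: "square_integrable (w S)" for S
    unfolding w_def by (intro square_integrable_fourier_trunc square_integrable_reflect uh)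
  have w_eq: "w S x = fourier_L1 (trunc S uh) (- x)" for S x
    by (simp add: w_def trunc_reflect fourier_L1_reflect)
  have w_nsq: "nsq (w S) = nsq (trunc S uh)" for S
    unfolding w_def
    by (subst fourier_Plancherel_L1)
       (use uh in \<open>auto simp: trunc_reflect nsq_reflect[OF square_integrable_measurable[OF square_integrable_trunc[OF uh]]]
          intro!: integrable_trunc[OF square_integrable_reflect[OF uh], unfolded trunc_reflect] square_integrable_reflect[OF square_integrable_trunc[OF uh]]\<close>)
  have cnj_w: "cnj (w S x) = fourier_L1 (\<lambda>\<xi>. cnj (trunc S uh \<xi>)) x" for S x
    unfolding w_eq fourier_L1_def by (simp add: cis_cnj Bochner_Integration.integral_cnj[symmetric] del: Bochner_Integration.integral_cnj)
  have adj: "(LINT x|lborel. u x * cnj (w S x)) = complex_of_real (enn2real (nsq (trunc S uh)))" for S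
  proof -
    have sT: "square_integrable (\<lambda>\<xi>. cnj (trunc S uh \<xi>))"
      by (intro square_integrable_cnj square_integrable_trunc uh)
    \<comment> \<open>The multiplication formula needs integrable functions, so \<open>u\<close> is
      truncated as well; then \<open>R\<close> tends to infinity at fixed \<open>S\<close>.\<close>
    have 1: "(LINT x|lborel. cnj (w S x) * trunc R u x) = (LINT \<xi>|lborel. cnj (trunc S uh \<xi>) * fourier_L1 (trunc R u) \<xi>)" for R
      unfolding cnj_w by (rule fourier_mult_formula) (auto intro!: integrable_trunc u uh)
    have "(\<lambda>R. LINT x|lborel. cnj (w S x) * trunc R u x) \<longlonglongrightarrow> (LINT x|lborel. cnj (w S x) * u x)"
      by (intro L2_inner_tendsto square_integrable_cnj w_sq u square_integrable_trunc trunc_L2_tendsto)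
    moreover have "(\<lambda>R. LINT \<xi>|lborel. cnj (trunc S uh \<xi>) * fourier_L1 (trunc R u) \<xi>) \<longlonglongrightarrow> (LINT \<xi>|lborel. cnj (trunc S uh \<xi>) * uh \<xi>)"
      using F by (intro L2_inner_tendsto sT uh square_integrable_fourier_trunc u) (simp add: is_fourier_iff)
    ultimately have "(LINT x|lborel. cnj (w S x) * u x) = (LINT \<xi>|lborel. cnj (trunc S uh \<xi>) * uh \<xi>)"
      unfolding 1 by (rule LIMSEQ_unique)
    also have "\<dots> = (LINT \<xi>|lborel. complex_of_real ((cmod (trunc S uh \<xi>))\<^sup>2))"
      by (intro lebesgue_integral_cong refl)
         (auto simp: trunc_def indicator_def complex_norm_square mult.commute simp del: of_real_power)
    also have "\<dots> = complex_of_real (LINT \<xi>|lborel. (cmod (trunc S uh \<xi>))\<^sup>2)"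
      by (rule integral_complex_of_real)
    also have "(LINT \<xi>|lborel. (cmod (trunc S uh \<xi>))\<^sup>2) = enn2real (nsq (trunc S uh))"
      using square_integrable_trunc[OF uh, of S] unfolding nsq_def
      by (simp add: nn_integral_eq_integral square_integrable_def)
    finally show ?thesis by (simp add: mult.commute)
  qed
  have "nsq (\<lambda>x. u x - w S x) = ennreal (enn2real (nsq u) - enn2real (nsq (trunc S uh)))" for S
    by (simp add: nsq_diff_expand[OF u w_sq] adj w_nsq)
  moreover have "(\<lambda>S. ennreal (enn2real (nsq u) - enn2real (nsq (trunc S uh)))) \<longlonglongrightarrow> ennreal (enn2real (nsq u) - enn2real (nsq u))"
  proof -
    have "(\<lambda>S. nsq (trunc S uh)) \<longlonglongrightarrow> nsq u"
      using L2_tendsto_nsq[OF uh square_integrable_trunc[OF uh] trunc_L2_tendsto[OF uh]]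
      by (simp add: is_fourier_Plancherel[OF u F])
    then have "(\<lambda>S. enn2real (nsq (trunc S uh))) \<longlonglongrightarrow> enn2real (nsq u)"
      using u by (intro tendsto_enn2real) (simp_all add: square_integrable_iff)
    then show ?thesis by (intro tendsto_ennrealI tendsto_diff tendsto_const)
  qed
  ultimately show ?thesis using u by (simp add: is_fourier_iff w_def)
qed

text \<open>The reflection of a transform of \<open>f\<close> has transform \<open>f\<close>, by
  inversion.\<close>

lemma fourier_L2_surj:
  assumes f: "square_integrable f"
  shows "\<exists>u. square_integrable u \<and> (AE \<xi> in lborel. fourier_L2 u \<xi> = f \<xi>)"
proof -
  obtain v where v: "is_fourier f v" using is_fourier_exists[OF f] by blast
  have v_sq: "square_integrable v" by (rule is_fourier_square_integrable[OF v])
  have "is_fourier (\<lambda>\<xi>. v (- \<xi>)) f" by (rule is_fourier_inversion[OF f v])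
  then have "AE \<xi> in lborel. fourier_L2 (\<lambda>\<xi>. v (- \<xi>)) \<xi> = f \<xi>"
    using is_fourier_fourier_L2[OF square_integrable_reflect[OF v_sq]]
    by (intro is_fourier_unique[of "\<lambda>\<xi>. v (- \<xi>)"]) (use square_integrable_reflect[OF v_sq] in \<open>auto simp: square_integrable_iff\<close>)
  with square_integrable_reflect[OF v_sq] show ?thesis by blast
qed

subsection \<open>Convolution powers\<close>

text \<open>The unsigned convolution is meaningful at every point, possibly infinite, and serves as
  majorant of the complex one.\<close>

definition nconv :: "(real \<Rightarrow> ennreal) \<Rightarrow> (real \<Rightarrow> ennreal) \<Rightarrow> real \<Rightarrow> ennreal" where
  "nconv f g x = (\<integral>\<^sup>+y. f y * g (x - y) \<partial>lborel)"

text \<open>Takes the default value 0 where the integrand is not integrable, so the bound by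
  \<open>nconv\<close> holds at every point.\<close>

definition cconv :: "(real \<Rightarrow> complex) \<Rightarrow> (real \<Rightarrow> complex) \<Rightarrow> real \<Rightarrow> complex" where
  "cconv f g x = (LINT y|lborel. f y * g (x - y))"

text \<open>The index counts convolutions, so \<open>npow g n\<close> has \<open>n + 1\<close> factors.\<close>
primrec npow :: "(real \<Rightarrow> ennreal) \<Rightarrow> nat \<Rightarrow> real \<Rightarrow> ennreal" where
  "npow g 0 = g"
| "npow g (Suc n) = nconv g (npow g n)"

primrec cpow :: "(real \<Rightarrow> complex) \<Rightarrow> nat \<Rightarrow> real \<Rightarrow> complex" where
  "cpow g 0 = g"
| "cpow g (Suc n) = cconv g (cpow g n)"

abbreviation nabs :: "(real \<Rightarrow> complex) \<Rightarrow> real \<Rightarrow> ennreal" where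
  "nabs u \<equiv> \<lambda>x. ennreal (cmod (u x))"

lemma nconv_measurable [measurable]:
  assumes [measurable]: "f \<in> borel_measurable borel" "g \<in> borel_measurable borel"
  shows "nconv f g \<in> borel_measurable borel"
  unfolding nconv_def by measurable

lemma cconv_measurable [measurable]:
  assumes [measurable]: "f \<in> borel_measurable borel" "g \<in> borel_measurable borel"
  shows "cconv f g \<in> borel_measurable borel"
  unfolding cconv_def by measurable

lemma npow_measurable [measurable]: "g \<in> borel_measurable borel \<Longrightarrow> npow g n \<in> borel_measurable borel"
  by (induction n) auto

lemma cpow_measurable [measurable]: "g \<in> borel_measurable borel \<Longrightarrow> cpow g n \<in> borel_measurable borel"
  by (induction n) auto

lemma nconv_mono: "(\<And>x. f x \<le> f' x) \<Longrightarrow> (\<And>x. g x \<le> g' x) \<Longrightarrow> nconv f g x \<le> nconv f' g' x"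
  unfolding nconv_def by (intro nn_integral_mono mult_mono) auto

lemma npow_mono: "(\<And>x. f x \<le> g x) \<Longrightarrow> npow f n x \<le> npow g n x"
  by (induction n arbitrary: x) (auto intro!: nconv_mono)

lemma cmod_cconv_le: "nabs (cconv f g) x \<le> nconv (nabs f) (nabs g) x"
  unfolding cconv_def nconv_def
  by (rule order_trans[OF norm_integral_le_nn]) (simp add: norm_mult ennreal_mult)

lemma cmod_cpow_le: "nabs (cpow u n) x \<le> npow (nabs u) n x"
proof (induction n arbitrary: x)
  case (Suc n)
  have "nabs (cpow u (Suc n)) x \<le> nconv (nabs u) (nabs (cpow u n)) x" by (simp add: cmod_cconv_le)
  also have "\<dots> \<le> npow (nabs u) (Suc n) x" by (simp add: nconv_mono Suc.IH)
  finally show ?case .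
qed simp

lemma AE_lborel_shift:
  fixes P :: "real \<Rightarrow> bool"
  assumes "AE x in lborel. P x"
  shows "AE y in lborel. P (x - y)" and "AE y in lborel. P (y + x)" and "AE y in lborel. P (- y)"
proof -
  from assms obtain N where N: "{x. \<not> P x} \<subseteq> N" "N \<in> null_sets lborel"
    by (auto elim!: AE_E simp: null_sets_def)
  then have [measurable]: "N \<in> sets borel" by auto
  have "AE x in lborel. x \<notin> N" by (rule AE_not_in[OF N(2)])
  from AE_borel_affine[OF _ _ this, of "-1" x] AE_borel_affine[OF _ _ this, of 1 x] AE_borel_affine[OF _ _ this, of "-1" 0]
  have "AE y in lborel. x - y \<notin> N" "AE y in lborel. y + x \<notin> N" "AE y in lborel. - y \<notin> N"
    by (auto simp: add.commute)
  moreover have "z \<notin> N \<Longrightarrow> P z" for z using N(1) by auto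
  ultimately show "AE y in lborel. P (x - y)" "AE y in lborel. P (y + x)" "AE y in lborel. P (- y)"
    by - (erule eventually_mono; simp)+
qed

lemma nn_integral_reflect_shift:
  fixes f :: "real \<Rightarrow> ennreal"
  assumes [measurable]: "f \<in> borel_measurable borel"
  shows "(\<integral>\<^sup>+y. f (x - y) \<partial>lborel) = (\<integral>\<^sup>+y. f y \<partial>lborel)"
  using nn_integral_real_affine[of f "-1" x] by simp

section \<open>The convolution theorem for integrable functions\<close>

lemma nn_integral_nconv:
  assumes [measurable]: "f \<in> borel_measurable borel" "g \<in> borel_measurable borel"
  shows "(\<integral>\<^sup>+x. nconv f g x \<partial>lborel) = (\<integral>\<^sup>+x. f x \<partial>lborel) * (\<integral>\<^sup>+x. g x \<partial>lborel)"
proof -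
  have "(\<integral>\<^sup>+x. nconv f g x \<partial>lborel) = (\<integral>\<^sup>+y. \<integral>\<^sup>+x. f y * g (x - y) \<partial>lborel \<partial>lborel)"
    unfolding nconv_def by (rule lborel_pair.Fubini') measurable
  also have "\<dots> = (\<integral>\<^sup>+y. f y * (\<integral>\<^sup>+x. g x \<partial>lborel) \<partial>lborel)"
    using nn_integral_shift[of g "- _"] by (simp add: nn_integral_cmult)
  also have "\<dots> = (\<integral>\<^sup>+x. f x \<partial>lborel) * (\<integral>\<^sup>+x. g x \<partial>lborel)"
    by (simp add: nn_integral_multc)
  finally show ?thesis .
qed

lemma cconv_integrable_pair:
  fixes f g :: "real \<Rightarrow> complex"
  assumes "integrable lborel f" "integrable lborel g"
  shows "integrable (lborel \<Otimes>\<^sub>M lborel) (\<lambda>(x, y). f y * g (x - y))"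
proof -
  have [measurable]: "f \<in> borel_measurable borel" "g \<in> borel_measurable borel"
    using assms by auto
  have "(\<integral>\<^sup>+p. ennreal (norm (case p of (x, y) \<Rightarrow> f y * g (x - y))) \<partial>(lborel \<Otimes>\<^sub>M lborel))
      = (\<integral>\<^sup>+x. nconv (nabs f) (nabs g) x \<partial>lborel)"
    unfolding nconv_def
    by (subst lborel.nn_integral_fst[symmetric]) (auto simp: norm_mult ennreal_mult)
  also have "\<dots> = (\<integral>\<^sup>+x. nabs f x \<partial>lborel) * (\<integral>\<^sup>+x. nabs g x \<partial>lborel)"
    by (rule nn_integral_nconv) auto
  also have "\<dots> < \<infinity>"
    using assms by (simp add: integrable_iff_bounded ennreal_mult_less_top)
  finally show ?thesis by (simp add: integrable_iff_bounded)
qed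

lemma integrable_cconv:
  assumes "integrable lborel f" "integrable lborel g"
  shows "integrable lborel (cconv f g)"
  using lborel_pair.integrable_fst[OF cconv_integrable_pair[OF assms]] unfolding cconv_def by simp

lemma fourier_cconv:
  assumes f: "integrable lborel f" and g: "integrable lborel g"
  shows "fourier_L1 (cconv f g) \<xi> = complex_of_real (sqrt (2 * pi)) * fourier_L1 f \<xi> * fourier_L1 g \<xi>"
proof -
  have [measurable]: "f \<in> borel_measurable borel" "g \<in> borel_measurable borel"
    using f g by auto
  have int: "integrable (lborel \<Otimes>\<^sub>M lborel) (\<lambda>(x, y). f y * g (x - y) * cis (- (\<xi> * x)))"
    by (rule integrable_dominated[OF cconv_integrable_pair[OF f g]]) (auto simp: norm_mult)
  have "(LINT x|lborel. cconv f g x * cis (- (\<xi> * x))) = (LINT x|lborel. LINT y|lborel. f y * g (x - y) * cis (- (\<xi> * x)))"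
    unfolding cconv_def by simp
  also have "\<dots> = (LINT y|lborel. LINT x|lborel. f y * g (x - y) * cis (- (\<xi> * x)))"
    using lborel_pair.Fubini_integral[of "\<lambda>x y. f y * g (x - y) * cis (- (\<xi> * x))"] int by simp
  also have "\<dots> = (LINT y|lborel. f y * cis (- (\<xi> * y)) * (LINT x|lborel. g x * cis (- (\<xi> * x))))"
  proof (intro lebesgue_integral_cong refl)
    fix y
    have "(LINT x|lborel. f y * g (x - y) * cis (- (\<xi> * x))) = (LINT x|lborel. f y * g x * cis (- (\<xi> * (y + x))))"
      using lborel_integral_real_affine[of 1 "\<lambda>x. f y * g (x - y) * cis (- (\<xi> * x))" y] by simp
    also have "\<dots> = (LINT x|lborel. (f y * cis (- (\<xi> * y))) * (g x * cis (- (\<xi> * x))))"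
    proof (intro lebesgue_integral_cong refl)
      fix x
      have "cis (- (\<xi> * (y + x))) = cis (- (\<xi> * y)) * cis (- (\<xi> * x))" by (simp add: cis_mult algebra_simps)
      then show "f y * g x * cis (- (\<xi> * (y + x))) = (f y * cis (- (\<xi> * y))) * (g x * cis (- (\<xi> * x)))" by simp
    qed
    finally show "(LINT x|lborel. f y * g (x - y) * cis (- (\<xi> * x))) = f y * cis (- (\<xi> * y)) * (LINT x|lborel. g x * cis (- (\<xi> * x)))"
      by simp
  qed
  also have "\<dots> = (LINT x|lborel. f x * cis (- (\<xi> * x))) * (LINT x|lborel. g x * cis (- (\<xi> * x)))"
    by simp
  finally show ?thesis
    unfolding fourier_L1_def by (simp add: field_simps flip: of_real_mult)
qed

lemma integrable_cpow: "integrable lborel f \<Longrightarrow> integrable lborel (cpow f n)"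
  by (induction n) (auto intro: integrable_cconv)

text \<open>The unitary normalization contributes one factor sqrt(2 pi) for each of the
  \<open>n\<close> convolutions, while there are n + 1 factors.\<close>

lemma fourier_cpow:
  assumes "integrable lborel f"
  shows "fourier_L1 (cpow f n) \<xi> = complex_of_real (sqrt (2 * pi)) ^ n * fourier_L1 f \<xi> ^ (Suc n)"
  by (induction n) (auto simp: fourier_cconv assms integrable_cpow)

text \<open>Induction with dominated convergence inside each convolution: where the next unsigned
  power is finite, its integrand is an integrable majorant that does not depend on the
  truncation.\<close>

lemma cpow_trunc_tendsto:
  assumes [measurable]: "u \<in> borel_measurable borel" and fin: "\<And>n. AE x in lborel. npow (nabs u) n x < \<infinity>"
  shows "AE x in lborel. (\<lambda>R. cpow (trunc R u) n x) \<longlonglongrightarrow> cpow u n x"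
proof (induction n)
  case (Suc n)
  have le: "cmod (trunc R u x) \<le> cmod (u x)" for R x by (rule cmod_trunc_le)
  show ?case
    using fin[of "Suc n"]
  proof eventually_elim
    case (elim x)
    let ?w = "\<lambda>y. nabs u y * npow (nabs u) n (x - y)"
    have wfin: "(\<integral>\<^sup>+y. ?w y \<partial>lborel) < \<infinity>" using elim by (simp add: nconv_def)
    then have wAE: "AE y in lborel. ?w y \<noteq> \<infinity>" by (intro nn_integral_PInf_AE) (auto simp: less_top)
    have w: "AE y in lborel. ?w y = ennreal (enn2real (?w y))"
      using wAE by eventually_elim (simp add: less_top)
    have wint: "integrable lborel (\<lambda>y. enn2real (?w y))"
      unfolding integrable_iff_bounded
      using wfin nn_integral_cong_AE[OF w] by simp
    have "(\<lambda>R. LINT y|lborel. trunc R u y * cpow (trunc R u) n (x - y)) \<longlonglongrightarrow> (LINT y|lborel. u y * cpow u n (x - y))"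
    proof (rule integral_dominated_convergence[OF _ _ wint])
      show "AE y in lborel. (\<lambda>R. trunc R u y * cpow (trunc R u) n (x - y)) \<longlonglongrightarrow> u y * cpow u n (x - y)"
        using AE_lborel_shift(1)[OF Suc.IH, of x] by eventually_elim (intro tendsto_mult trunc_tendsto)
      show "AE y in lborel. norm (trunc R u y * cpow (trunc R u) n (x - y)) \<le> enn2real (?w y)" for R
        using wAE
      proof eventually_elim
        case (elim y)
        have "ennreal (norm (trunc R u y * cpow (trunc R u) n (x - y))) \<le> ?w y"
          unfolding norm_mult
          by (subst ennreal_mult)
             (auto intro!: mult_mono ennreal_leI le order_trans[OF cmod_cpow_le npow_mono])
        then show ?case using elim
          by (metis enn2real_ennreal enn2real_mono infinity_ennreal_def less_top norm_ge_zero)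
      qed
    qed measurable
    then show ?case by (simp add: cconv_def)
  qed
qed (simp add: trunc_tendsto)

lemma nsq_eq_nabs: "nsq f = (\<integral>\<^sup>+x. (nabs f x)\<^sup>2 \<partial>lborel)"
  by (simp add: nsq_def ennreal_power)

lemma AE_finite_of_sq:
  fixes f :: "real \<Rightarrow> ennreal"
  assumes [measurable]: "f \<in> borel_measurable borel" and "(\<integral>\<^sup>+x. (f x)\<^sup>2 \<partial>lborel) < \<infinity>"
  shows "AE x in lborel. f x < \<infinity>"
proof -
  have "AE x in lborel. (f x)\<^sup>2 \<noteq> \<infinity>" using assms(2) by (intro nn_integral_PInf_AE) auto
  then show ?thesis by eventually_elim (auto simp: less_top power_eq_top_ennreal)
qed

text \<open>On truncations \<open>w\<^sub>R\<close> of the inverse transform the convolution theorem gives \<open>w\<^sub>R ^ (n + 1)\<close> exactly;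
  a common a.e. convergent subsequence identifies \<open>u ^ (n + 1)\<close> with the inverse transform of \<open>cpow uh n\<close>.\<close>
lemma power_norm_eq_cpow:
  assumes u: "square_integrable u" and F: "is_fourier u uh"
    and fin: "\<And>n. (\<integral>\<^sup>+x. (npow (nabs uh) n x)\<^sup>2 \<partial>lborel) < \<infinity>"
  shows "(\<integral>\<^sup>+x. ennreal (cmod (u x) ^ (2 * n + 2)) \<partial>lborel) = ennreal (1 / (2 * pi) ^ n) * nsq (cpow uh n)"
proof -
  note [measurable] = square_integrable_measurable[OF u]
  have uh: "square_integrable uh" using F by (rule is_fourier_square_integrable)
  note [measurable] = square_integrable_measurable[OF uh]
  define h where "h = cpow uh n"
  define hR where "hR R = cpow (trunc R uh) n" for R
  have [measurable]: "h \<in> borel_measurable borel" "hR R \<in> borel_measurable borel" for R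
    by (simp_all add: h_def hR_def)
  have h_le: "nabs h x \<le> npow (nabs uh) n x" for x unfolding h_def by (rule cmod_cpow_le)
  have hR_le: "nabs (hR R) x \<le> npow (nabs uh) n x" for x R
    unfolding hR_def by (rule order_trans[OF cmod_cpow_le npow_mono]) (auto intro!: ennreal_leI cmod_trunc_le)
  have sq: "square_integrable k" if "k \<in> borel_measurable borel" "\<And>x. nabs k x \<le> npow (nabs uh) n x" for k
  proof -
    have "nsq k \<le> (\<integral>\<^sup>+x. (npow (nabs uh) n x)\<^sup>2 \<partial>lborel)"
      unfolding nsq_eq_nabs by (intro nn_integral_mono power_mono that) auto
    with fin[of n] that(1) show ?thesis by (auto simp: square_integrable_iff intro: le_less_trans)
  qed
  have h_sq: "square_integrable h" by (rule sq) (auto simp: h_le)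
  have hR_sq: "square_integrable (hR R)" for R by (rule sq) (auto simp: hR_le)
  have hR_int: "integrable lborel (hR R)" for R
    unfolding hR_def by (intro integrable_cpow integrable_trunc uh)
  have finAE: "AE x in lborel. npow (nabs uh) m x < \<infinity>" for m
    by (rule AE_finite_of_sq) (auto simp: fin[simplified])
  have h_lim: "(\<lambda>R. nsq (\<lambda>x. h x - hR R x)) \<longlonglongrightarrow> 0"
  proof (rule nsq_dominated_tendsto_0[where w="\<lambda>x. 2 * npow (nabs uh) n x"])
    show "(\<integral>\<^sup>+x. (2 * npow (nabs uh) n x)\<^sup>2 \<partial>lborel) < \<infinity>"
      using fin[of n] by (simp add: power_mult_distrib nn_integral_cmult ennreal_mult_less_top power_less_top_ennreal)
    show "AE x in lborel. ennreal (cmod (h x - hR R x)) \<le> 2 * npow (nabs uh) n x" for R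
    proof (intro AE_I2)
      fix x
      have "ennreal (cmod (h x - hR R x)) \<le> ennreal (cmod (h x)) + ennreal (cmod (hR R x))"
        by (subst ennreal_plus[symmetric]) (auto intro!: ennreal_leI norm_triangle_ineq4 simp del: ennreal_plus)
      also have "\<dots> \<le> npow (nabs uh) n x + npow (nabs uh) n x" by (intro add_mono h_le hR_le)
      finally show "ennreal (cmod (h x - hR R x)) \<le> 2 * npow (nabs uh) n x" by (simp add: mult_2)
    qed
    show "AE x in lborel. (\<lambda>R. hR R x) \<longlonglongrightarrow> h x"
      unfolding h_def hR_def by (rule cpow_trunc_tendsto) (auto simp: finAE[simplified])
  qed auto
  define V where "V = fourier_L2 h"
  have V: "is_fourier h V" unfolding V_def by (rule is_fourier_fourier_L2[OF h_sq])
  have V_sq: "square_integrable V" by (rule is_fourier_square_integrable[OF V])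
  note [measurable] = square_integrable_measurable[OF V_sq]
  have FhR_sq: "square_integrable (fourier_L1 (hR R))" for R
    using fourier_Plancherel_L1[OF hR_int hR_sq, of R] hR_sq[of R] by (simp add: square_integrable_iff)
  \<comment> \<open>\<open>V\<close> is by definition approached by the transforms of truncations of
    \<open>h\<close>. The functions \<open>hR R\<close> are L^2 close to these truncations, so by
    Plancherel their transforms approach \<open>V\<close> too.\<close>
  have V_lim: "(\<lambda>R. nsq (\<lambda>x. V x - fourier_L1 (hR R) x)) \<longlonglongrightarrow> 0"
  proof (rule tendsto_sandwich[OF _ _ tendsto_const])
    let ?b = "\<lambda>R. 2 * nsq (\<lambda>x. V x - fourier_L1 (trunc R h) x) + 2 * (2 * nsq (\<lambda>x. h x - trunc R h x) + 2 * nsq (\<lambda>x. h x - hR R x))"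
    show "\<forall>\<^sub>F R in sequentially. nsq (\<lambda>x. V x - fourier_L1 (hR R) x) \<le> ?b R"
    proof (intro always_eventually allI)
      fix R
      have "nsq (\<lambda>x. V x - fourier_L1 (hR R) x)
          \<le> 2 * nsq (\<lambda>x. V x - fourier_L1 (trunc R h) x) + 2 * nsq (\<lambda>x. fourier_L1 (trunc R h) x - fourier_L1 (hR R) x)"
        by (rule nsq_triangle) auto
      also have "nsq (\<lambda>x. fourier_L1 (trunc R h) x - fourier_L1 (hR R) x) = nsq (\<lambda>x. trunc R h x - hR R x)"
        using fourier_Plancherel_L1[of "\<lambda>x. trunc R h x - hR R x"] integrable_trunc[OF h_sq, of R] hR_int[of R]
          square_integrable_diff[OF square_integrable_trunc[OF h_sq] hR_sq]
        by (simp add: fourier_L1_diff[symmetric])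
      also have "\<dots> \<le> 2 * nsq (\<lambda>x. trunc R h x - h x) + 2 * nsq (\<lambda>x. h x - hR R x)"
        by (rule nsq_triangle) auto
      finally show "nsq (\<lambda>x. V x - fourier_L1 (hR R) x) \<le> ?b R"
        by (simp add: nsq_minus_commute[of "trunc R h"] mult_left_mono add_left_mono)
    qed
    have "?b \<longlonglongrightarrow> 2 * 0 + 2 * (2 * 0 + 2 * 0)"
      using V h_lim trunc_L2_tendsto[OF h_sq]
      by (intro tendsto_add tendsto_mult_ennreal tendsto_const) (auto simp: is_fourier_iff)
    then show "?b \<longlonglongrightarrow> 0" by simp
  qed simp
  define w where "w R = fourier_L1 (trunc R (\<lambda>\<xi>. uh (- \<xi>)))" for R
  have w_sq: "square_integrable (w R)" for R
    unfolding w_def by (intro square_integrable_fourier_trunc square_integrable_reflect uh)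
  have w_lim: "(\<lambda>R. nsq (\<lambda>x. u x - w R x)) \<longlonglongrightarrow> 0"
    using is_fourier_inversion[OF u F] by (simp add: is_fourier_iff w_def)
  obtain r where r: "strict_mono r" "AE x in lborel. (\<lambda>k. w (r k) x) \<longlonglongrightarrow> u x"
    using L2_AE_subseq[OF u w_sq w_lim] by blast
  \<comment> \<open>The second subsequence is taken inside the first, so that both a.e. limits hold
    along the same indices.\<close>
  obtain q where q: "strict_mono q" "AE x in lborel. (\<lambda>k. fourier_L1 (hR (r (q k))) x) \<longlonglongrightarrow> V x"
    using L2_AE_subseq[OF V_sq FhR_sq LIMSEQ_subseq_LIMSEQ[OF V_lim r(1), unfolded o_def]] by blast
  let ?c = "complex_of_real (sqrt (2 * pi)) ^ n"
  have "AE x in lborel. V (- x) = ?c * u x ^ Suc n"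
    using r(2) AE_lborel_shift(3)[OF q(2)]
  proof eventually_elim
    case (elim x)
    \<comment> \<open>The reflection appears because \<open>w R\<close> is an inverse transform,
      that is, the transform of the truncated \<open>uh\<close> evaluated at -x.\<close>
    have eq: "fourier_L1 (hR R) (- x) = ?c * w R x ^ Suc n" for R
      unfolding hR_def w_def by (simp add: fourier_cpow integrable_trunc uh trunc_reflect fourier_L1_reflect)
    have L: "(\<lambda>k. ?c * w (r (q k)) x ^ Suc n) \<longlonglongrightarrow> ?c * u x ^ Suc n"
      using LIMSEQ_subseq_LIMSEQ[OF elim(1) q(1)] by (intro tendsto_intros) (simp add: o_def)
    show ?case by (rule LIMSEQ_unique[OF elim(2)[unfolded eq] L])
  qed
  then have "nsq (\<lambda>x. V (- x)) = nsq (\<lambda>x. ?c * u x ^ Suc n)"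
    by (intro nsq_cong_AE) auto
  also have "\<dots> = ennreal ((2 * pi) ^ n) * nsq (\<lambda>x. u x ^ Suc n)"
  proof -
    have "(a ^ n)\<^sup>2 = (a\<^sup>2) ^ n" for a :: real by (simp add: power_mult[symmetric] mult.commute)
    then have "(cmod ?c)\<^sup>2 = (\<bar>sqrt (2 * pi)\<bar>\<^sup>2) ^ n"
      unfolding norm_power norm_of_real .
    then have "(cmod ?c)\<^sup>2 = (2 * pi) ^ n" by simp
    then show ?thesis by (subst nsq_cmult) auto
  qed
  finally have "nsq h = ennreal ((2 * pi) ^ n) * nsq (\<lambda>x. u x ^ Suc n)"
    by (simp add: nsq_reflect is_fourier_Plancherel[OF h_sq V])
  then have "ennreal (1 / (2 * pi) ^ n) * nsq h = nsq (\<lambda>x. u x ^ Suc n)"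
    by (simp add: mult.assoc[symmetric] ennreal_mult[symmetric])
  also have "\<dots> = (\<integral>\<^sup>+x. ennreal (cmod (u x) ^ (2 * n + 2)) \<partial>lborel)"
  proof -
    have "(cmod (u x ^ Suc n))\<^sup>2 = cmod (u x) ^ (2 * n + 2)" for x
      unfolding norm_power power_mult[symmetric] by (rule arg_cong[where f="power _"]) simp
    then show ?thesis unfolding nsq_def by simp
  qed
  finally show ?thesis by (simp add: h_def)
qed

subsection \<open>Weighted bounds for convolution powers\<close>

lemma nn_integral_japanese_finite:
  fixes e :: real
  assumes e: "e > 1"
  shows "(\<integral>\<^sup>+x. ennreal ((1 + \<bar>x\<bar>) powr (- e)) \<partial>lborel) < \<infinity>"
proof -
  let ?f = "\<lambda>x::real. (1 + \<bar>x\<bar>) powr (- e)"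
  let ?F = "\<lambda>x::real. - ((1 + x) powr (1 - e)) / (e - 1)"
  have "(\<integral>\<^sup>+x. ennreal ((1 + x) powr (- e)) * indicator {0..} x \<partial>lborel) = ennreal (0 - ?F 0)"
  proof (rule nn_integral_FTC_atLeast)
    show "DERIV ?F x :> (1 + x) powr (- e)" if "0 \<le> x" for x
    proof -
      have "((\<lambda>x. (1 + x) powr (1 - e)) has_real_derivative (1 - e) * (1 + x) powr (1 - e - of_nat 1) * 1) (at x)"
        by (rule DERIV_fun_powr) (use that in \<open>auto intro!: derivative_eq_intros\<close>)
      then show ?thesis
        by (intro DERIV_cong[OF DERIV_cdivide[OF DERIV_minus, of _ _ _ _ "e - 1"]]) (use e in \<open>auto simp: field_simps\<close>)
    qed
    have "((\<lambda>x::real. (1 + x) powr (1 - e)) \<longlongrightarrow> 0) at_top"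
      using e by (intro tendsto_neg_powr filterlim_tendsto_add_at_top[OF tendsto_const] filterlim_ident) auto
    then have "((\<lambda>x. - ((1 + x) powr (1 - e)) / (e - 1)) \<longlongrightarrow> - 0 / (e - 1)) at_top"
      using e by (intro tendsto_intros) auto
    then show "(?F \<longlongrightarrow> 0) at_top" by simp
  qed auto
  then have half: "(\<integral>\<^sup>+x. ennreal ((1 + x) powr (- e)) * indicator {0..} x \<partial>lborel) < \<infinity>" by simp
  have refl: "(\<integral>\<^sup>+x. ennreal ((1 - x) powr (- e)) * indicator {..0} x \<partial>lborel)
      = (\<integral>\<^sup>+x. ennreal ((1 + x) powr (- e)) * indicator {0..} x \<partial>lborel)"
    using nn_integral_real_affine[of "\<lambda>x. ennreal ((1 - x) powr (- e)) * indicator {..0} x" "-1" 0]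
    by (simp add: indicator_def)
  have "(\<integral>\<^sup>+x. ennreal (?f x) \<partial>lborel) \<le> (\<integral>\<^sup>+x. ennreal ((1 + x) powr (- e)) * indicator {0..} x
      + ennreal ((1 - x) powr (- e)) * indicator {..0} x \<partial>lborel)"
    by (intro nn_integral_mono) (auto simp: indicator_def abs_if not_less)
  also have "\<dots> < \<infinity>"
    using half by (subst nn_integral_add) (auto simp: refl)
  finally show ?thesis .
qed

text \<open>As 1 + |x| is at most twice the larger of 1 + |y| and 1 + |x - y|, the weight is
  absorbed by the larger factor. The exponent left on it is nonpositive, so its base may be replaced
  by the smaller one. The total exponent 1 + a - b exceeds 1 as soon as b < a, which is what
  integrability requires.\<close>

lemma japanese_kernel_bound:
  fixes a b x y :: real
  assumes "0 \<le> b" "b \<le> a" "a \<le> 1"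
  shows "(1 + \<bar>x\<bar>) powr b * ((1 + \<bar>y\<bar>) powr (- 1) * (1 + \<bar>x - y\<bar>) powr (- a))
    \<le> 2 * ((1 + \<bar>y\<bar>) powr (- (1 + a - b)) + (1 + \<bar>x - y\<bar>) powr (- (1 + a - b)))"
proof -
  define p where "p = 1 + \<bar>y\<bar>"
  define q where "q = 1 + \<bar>x - y\<bar>"
  have pq: "p \<ge> 1" "q \<ge> 1" "1 + \<bar>x\<bar> \<le> p + q" by (auto simp: p_def q_def)
  have two: "(2::real) powr b \<le> 2" using powr_mono[of b 1 "2::real"] assms by simp
  have "(1 + \<bar>x\<bar>) powr b * (p powr (- 1) * q powr (- a)) \<le> 2 * (p powr (- (1 + a - b)) + q powr (- (1 + a - b)))"
  proof (cases "p \<ge> q")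
    case True
    have "(1 + \<bar>x\<bar>) powr b \<le> (2 * p) powr b"
      using pq True assms by (intro powr_mono2) auto
    also have "\<dots> \<le> 2 * p powr b"
      using two pq by (simp add: powr_mult)
    finally have "(1 + \<bar>x\<bar>) powr b * (p powr (- 1) * q powr (- a)) \<le> 2 * p powr b * (p powr (- 1) * q powr (- a))"
      by (intro mult_right_mono) auto
    also have "\<dots> = 2 * (p powr (b - 1) * q powr (- a))"
      using pq by (simp add: powr_diff powr_minus field_simps)
    also have "\<dots> \<le> 2 * (q powr (b - 1) * q powr (- a))"
      using pq True assms by (intro mult_left_mono mult_right_mono powr_mono2') auto
    also have "\<dots> = 2 * q powr (- (1 + a - b))"
      by (simp add: powr_add[symmetric] algebra_simps)
    finally show ?thesis by (simp add: distrib_left add_increasing)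
  next
    case False
    have "(1 + \<bar>x\<bar>) powr b \<le> (2 * q) powr b"
      using pq False assms by (intro powr_mono2) auto
    also have "\<dots> \<le> 2 * q powr b"
      using two pq by (simp add: powr_mult)
    finally have "(1 + \<bar>x\<bar>) powr b * (p powr (- 1) * q powr (- a)) \<le> 2 * q powr b * (p powr (- 1) * q powr (- a))"
      by (intro mult_right_mono) auto
    also have "\<dots> = 2 * (q powr (b - a) * p powr (- 1))"
      using pq by (simp add: powr_diff powr_minus field_simps)
    also have "\<dots> \<le> 2 * (p powr (b - a) * p powr (- 1))"
      using pq False assms by (intro mult_left_mono mult_right_mono powr_mono2') auto
    also have "\<dots> = 2 * p powr (- (1 + a - b))"
      by (simp only: powr_add[symmetric]) (simp add: algebra_simps)
    finally show ?thesis by (simp add: distrib_left add_increasing2)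
  qed
  then show ?thesis by (simp add: p_def q_def)
qed

definition wpow :: "real \<Rightarrow> real \<Rightarrow> ennreal" where
  "wpow a x = ennreal ((1 + \<bar>x\<bar>) powr a)"

lemma wpow_measurable [measurable]: "wpow a \<in> borel_measurable borel"
  unfolding wpow_def by measurable

text \<open>Cauchy--Schwarz against the kernel \<open>\<integral> (1+|y|)\<^sup>-\<^sup>1 (1+|x-y|) powr (-a) dy\<close>, which decays like
  \<open>(1+|x|) powr (-b)\<close> for every \<open>b < a\<close>: each convolution costs an arbitrarily small power of the weight.\<close>
lemma nconv_weighted_L2:
  assumes [measurable]: "f \<in> borel_measurable borel" "h \<in> borel_measurable borel"
    and ab: "0 \<le> b" "b < a" "a \<le> 1"
    and f: "(\<integral>\<^sup>+x. (f x)\<^sup>2 * wpow a x \<partial>lborel) < \<infinity>" and h: "(\<integral>\<^sup>+x. (h x)\<^sup>2 * wpow 1 x \<partial>lborel) < \<infinity>"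
  shows "(\<integral>\<^sup>+x. (nconv h f x)\<^sup>2 * wpow b x \<partial>lborel) < \<infinity>"
proof -
  \<comment> \<open>One factor 2 comes from the kernel bound, the other from its two summands, which
    have equal integrals.\<close>
  define C where "C = 4 * (\<integral>\<^sup>+x. ennreal ((1 + \<bar>x\<bar>) powr (- (1 + a - b))) \<partial>lborel)"
  have C: "C < \<infinity>" unfolding C_def
    using ab nn_integral_japanese_finite[of "1 + a - b"] by (simp add: ennreal_mult_less_top)
  define K where "K x = (\<integral>\<^sup>+y. wpow (- 1) y * wpow (- a) (x - y) \<partial>lborel)" for x
  have K: "wpow b x * K x \<le> C" for x
  proof -
    let ?e = "\<lambda>y. ennreal ((1 + \<bar>y\<bar>) powr (- (1 + a - b)))"
    have "wpow b x * K x = (\<integral>\<^sup>+y. wpow b x * (wpow (- 1) y * wpow (- a) (x - y)) \<partial>lborel)"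
      unfolding K_def by (simp add: nn_integral_cmult)
    also have "\<dots> \<le> (\<integral>\<^sup>+y. 2 * (?e y + ?e (x - y)) \<partial>lborel)"
    proof (intro nn_integral_mono)
      fix y
      have "wpow b x * (wpow (- 1) y * wpow (- a) (x - y))
          = ennreal ((1 + \<bar>x\<bar>) powr b * ((1 + \<bar>y\<bar>) powr (- 1) * (1 + \<bar>x - y\<bar>) powr (- a)))"
        by (simp only: wpow_def ennreal_mult powr_ge_zero mult_nonneg_nonneg)
      also have "\<dots> \<le> ennreal (2 * ((1 + \<bar>y\<bar>) powr (- (1 + a - b)) + (1 + \<bar>x - y\<bar>) powr (- (1 + a - b))))"
        using japanese_kernel_bound[of b a x y] ab by (intro ennreal_leI) auto
      also have "\<dots> = 2 * (?e y + ?e (x - y))"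
        by (subst ennreal_mult) (auto simp: ennreal_plus)
      finally show "wpow b x * (wpow (- 1) y * wpow (- a) (x - y)) \<le> 2 * (?e y + ?e (x - y))" .
    qed
    also have "\<dots> = 2 * ((\<integral>\<^sup>+y. ?e y \<partial>lborel) + (\<integral>\<^sup>+y. ?e (x - y) \<partial>lborel))"
      by (simp add: nn_integral_cmult nn_integral_add)
    also have "(\<integral>\<^sup>+y. ?e (x - y) \<partial>lborel) = (\<integral>\<^sup>+y. ?e y \<partial>lborel)"
      by (rule nn_integral_reflect_shift) measurable
    also have "2 * ((\<integral>\<^sup>+y. ?e y \<partial>lborel) + (\<integral>\<^sup>+y. ?e y \<partial>lborel)) = C"
      unfolding C_def by (simp add: mult_2[symmetric] mult.assoc[symmetric])
    finally show ?thesis .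
  qed
  let ?H = "\<lambda>y. (h y)\<^sup>2 * wpow 1 y" and ?G = "\<lambda>y. (f y)\<^sup>2 * wpow a y"
  have CS: "(nconv h f x)\<^sup>2 \<le> nconv ?H ?G x * K x" for x
  proof -
    \<comment> \<open>Square roots of the weights are inserted and divided out, so that
      Cauchy-Schwarz separates the weighted squares from the kernel \<open>K\<close>.\<close>
    let ?\<alpha> = "\<lambda>y. h y * wpow (1/2) y * (f (x - y) * wpow (a/2) (x - y))"
    let ?\<beta> = "\<lambda>y. wpow (- 1/2) y * wpow (- a/2) (x - y)"
    have w1: "wpow (c/2) y * wpow (- c/2) y = 1" for c y
      unfolding wpow_def by (subst ennreal_mult[symmetric]) (auto simp: powr_add[symmetric])
    have w2: "(wpow (c/2) y)\<^sup>2 = wpow c y" for c y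
      unfolding wpow_def power2_eq_square by (subst ennreal_mult[symmetric]) (auto simp: powr_add[symmetric])
    have "nconv h f x = (\<integral>\<^sup>+y. ?\<alpha> y * ?\<beta> y \<partial>lborel)"
      unfolding nconv_def
    proof (intro nn_integral_cong)
      fix y
      have "?\<alpha> y * ?\<beta> y = h y * f (x - y) * (wpow (1/2) y * wpow (- 1/2) y) * (wpow (a/2) (x - y) * wpow (- a/2) (x - y))"
        by (simp add: mult_ac)
      then show "h y * f (x - y) = ?\<alpha> y * ?\<beta> y" by (simp only: w1 mult_1_right)
    qed
    then have "(nconv h f x)\<^sup>2 \<le> (\<integral>\<^sup>+y. (?\<alpha> y)\<^sup>2 \<partial>lborel) * (\<integral>\<^sup>+y. (?\<beta> y)\<^sup>2 \<partial>lborel)"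
      using Cauchy_Schwarz_nn_integral[of ?\<alpha> lborel ?\<beta>] by simp
    also have "(\<integral>\<^sup>+y. (?\<alpha> y)\<^sup>2 \<partial>lborel) = nconv ?H ?G x"
      unfolding nconv_def by (simp add: power_mult_distrib w2)
    also have "(\<integral>\<^sup>+y. (?\<beta> y)\<^sup>2 \<partial>lborel) = K x"
      unfolding K_def using w2[of "- 1"] w2[of "- a"] by (simp add: power_mult_distrib)
    finally show ?thesis .
  qed
  have "(\<integral>\<^sup>+x. (nconv h f x)\<^sup>2 * wpow b x \<partial>lborel) \<le> (\<integral>\<^sup>+x. nconv ?H ?G x * C \<partial>lborel)"
  proof (intro nn_integral_mono)
    fix x
    have "(nconv h f x)\<^sup>2 * wpow b x \<le> nconv ?H ?G x * K x * wpow b x"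
      by (intro mult_right_mono CS) auto
    also have "\<dots> = nconv ?H ?G x * (wpow b x * K x)" by (simp add: mult_ac)
    also have "\<dots> \<le> nconv ?H ?G x * C" by (intro mult_left_mono K) auto
    finally show "(nconv h f x)\<^sup>2 * wpow b x \<le> nconv ?H ?G x * C" .
  qed
  also have "\<dots> = (\<integral>\<^sup>+x. ?H x \<partial>lborel) * (\<integral>\<^sup>+x. ?G x \<partial>lborel) * C"
    by (simp add: nn_integral_multc nn_integral_nconv)
  also have "\<dots> < \<infinity>" using f h C by (simp add: ennreal_mult_less_top)
  finally show ?thesis .
qed

lemma npow_L2_finite:
  assumes [measurable]: "g \<in> borel_measurable borel" and g: "(\<integral>\<^sup>+x. (g x)\<^sup>2 * wpow 1 x \<partial>lborel) < \<infinity>"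
  shows "(\<integral>\<^sup>+x. (npow g n x)\<^sup>2 \<partial>lborel) < \<infinity>"
proof -
  \<comment> \<open>The exponent at stage \<open>k\<close> is 1 - k/(n+1): it starts at 1, decreases
    strictly, and is still 1/(n+1) at k = n.\<close>
  have *: "(\<integral>\<^sup>+x. (npow g k x)\<^sup>2 * wpow (1 - real k / real (Suc n)) x \<partial>lborel) < \<infinity>" if "k \<le> n" for k
    using that
  proof (induction k)
    case (Suc k)
    then show ?case
      unfolding npow.simps
      by (intro nconv_weighted_L2[where a="1 - real k / real (Suc n)"] g)
         (auto simp: divide_simps)
  qed (use g in simp)
  have "(\<integral>\<^sup>+x. (npow g n x)\<^sup>2 \<partial>lborel) \<le> (\<integral>\<^sup>+x. (npow g n x)\<^sup>2 * wpow (1 - real n / real (Suc n)) x \<partial>lborel)"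
  proof (intro nn_integral_mono)
    fix x
    have "(1::real) \<le> (1 + \<bar>x\<bar>) powr (1 - real n / real (Suc n))"
      by (intro ge_one_powr_ge_zero) (auto simp: field_simps)
    then have "1 \<le> wpow (1 - real n / real (Suc n)) x"
      unfolding wpow_def ennreal_1[symmetric] by (rule ennreal_leI)
    then show "(npow g n x)\<^sup>2 \<le> (npow g n x)\<^sup>2 * wpow (1 - real n / real (Suc n)) x"
      using mult_left_mono[of 1 _ "(npow g n x)\<^sup>2"] by simp
  qed
  also have "\<dots> < \<infinity>" using *[of n] by simp
  finally show ?thesis .
qed

subsection \<open>Propagation of zeros\<close>

text \<open>On the Fourier side translation is multiplication by a phase that tends to 1, so
  Plancherel reduces the claim to dominated convergence.\<close>

lemma L2_translation_continuous:
  assumes f: "integrable lborel f" "square_integrable f" and t: "t \<longlonglongrightarrow> 0"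
  shows "(\<lambda>n. nsq (\<lambda>x. f x - f (x + t n))) \<longlonglongrightarrow> 0"
proof -
  let ?F = "fourier_L1 f"
  have [measurable]: "f \<in> borel_measurable borel" using f by auto
  have shift: "fourier_L1 (\<lambda>x. f (x + a)) \<xi> = ?F \<xi> * cis (\<xi> * a)" for a \<xi>
  proof -
    have "(LINT x|lborel. f (x + a) * cis (- (\<xi> * x))) = (LINT x|lborel. f x * cis (- (\<xi> * (x - a))))"
      using lborel_integral_real_affine[of 1 "\<lambda>x. f x * cis (- (\<xi> * (x - a)))" a] by (simp add: add.commute)
    also have "\<dots> = (LINT x|lborel. f x * cis (- (\<xi> * x)) * cis (\<xi> * a))"
      by (intro lebesgue_integral_cong refl) (simp add: cis_mult mult.assoc algebra_simps)
    finally show ?thesis by (simp add: fourier_L1_def)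
  qed
  have int: "integrable lborel (\<lambda>x. f (x + a))" for a
    using lborel_integrable_real_affine[OF f(1), of 1 a] by (simp add: add.commute)
  have sq: "square_integrable (\<lambda>x. f (x + a))" for a
    using f(2) by (simp add: square_integrable_iff nsq_shift)
  have "fourier_L1 (\<lambda>x. f x - f (x + a)) = (\<lambda>\<xi>. ?F \<xi> - ?F \<xi> * cis (\<xi> * a))" for a
    by (rule ext) (simp add: fourier_L1_diff f int shift)
  then have "nsq (\<lambda>x. f x - f (x + a)) = nsq (\<lambda>\<xi>. ?F \<xi> - ?F \<xi> * cis (\<xi> * a))" for a
    using fourier_Plancherel_L1[of "\<lambda>x. f x - f (x + a)"] f int sq
    by (simp add: square_integrable_diff)
  moreover have "(\<lambda>n. nsq (\<lambda>\<xi>. ?F \<xi> - ?F \<xi> * cis (\<xi> * t n))) \<longlonglongrightarrow> 0"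
  proof (rule nsq_dominated_tendsto_0[where w="\<lambda>x. ennreal (2 * cmod (?F x))"])
    have "(\<integral>\<^sup>+x. (ennreal (2 * cmod (?F x)))\<^sup>2 \<partial>lborel) = nsq (\<lambda>x. 2 * ?F x)"
      by (simp add: nsq_def ennreal_power norm_mult)
    also have "\<dots> < \<infinity>"
      using f(2) fourier_Plancherel_L1[OF f] by (simp add: nsq_cmult square_integrable_iff ennreal_mult_less_top)
    finally show "(\<integral>\<^sup>+x. (ennreal (2 * cmod (?F x)))\<^sup>2 \<partial>lborel) < \<infinity>" .
    show "AE \<xi> in lborel. ennreal (cmod (?F \<xi> - ?F \<xi> * cis (\<xi> * t n))) \<le> ennreal (2 * cmod (?F \<xi>))" for n
    proof (intro AE_I2 ennreal_leI)
      fix \<xi>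
      show "cmod (?F \<xi> - ?F \<xi> * cis (\<xi> * t n)) \<le> 2 * cmod (?F \<xi>)"
        using norm_triangle_ineq4[of "?F \<xi>" "?F \<xi> * cis (\<xi> * t n)"] by (simp add: norm_mult)
    qed
    show "AE \<xi> in lborel. (\<lambda>n. ?F \<xi> * cis (\<xi> * t n)) \<longlonglongrightarrow> ?F \<xi>"
    proof (intro AE_I2)
      fix \<xi>
      have "(\<lambda>n. ?F \<xi> * cis (\<xi> * t n)) \<longlonglongrightarrow> ?F \<xi> * cis (\<xi> * 0)"
        by (intro tendsto_intros t)
      then show "(\<lambda>n. ?F \<xi> * cis (\<xi> * t n)) \<longlonglongrightarrow> ?F \<xi>" by simp
    qed
  qed auto
  ultimately show ?thesis by simp
qed

text \<open>Otherwise shifts \<open>t n\<close> tending to 0 would carry the support of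
  \<open>G\<close> off itself up to null sets. For the indicator of a bounded part of that support,
  the distance to its shift would then be at least its own norm, against continuity of
  translation.\<close>

lemma autocorrelation_pos:
  fixes G :: "real \<Rightarrow> ennreal"
  assumes [measurable]: "G \<in> borel_measurable borel" and nz: "\<not> (AE x in lborel. G x = 0)"
  shows "\<exists>\<epsilon>>0. \<forall>t. \<bar>t\<bar> < \<epsilon> \<longrightarrow> (\<integral>\<^sup>+x. G x * G (x + t) \<partial>lborel) \<noteq> 0"
proof (rule ccontr)
  assume "\<not> ?thesis"
  then have "\<forall>n. \<exists>t. \<bar>t\<bar> < 1 / real (Suc n) \<and> (\<integral>\<^sup>+x. G x * G (x + t) \<partial>lborel) = 0"
    by (auto dest!: spec[of _ "1 / real (Suc _)"] simp del: of_nat_Suc)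
  then obtain t where t: "\<And>n. \<bar>t n\<bar> < 1 / real (Suc n)" "\<And>n. (\<integral>\<^sup>+x. G x * G (x + t n) \<partial>lborel) = 0"
    by metis
  have t0: "t \<longlonglongrightarrow> 0"
    by (rule tendsto_norm_zero_cancel, rule tendsto_sandwich[OF _ _ tendsto_const LIMSEQ_inverse_real_of_nat])
       (use t(1) in \<open>auto simp: inverse_eq_divide less_imp_le simp del: of_nat_Suc\<close>)
  have "\<exists>k::nat. \<not> (AE x in lborel. \<bar>x\<bar> \<le> real k \<longrightarrow> G x = 0)"
  proof (rule ccontr)
    assume "\<not> ?thesis"
    then have "AE x in lborel. \<forall>k::nat. \<bar>x\<bar> \<le> real k \<longrightarrow> G x = 0" unfolding AE_all_countable by blast
    then have "AE x in lborel. G x = 0"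
      by eventually_elim (use real_arch_simple in blast)
    with nz show False by blast
  qed
  then obtain k :: nat where k: "\<not> (AE x in lborel. \<bar>x\<bar> \<le> real k \<longrightarrow> G x = 0)" by blast
  \<comment> \<open>Restricting to a bounded set of positive measure makes the indicator integrable
    and square integrable.\<close>
  define S where "S = {x. \<bar>x\<bar> \<le> real k \<and> G x \<noteq> 0}"
  have [measurable]: "S \<in> sets borel" unfolding S_def by measurable
  define f :: "real \<Rightarrow> complex" where "f = indicator S"
  have [measurable]: "f \<in> borel_measurable borel" unfolding f_def by measurable
  have le: "cmod (f x) \<le> cmod (indicator {- real k..real k} x)" for x
    by (auto simp: f_def S_def indicator_def)
  have f_sq: "square_integrable f"
    by (rule square_integrable_bound[OF square_integrable_indicator[of k]]) (auto simp: le)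
  have "f = trunc k f" by (rule ext) (auto simp: trunc_def f_def S_def indicator_def)
  then have f_int: "integrable lborel f" using integrable_trunc[OF f_sq, of k] by simp
  have "nsq f \<le> nsq (\<lambda>x. f x - f (x + t n))" for n
  proof -
    have "AE x in lborel. G x * G (x + t n) = 0"
      using t(2)[of n] by (subst (asm) nn_integral_0_iff_AE) auto
    then show ?thesis unfolding nsq_def
      by (intro nn_integral_mono_AE) (auto elim!: eventually_mono simp: f_def S_def indicator_def)
  qed
  then have "nsq f \<le> 0"
    by (intro tendsto_lowerbound[OF L2_translation_continuous[OF f_int f_sq t0]]) auto
  then have "AE x in lborel. f x = 0" by (subst nsq_zero_iff[symmetric]) auto
  then have "AE x in lborel. \<bar>x\<bar> \<le> real k \<longrightarrow> G x = 0"
    by eventually_elim (auto simp: f_def S_def indicator_def split: if_splits)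
  with k show False by blast
qed

lemma not_AE_interval:
  fixes a b :: real
  assumes "a < b"
  shows "\<not> (AE x in lborel. x \<notin> {a..<b})"
proof
  assume "AE x in lborel. x \<notin> {a..<b}"
  then have "{a..<b} \<in> null_sets lborel" by (subst AE_iff_null_sets) auto
  with assms show False by (simp add: null_sets_def)
qed

text \<open>On a grid of mesh \<open>\<epsilon>/2\<close>, a cell meeting the zero set in positive measure lies in the zero set together
  with its two neighbours.\<close>
lemma AE_nonzero_of_local_propagation:
  fixes g :: "real \<Rightarrow> ennreal"
  assumes \<epsilon>: "\<epsilon> > 0" and nz: "\<not> (AE x in lborel. g x = 0)"
    and spreads: "AE y in lborel. g y = 0 \<longrightarrow> (AE z in lborel. \<bar>z - y\<bar> < \<epsilon> \<longrightarrow> g z = 0)"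
  shows "AE x in lborel. g x \<noteq> 0"
proof (rule ccontr)
  assume contr: "\<not> ?thesis"
  \<comment> \<open>Points of the same or of adjacent half-open cells of length \<open>d\<close> are
    at distance less than 2 d, which is \<open>\<epsilon>\<close>.\<close>
  define d where "d = \<epsilon> / 2"
  have d: "d > 0" using \<epsilon> by (simp add: d_def)
  define I where "I j = {real_of_int j * d..<real_of_int (j + 1) * d}" for j :: int
  have cover: "x \<in> I \<lfloor>x / d\<rfloor>" for x
    unfolding I_def using d floor_divide_lower[of d x] floor_divide_upper[of d x] by simp
  define bad where "bad j \<longleftrightarrow> (AE x in lborel. x \<in> I j \<longrightarrow> g x = 0)" for j
  have start: "\<exists>j. \<not> (AE x in lborel. x \<in> I j \<longrightarrow> g x \<noteq> 0)"
  proof (rule ccontr)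
    assume "\<not> ?thesis"
    then have "AE x in lborel. \<forall>j. x \<in> I j \<longrightarrow> g x \<noteq> 0" unfolding AE_all_countable by blast
    then have "AE x in lborel. g x \<noteq> 0" by eventually_elim (use cover in blast)
    with contr show False by blast
  qed
  have spread: "bad (j - 1) \<and> bad j \<and> bad (j + 1)" if j: "\<not> (AE x in lborel. x \<in> I j \<longrightarrow> g x \<noteq> 0)" for j
  proof -
    have "\<exists>y\<in>I j. AE z in lborel. \<bar>z - y\<bar> < \<epsilon> \<longrightarrow> g z = 0"
    proof (rule ccontr)
      assume "\<not> ?thesis"
      then have "AE y in lborel. y \<in> I j \<longrightarrow> g y \<noteq> 0" using spreads by (auto elim!: eventually_mono)
      with j show False by blast
    qed
    then obtain y where y: "y \<in> I j" "AE z in lborel. \<bar>z - y\<bar> < \<epsilon> \<longrightarrow> g z = 0" by blast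
    have "\<bar>z - y\<bar> < \<epsilon>" if "z \<in> I (j - 1) \<or> z \<in> I j \<or> z \<in> I (j + 1)" for z
      using that y(1) d unfolding I_def by (auto simp: d_def algebra_simps abs_if)
    with y(2) show ?thesis unfolding bad_def by (auto elim!: eventually_mono)
  qed
  \<comment> \<open>A cell on which \<open>g\<close> vanishes a.e. has positive length, hence meets
    the zero set in positive measure and spreads again.\<close>
  have bad_step: "bad (j - 1) \<and> bad j \<and> bad (j + 1)" if "bad j" for j
  proof (rule spread, rule notI)
    assume "AE x in lborel. x \<in> I j \<longrightarrow> g x \<noteq> 0"
    with that have "AE x in lborel. x \<notin> I j" unfolding bad_def by eventually_elim auto
    moreover have "real_of_int j * d < real_of_int (j + 1) * d" using d by simp
    ultimately show False using not_AE_interval unfolding I_def by blast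
  qed
  from start spread obtain j0 where j0: "bad j0" by blast
  have "bad j" for j
  proof (cases "j \<ge> j0")
    case True then show ?thesis
      by (induction j rule: int_ge_induct) (use j0 bad_step in auto)
  next
    case False then have "j \<le> j0" by simp
    then show ?thesis by (induction j rule: int_le_induct) (use j0 bad_step in auto)
  qed
  then have "AE x in lborel. \<forall>j. x \<in> I j \<longrightarrow> g x = 0" unfolding bad_def AE_all_countable by blast
  then have "AE x in lborel. g x = 0" by eventually_elim (use cover in blast)
  with nz show False by blast
qed

text \<open>The hypothesis says that \<open>g\<close> convolved with the autocorrelation of \<open>G\<close> vanishes where \<open>g\<close> does;
  that autocorrelation is positive near the origin, so zeros of \<open>g\<close> propagate.\<close>
lemma AE_nonzero_of_correlation:
  fixes g G :: "real \<Rightarrow> ennreal"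
  assumes [measurable]: "g \<in> borel_measurable borel" "G \<in> borel_measurable borel"
    and gnz: "\<not> (AE x in lborel. g x = 0)" and Gnz: "\<not> (AE x in lborel. G x = 0)"
    and H: "AE y in lborel. g y = 0 \<longrightarrow> (\<integral>\<^sup>+\<xi>. nconv g G \<xi> * G (\<xi> - y) \<partial>lborel) = 0"
  shows "AE x in lborel. g x \<noteq> 0"
proof -
  let ?\<rho> = "\<lambda>t. \<integral>\<^sup>+x. G x * G (x + t) \<partial>lborel"
  obtain \<epsilon> where \<epsilon>: "\<epsilon> > 0" "\<And>t. \<bar>t\<bar> < \<epsilon> \<Longrightarrow> (\<integral>\<^sup>+x. G x * G (x + t) \<partial>lborel) \<noteq> 0"
    using autocorrelation_pos[of G] Gnz by auto
  show ?thesis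
  proof (rule AE_nonzero_of_local_propagation[OF \<epsilon>(1) gnz])
    show "AE y in lborel. g y = 0 \<longrightarrow> (AE z in lborel. \<bar>z - y\<bar> < \<epsilon> \<longrightarrow> g z = 0)"
      using H
    proof (eventually_elim, intro impI)
      fix y assume "g y = 0 \<longrightarrow> (\<integral>\<^sup>+\<xi>. nconv g G \<xi> * G (\<xi> - y) \<partial>lborel) = 0" "g y = 0"
      then have "0 = (\<integral>\<^sup>+\<xi>. nconv g G \<xi> * G (\<xi> - y) \<partial>lborel)" by simp
      also have "\<dots> = (\<integral>\<^sup>+\<xi>. \<integral>\<^sup>+z. g z * G (\<xi> - z) * G (\<xi> - y) \<partial>lborel \<partial>lborel)"
        unfolding nconv_def by (simp add: nn_integral_multc)
      also have "\<dots> = (\<integral>\<^sup>+z. \<integral>\<^sup>+\<xi>. g z * G (\<xi> - z) * G (\<xi> - y) \<partial>lborel \<partial>lborel)"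
        by (rule lborel_pair.Fubini') measurable
      also have "\<dots> = (\<integral>\<^sup>+z. g z * (?\<rho> (z - y)) \<partial>lborel)"
      proof (intro nn_integral_cong)
        fix z
        have "(\<integral>\<^sup>+\<xi>. g z * G (\<xi> - z) * G (\<xi> - y) \<partial>lborel) = g z * (\<integral>\<^sup>+\<xi>. G (\<xi> - z) * G (\<xi> - y) \<partial>lborel)"
          by (simp add: mult.assoc nn_integral_cmult)
        \<comment> \<open>Shifting the integration variable by \<open>z\<close> leaves an
          autocorrelation that depends on z - y alone.\<close>
        also have "(\<integral>\<^sup>+\<xi>. G (\<xi> - z) * G (\<xi> - y) \<partial>lborel) = (?\<rho> (z - y))"
          using nn_integral_shift[of "\<lambda>\<xi>. G (\<xi> - z) * G (\<xi> - y)" z] by (simp add: add_diff_eq)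
        finally show "(\<integral>\<^sup>+\<xi>. g z * G (\<xi> - z) * G (\<xi> - y) \<partial>lborel) = g z * (?\<rho> (z - y))" .
      qed
      finally have "AE z in lborel. g z * (?\<rho> (z - y)) = 0"
        by (subst (asm) eq_commute, subst (asm) nn_integral_0_iff_AE) auto
      then show "AE z in lborel. \<bar>z - y\<bar> < \<epsilon> \<longrightarrow> g z = 0"
        by eventually_elim (use \<epsilon>(2) in auto)
    qed
  qed
qed

text \<open>Two sets of full measure, one of them reflected and shifted, still intersect in a set of
  full measure; this gives every \<open>x\<close>, not only almost every one.\<close>

lemma nconv_nonzero:
  assumes [measurable]: "f \<in> borel_measurable borel" "g \<in> borel_measurable borel"
    and f: "AE x in lborel. f x \<noteq> 0" and g: "AE x in lborel. g x \<noteq> 0"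
  shows "nconv f g x \<noteq> 0"
proof
  assume "nconv f g x = 0"
  then have "AE y in lborel. f y * g (x - y) = 0"
    unfolding nconv_def by (subst (asm) nn_integral_0_iff_AE) auto
  with f AE_lborel_shift(1)[OF g, of x] have "AE y in lborel. (y::real) \<notin> {0..<1}"
    by eventually_elim auto
  with not_AE_interval[of 0 1] show False by simp
qed

lemma npow_AE_nonzero:
  assumes [measurable]: "g \<in> borel_measurable borel" and g: "AE x in lborel. g x \<noteq> 0"
  shows "AE x in lborel. npow g n x \<noteq> 0"
proof (induction n)
  case (Suc n)
  show ?case unfolding npow.simps by (intro AE_I2 nconv_nonzero g Suc.IH) auto
qed (use g in simp)

text \<open>Integrals multiply under convolution. This weaker nonvanishing is available before
  \<open>g\<close> is known to be positive a.e., and it feeds that proof.\<close>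

lemma npow_not_AE_zero:
  assumes [measurable]: "g \<in> borel_measurable borel" and g: "\<not> (AE x in lborel. g x = 0)"
  shows "\<not> (AE x in lborel. npow g n x = 0)"
proof (induction n)
  case (Suc n)
  have "(\<integral>\<^sup>+x. g x \<partial>lborel) \<noteq> 0" "(\<integral>\<^sup>+x. npow g n x \<partial>lborel) \<noteq> 0"
    using g Suc.IH by (auto simp: nn_integral_0_iff_AE)
  then have "(\<integral>\<^sup>+x. npow g (Suc n) x \<partial>lborel) \<noteq> 0" by (simp add: nn_integral_nconv)
  then show ?case by (subst (asm) nn_integral_0_iff_AE) auto
qed (use g in simp)

subsection \<open>The variational inequality on the Fourier side\<close>

lemma cpow_cong_AE:
  assumes [measurable]: "u \<in> borel_measurable borel" "v \<in> borel_measurable borel" and eq: "AE x in lborel. u x = v x"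
  shows "AE x in lborel. cpow u n x = cpow v n x"
proof (induction n)
  case (Suc n)
  have "cconv u (cpow u n) x = cconv v (cpow v n) x" for x
    unfolding cconv_def
  proof (rule integral_cong_AE)
    show "AE y in lborel. u y * cpow u n (x - y) = v y * cpow v n (x - y)"
      using eq AE_lborel_shift(1)[OF Suc.IH, of x] by eventually_elim simp
  qed measurable
  then show ?case by simp
qed (use eq in simp)

lemma cpow_of_real:
  fixes f :: "real \<Rightarrow> real"
  assumes [measurable]: "f \<in> borel_measurable borel" and nn: "\<And>x. f x \<ge> 0"
    and fin: "\<And>n. AE x in lborel. npow (\<lambda>x. ennreal (f x)) n x < \<infinity>"
  shows "AE x in lborel. cpow (\<lambda>x. complex_of_real (f x)) n x = complex_of_real (enn2real (npow (\<lambda>x. ennreal (f x)) n x))"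
proof (induction n)
  case (Suc n)
  let ?f = "\<lambda>x. ennreal (f x)"
  let ?c = "\<lambda>x. complex_of_real (f x)"
  let ?L = "cconv ?c (cpow ?c n)"
  have "?L x
      = complex_of_real (enn2real (nconv ?f (npow ?f n) x))" for x
  proof -
    have "?L x
        = (LINT y|lborel. complex_of_real (f y * enn2real (npow ?f n (x - y))))"
      unfolding cconv_def
    proof (rule integral_cong_AE)
      show "AE y in lborel. complex_of_real (f y) * cpow ?c n (x - y)
          = complex_of_real (f y * enn2real (npow ?f n (x - y)))"
        using AE_lborel_shift(1)[OF Suc.IH, of x] by eventually_elim simp
    qed measurable
    also have "\<dots> = complex_of_real (LINT y|lborel. f y * enn2real (npow ?f n (x - y)))"
      by (rule integral_complex_of_real)
    \<comment> \<open>Divergence is harmless: the Bochner integral and \<open>enn2real\<close> of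
      infinity are then both 0.\<close>
    also have "(LINT y|lborel. f y * enn2real (npow ?f n (x - y))) = enn2real (\<integral>\<^sup>+y. ennreal (f y * enn2real (npow ?f n (x - y))) \<partial>lborel)"
      by (rule integral_eq_nn_integral) (auto simp: nn)
    also have "(\<integral>\<^sup>+y. ennreal (f y * enn2real (npow ?f n (x - y))) \<partial>lborel) = nconv ?f (npow ?f n) x"
      unfolding nconv_def
    proof (rule nn_integral_cong_AE)
      show "AE y in lborel. ennreal (f y * enn2real (npow ?f n (x - y))) = ennreal (f y) * npow ?f n (x - y)"
        using AE_lborel_shift(1)[OF fin[of n], of x] by eventually_elim (simp add: ennreal_mult nn)
    qed
    finally show ?thesis .
  qed
  then show ?case by simp
qed (simp add: nn)

lemma nsq_cpow_of_real:
  fixes f :: "real \<Rightarrow> real"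
  assumes [measurable]: "f \<in> borel_measurable borel" and nn: "\<And>x. f x \<ge> 0"
    and fin: "\<And>n. AE x in lborel. npow (\<lambda>x. ennreal (f x)) n x < \<infinity>"
  shows "nsq (cpow (\<lambda>x. complex_of_real (f x)) n) = (\<integral>\<^sup>+x. (npow (\<lambda>x. ennreal (f x)) n x)\<^sup>2 \<partial>lborel)"
  unfolding nsq_eq_nabs
proof (rule nn_integral_cong_AE)
  show "AE x in lborel. (nabs (cpow (\<lambda>x. complex_of_real (f x)) n) x)\<^sup>2 = (npow (\<lambda>x. ennreal (f x)) n x)\<^sup>2"
    using cpow_of_real[OF assms, of n] fin[of n] by eventually_elim simp
qed

text \<open>The threshold s = 1/2 enters here: the first bound provides the weight of exponent 1
  consumed by the convolution powers. The other two give square integrability and the upper bound on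
  the symbol.\<close>

lemma sobolev_weight_ge:
  fixes s \<xi> :: real
  assumes "s \<ge> 1/2"
  shows "1 + \<bar>\<xi>\<bar> \<le> 2 * (1 + \<xi>\<^sup>2) powr s" and "1 \<le> (1 + \<xi>\<^sup>2) powr s" and "\<bar>\<xi>\<bar> powr (2 * s) \<le> (1 + \<xi>\<^sup>2) powr s"
proof -
  have "(1 + \<bar>\<xi>\<bar>)\<^sup>2 \<le> 4 * (1 + \<xi>\<^sup>2)"
    using sum_squares_bound[of 1 "\<bar>\<xi>\<bar>"] by (simp add: power2_sum)
  then have "sqrt ((1 + \<bar>\<xi>\<bar>)\<^sup>2) \<le> sqrt (4 * (1 + \<xi>\<^sup>2))" by (rule real_sqrt_le_mono)
  moreover have "sqrt (4 * (1 + \<xi>\<^sup>2)) = 2 * (1 + \<xi>\<^sup>2) powr (1/2)"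
    by (subst real_sqrt_mult) (simp add: powr_half_sqrt)
  ultimately have "1 + \<bar>\<xi>\<bar> \<le> 2 * (1 + \<xi>\<^sup>2) powr (1/2)" by simp
  also have "(1 + \<xi>\<^sup>2) powr (1/2) \<le> (1 + \<xi>\<^sup>2) powr s" using assms by (intro powr_mono) auto
  finally show "1 + \<bar>\<xi>\<bar> \<le> 2 * (1 + \<xi>\<^sup>2) powr s" by simp
  show "1 \<le> (1 + \<xi>\<^sup>2) powr s" using assms by (intro ge_one_powr_ge_zero) auto
  have e: "\<bar>\<xi>\<bar> powr 2 = \<xi>\<^sup>2" by simp
  have "\<bar>\<xi>\<bar> powr (2 * s) = (\<xi>\<^sup>2) powr s" by (simp only: powr_powr[symmetric] e)
  also have "\<dots> \<le> (1 + \<xi>\<^sup>2) powr s" using assms by (intro powr_mono2) auto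
  finally show "\<bar>\<xi>\<bar> powr (2 * s) \<le> (1 + \<xi>\<^sup>2) powr s" .
qed

lemma npow_finite_of_sobolev:
  fixes f :: "real \<Rightarrow> real"
  assumes s: "s \<ge> 1/2" and [measurable]: "f \<in> borel_measurable borel"
    and f: "integrable lborel (\<lambda>\<xi>. (1 + \<xi>\<^sup>2) powr s * (f \<xi>)\<^sup>2)" and nn: "\<And>x. f x \<ge> 0"
  shows "(\<integral>\<^sup>+x. (npow (\<lambda>x. ennreal (f x)) n x)\<^sup>2 \<partial>lborel) < \<infinity>"
proof (rule npow_L2_finite)
  have "(\<integral>\<^sup>+x. (ennreal (f x))\<^sup>2 * wpow 1 x \<partial>lborel) \<le> (\<integral>\<^sup>+x. 2 * ennreal ((1 + x\<^sup>2) powr s * (f x)\<^sup>2) \<partial>lborel)"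
  proof (intro nn_integral_mono)
    fix x
    have "(ennreal (f x))\<^sup>2 * wpow 1 x = ennreal ((f x)\<^sup>2 * (1 + \<bar>x\<bar>))"
      by (simp add: wpow_def ennreal_mult ennreal_power nn)
    also have "\<dots> \<le> ennreal (2 * ((1 + x\<^sup>2) powr s * (f x)\<^sup>2))"
      using mult_left_mono[OF sobolev_weight_ge(1)[OF s, of x], of "(f x)\<^sup>2"] by (intro ennreal_leI) (simp add: mult_ac)
    finally show "(ennreal (f x))\<^sup>2 * wpow 1 x \<le> 2 * ennreal ((1 + x\<^sup>2) powr s * (f x)\<^sup>2)"
      by (simp add: ennreal_mult)
  qed
  also have "\<dots> < \<infinity>"
    using f by (simp add: nn_integral_cmult nn_integral_eq_integral ennreal_mult_less_top)
  finally show "(\<integral>\<^sup>+x. (ennreal (f x))\<^sup>2 * wpow 1 x \<partial>lborel) < \<infinity>" .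
qed simp

lemma sobolev_H_power_norm:
  assumes s: "s \<ge> 1/2" and u: "sobolev_H s u"
  shows "(\<integral>\<^sup>+x. (npow (nabs (fourier_L2 u)) n x)\<^sup>2 \<partial>lborel) < \<infinity>"
    and "nsq (cpow (fourier_L2 u) n) < \<infinity>"
    and "(\<integral>\<^sup>+x. ennreal (cmod (u x) ^ (2 * n + 2)) \<partial>lborel) = ennreal (1 / (2 * pi) ^ n) * nsq (cpow (fourier_L2 u) n)"
    and "(LINT x|lborel. cmod (u x) ^ (2 * n + 2)) = enn2real (nsq (cpow (fourier_L2 u) n)) / (2 * pi) ^ n"
proof -
  let ?U = "fourier_L2 u"
  have u2: "square_integrable u" using u by (simp add: sobolev_H_def)
  note [measurable] = square_integrable_measurable[OF u2]
  have F: "is_fourier u ?U" by (rule is_fourier_fourier_L2[OF u2])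
  note [measurable] = fourier_L2_measurable[OF u2]
  show fin: "(\<integral>\<^sup>+x. (npow (nabs ?U) n x)\<^sup>2 \<partial>lborel) < \<infinity>" for n
    by (rule npow_finite_of_sobolev[OF s]) (use u in \<open>auto simp: sobolev_H_def\<close>)
  have "nsq (cpow ?U n) \<le> (\<integral>\<^sup>+x. (npow (nabs ?U) n x)\<^sup>2 \<partial>lborel)"
    unfolding nsq_eq_nabs by (intro nn_integral_mono power_mono cmod_cpow_le) auto
  with fin[of n] show "nsq (cpow ?U n) < \<infinity>" by (rule le_less_trans[rotated])
  show eq: "(\<integral>\<^sup>+x. ennreal (cmod (u x) ^ (2 * n + 2)) \<partial>lborel) = ennreal (1 / (2 * pi) ^ n) * nsq (cpow ?U n)"
    by (rule power_norm_eq_cpow[OF u2 F fin])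
  have "(LINT x|lborel. cmod (u x) ^ (2 * n + 2)) = enn2real (\<integral>\<^sup>+x. ennreal (cmod (u x) ^ (2 * n + 2)) \<partial>lborel)"
    by (rule integral_eq_nn_integral) auto
  then show "(LINT x|lborel. cmod (u x) ^ (2 * n + 2)) = enn2real (nsq (cpow ?U n)) / (2 * pi) ^ n"
    unfolding eq by (simp add: enn2real_mult)
qed

section \<open>Competitors with prescribed transform\<close>

lemma sobolev_H_of_profile:
  fixes f :: "real \<Rightarrow> real"
  assumes s: "s \<ge> 1/2" and [measurable]: "f \<in> borel_measurable borel"
    and f: "integrable lborel (\<lambda>\<xi>. (1 + \<xi>\<^sup>2) powr s * (f \<xi>)\<^sup>2)"
  shows "\<exists>u. sobolev_H s u \<and> (AE \<xi> in lborel. fourier_L2 u \<xi> = complex_of_real (f \<xi>))"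
proof -
  have "integrable lborel (\<lambda>\<xi>. (f \<xi>)\<^sup>2)"
  proof (rule integrable_dominated[OF f])
    show "AE \<xi> in lborel. norm ((f \<xi>)\<^sup>2) \<le> norm ((1 + \<xi>\<^sup>2) powr s * (f \<xi>)\<^sup>2)"
      using mult_right_mono[OF sobolev_weight_ge(2)[OF s]] by (auto simp: abs_mult)
  qed simp
  then have "square_integrable (\<lambda>\<xi>. complex_of_real (f \<xi>))" by (simp add: square_integrable_def)
  then obtain u where u: "square_integrable u" "AE \<xi> in lborel. fourier_L2 u \<xi> = complex_of_real (f \<xi>)"
    using fourier_L2_surj by blast
  note [measurable] = fourier_L2_measurable[OF u(1)]
  have "integrable lborel (\<lambda>\<xi>. (1 + \<xi>\<^sup>2) powr s * (cmod (fourier_L2 u \<xi>))\<^sup>2)"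
    by (rule integrable_cong_AE_imp[OF f]) (use u(2) in \<open>auto elim!: eventually_mono\<close>)
  with u show ?thesis by (auto simp: sobolev_H_def)
qed

text \<open>Minimality is tested on a function whose transform is the profile \<open>f\<close>.
  Dominating the transform of \<open>Q\<close> makes the denominator of the competitor positive, so
  it is admissible; the common factor (2 pi)^\<open>\<sigma>\<close> cancels, and
  cross-multiplication removes the quotients.\<close>

lemma ground_state_inequality:
  fixes f :: "real \<Rightarrow> real"
  assumes s: "s \<ge> 1/2" and Q: "boosted_ground_state s p v \<omega> \<sigma> Q"
    and [measurable]: "p \<in> borel_measurable borel"
    and [measurable]: "f \<in> borel_measurable borel" and f: "integrable lborel (\<lambda>\<xi>. (1 + \<xi>\<^sup>2) powr s * (f \<xi>)\<^sup>2)"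
    and fge: "\<And>\<xi>. cmod (fourier_L2 Q \<xi>) \<le> f \<xi>"
  defines "NQ \<equiv> enn2real (nsq (cpow (fourier_L2 Q) \<sigma>))"
    and "Nf \<equiv> enn2real (\<integral>\<^sup>+x. (npow (\<lambda>x. ennreal (f x)) \<sigma> x)\<^sup>2 \<partial>lborel)"
  shows "(LINT \<xi>|lborel. (p \<xi> - v * \<xi> + \<omega>) * (cmod (fourier_L2 Q \<xi>))\<^sup>2) ^ (\<sigma> + 1) * Nf
      \<le> (LINT \<xi>|lborel. (p \<xi> - v * \<xi> + \<omega>) * (f \<xi>)\<^sup>2) ^ (\<sigma> + 1) * NQ"
    and "NQ > 0"
proof -
  have QH: "sobolev_H s Q" and Qnz: "\<not> (AE x in lborel. Q x = 0)"
    and Qmin: "\<And>u. sobolev_H s u \<Longrightarrow> \<not> (AE x in lborel. u x = 0) \<Longrightarrow> J_fun p v \<omega> \<sigma> Q \<le> J_fun p v \<omega> \<sigma> u"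
    using Q by (auto simp: boosted_ground_state_def)
  have Q2: "square_integrable Q" using QH by (simp add: sobolev_H_def)
  note [measurable] = square_integrable_measurable[OF Q2]
  have nn: "f x \<ge> 0" for x using fge[of x] norm_ge_zero order_trans by blast
  have fin: "(\<integral>\<^sup>+x. (npow (\<lambda>x. ennreal (f x)) n x)\<^sup>2 \<partial>lborel) < \<infinity>" for n
    by (rule npow_finite_of_sobolev[OF s _ f nn]) simp
  have "nsq (cpow (fourier_L2 Q) \<sigma>) \<noteq> 0"
  proof
    assume "nsq (cpow (fourier_L2 Q) \<sigma>) = 0"
    then have "(\<integral>\<^sup>+x. ennreal (cmod (Q x) ^ (2 * \<sigma> + 2)) \<partial>lborel) = 0"
      using sobolev_H_power_norm(3)[OF s QH] by simp
    then have "AE x in lborel. Q x = 0"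
      by (subst (asm) nn_integral_0_iff_AE) (auto elim!: eventually_mono)
    with Qnz show False by blast
  qed
  then show NQ: "NQ > 0"
    using sobolev_H_power_norm(2)[OF s QH] by (simp add: NQ_def enn2real_positive_iff zero_less_iff_neq_zero)
  obtain u where u: "sobolev_H s u" "AE \<xi> in lborel. fourier_L2 u \<xi> = complex_of_real (f \<xi>)"
    using sobolev_H_of_profile[OF s _ f] by auto
  have u2: "square_integrable u" using u(1) by (simp add: sobolev_H_def)
  note [measurable] = square_integrable_measurable[OF u2]
  note [measurable] = fourier_L2_measurable[OF u2]
  have "nsq (cpow (fourier_L2 u) \<sigma>) = nsq (cpow (\<lambda>x. complex_of_real (f x)) \<sigma>)"
    by (rule nsq_cong_AE) (use cpow_cong_AE[OF _ _ u(2), of \<sigma>] in \<open>auto elim!: eventually_mono\<close>)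
  also have "\<dots> = (\<integral>\<^sup>+x. (npow (\<lambda>x. ennreal (f x)) \<sigma> x)\<^sup>2 \<partial>lborel)"
    by (rule nsq_cpow_of_real[OF _ nn]) (auto intro!: AE_finite_of_sq[simplified] fin[simplified])
  finally have Nu: "enn2real (nsq (cpow (fourier_L2 u) \<sigma>)) = Nf" by (simp add: Nf_def)
  have "nsq (cpow (fourier_L2 Q) \<sigma>) \<le> (\<integral>\<^sup>+x. (npow (\<lambda>x. ennreal (f x)) \<sigma> x)\<^sup>2 \<partial>lborel)"
    unfolding nsq_eq_nabs
    by (intro nn_integral_mono power_mono order_trans[OF cmod_cpow_le npow_mono] ennreal_leI fge) auto
  then have "NQ \<le> Nf" unfolding NQ_def Nf_def using fin[of \<sigma>] by (intro enn2real_mono) auto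
  with NQ have Nf: "Nf > 0" by simp
  have unz: "\<not> (AE x in lborel. u x = 0)"
  proof
    assume "AE x in lborel. u x = 0"
    then have "(LINT x|lborel. cmod (u x) ^ (2 * \<sigma> + 2)) = 0"
      by (intro integral_eq_zero_AE) (auto elim!: eventually_mono)
    then show False using Nf sobolev_H_power_norm(4)[OF s u(1), of \<sigma>] Nu by simp
  qed
  have D: "(LINT \<xi>|lborel. (p \<xi> - v * \<xi> + \<omega>) * (cmod (fourier_L2 u \<xi>))\<^sup>2) = (LINT \<xi>|lborel. (p \<xi> - v * \<xi> + \<omega>) * (f \<xi>)\<^sup>2)"
    by (rule integral_cong_AE) (use u(2) in \<open>auto elim!: eventually_mono\<close>)
  from Qmin[OF u(1) unz] NQ Nf show "(LINT \<xi>|lborel. (p \<xi> - v * \<xi> + \<omega>) * (cmod (fourier_L2 Q \<xi>))\<^sup>2) ^ (\<sigma> + 1) * Nf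
      \<le> (LINT \<xi>|lborel. (p \<xi> - v * \<xi> + \<omega>) * (f \<xi>)\<^sup>2) ^ (\<sigma> + 1) * NQ"
    unfolding J_fun_def D sobolev_H_power_norm(4)[OF s u(1)] sobolev_H_power_norm(4)[OF s QH] Nu
    by (simp add: NQ_def[symmetric] field_simps del: power_Suc)
qed

text \<open>Only one factor of the convolution is perturbed, and the square of the sum is expanded
  to first order. Everything discarded is nonnegative, so a lower bound results that keeps a nonzero
  part of the linear term.\<close>

lemma npow_perturb_sq_ge:
  assumes [measurable]: "g \<in> borel_measurable borel" "e \<in> borel_measurable borel"
  shows "(\<integral>\<^sup>+x. (npow g (Suc n) x)\<^sup>2 \<partial>lborel) + 2 * t * (\<integral>\<^sup>+x. npow g (Suc n) x * nconv e (npow g n) x \<partial>lborel)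
    \<le> (\<integral>\<^sup>+x. (npow (\<lambda>x. g x + t * e x) (Suc n) x)\<^sup>2 \<partial>lborel)"
proof -
  let ?P = "npow g (Suc n)" and ?L = "nconv e (npow g n)"
  have ge: "?P x + t * ?L x \<le> npow (\<lambda>x. g x + t * e x) (Suc n) x" for x
  proof -
    have "?P x + t * ?L x = nconv (\<lambda>x. g x + t * e x) (npow g n) x"
      unfolding npow.simps nconv_def
      by (subst nn_integral_cmult[symmetric], simp, subst nn_integral_add[symmetric]) (auto simp: distrib_right mult.assoc)
    also have "\<dots> \<le> npow (\<lambda>x. g x + t * e x) (Suc n) x"
      unfolding npow.simps by (intro nconv_mono npow_mono) auto
    finally show ?thesis .
  qed
  have "(\<integral>\<^sup>+x. (?P x)\<^sup>2 \<partial>lborel) + 2 * t * (\<integral>\<^sup>+x. ?P x * ?L x \<partial>lborel)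
      = (\<integral>\<^sup>+x. (?P x)\<^sup>2 + 2 * t * (?P x * ?L x) \<partial>lborel)"
    by (subst nn_integral_add) (auto simp: nn_integral_cmult)
  also have "\<dots> \<le> (\<integral>\<^sup>+x. (?P x + t * ?L x)\<^sup>2 \<partial>lborel)"
    by (intro nn_integral_mono) (simp add: power2_eq_square distrib_left distrib_right mult_2 add_ac mult_ac add_increasing2)
  also have "\<dots> \<le> (\<integral>\<^sup>+x. (npow (\<lambda>x. g x + t * e x) (Suc n) x)\<^sup>2 \<partial>lborel)"
    by (intro nn_integral_mono power_mono ge) auto
  finally show ?thesis .
qed

text \<open>The right-hand side has vanishing derivative in \<open>t\<close> at \<open>0\<close>.\<close>
lemma first_order_zero:
  fixes D B C N :: real
  assumes D: "D > 0" and C: "C \<ge> 0"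
    and ineq: "\<And>t. 0 < t \<Longrightarrow> D ^ k * (N + 2 * t * C) \<le> (D + t\<^sup>2 * B) ^ k * N"
  shows "C = 0"
proof -
  have "((\<lambda>t. (D + t\<^sup>2 * B) ^ k * N) has_real_derivative 0) (at 0)"
    by (auto intro!: derivative_eq_intros)
  then have "((\<lambda>t. ((D + t\<^sup>2 * B) ^ k * N - D ^ k * N) / t) \<longlongrightarrow> 0) (at 0)"
    by (simp add: has_field_derivative_iff)
  \<comment> \<open>The hypothesis concerns positive \<open>t\<close> only, hence the restriction to
    a one-sided limit.\<close>
  then have l: "((\<lambda>t. ((D + t\<^sup>2 * B) ^ k * N - D ^ k * N) / t) \<longlongrightarrow> 0) (at_right 0)"
    by (rule filterlim_mono) (auto simp: at_le)
  have "2 * D ^ k * C \<le> 0"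
  proof (rule tendsto_lowerbound[OF l])
    show "\<forall>\<^sub>F t in at_right 0. 2 * D ^ k * C \<le> ((D + t\<^sup>2 * B) ^ k * N - D ^ k * N) / t"
      unfolding eventually_at_filter
      by (intro always_eventually) (use ineq in \<open>auto simp: pos_le_divide_eq algebra_simps\<close>)
  qed simp
  with C zero_less_power[OF D, of k] show ?thesis by (auto simp: mult_le_0_iff)
qed

lemma ennreal_power2_le_imp_le: "a\<^sup>2 \<le> b\<^sup>2 \<Longrightarrow> a \<le> (b :: ennreal)"
proof (cases a; cases b)
  fix x y :: real assume "a\<^sup>2 \<le> b\<^sup>2" "0 \<le> x" "a = ennreal x" "0 \<le> y" "b = ennreal y"
  then show "a \<le> b" by (auto simp: ennreal_power intro!: ennreal_leI power2_le_imp_le)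
qed (auto simp: ennreal_power power2_eq_square top_unique ennreal_mult_eq_top_iff)

text \<open>Two choices of profile are tested: \<open>g\<close> itself yields equality in the
  majorization, and \<open>g\<close> plus a multiple of an indicator yields absence of zeros.
  Writing \<open>\<sigma>\<close> as \<open>Suc n\<close> leaves the nontrivial power
  \<open>npow g n\<close> after one factor is split off.\<close>

lemma ground_state_Fourier_positive:
  assumes s: "s \<ge> 1/2" and Q: "boosted_ground_state s p v \<omega> (Suc n) Q"
    and p [measurable]: "p \<in> borel_measurable borel" and m0: "\<And>\<xi>. p \<xi> - v * \<xi> + \<omega> > 0"
    and mC: "\<And>\<xi>. p \<xi> - v * \<xi> + \<omega> \<le> C * (1 + \<xi>\<^sup>2) powr s"
  shows "AE \<xi> in lborel. fourier_L2 Q \<xi> \<noteq> 0"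
    and "AE \<xi> in lborel. nabs (cpow (fourier_L2 Q) (Suc n)) \<xi> = npow (nabs (fourier_L2 Q)) (Suc n) \<xi>"
proof -
  let ?m = "\<lambda>\<xi>. p \<xi> - v * \<xi> + \<omega>"
  define g where "g \<xi> = cmod (fourier_L2 Q \<xi>)" for \<xi>
  let ?NQ = "nsq (cpow (fourier_L2 Q) (Suc n))" and ?g = "\<lambda>x. ennreal (g x)"
  have QH: "sobolev_H s Q" and Qnz: "\<not> (AE x in lborel. Q x = 0)"
    using Q by (auto simp: boosted_ground_state_def)
  have Q2: "square_integrable Q" using QH by (simp add: sobolev_H_def)
  note [measurable] = square_integrable_measurable[OF Q2]
  have FQ: "is_fourier Q (fourier_L2 Q)" by (rule is_fourier_fourier_L2[OF Q2])
  note [measurable] = fourier_L2_measurable[OF Q2]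
  have [measurable]: "g \<in> borel_measurable borel" unfolding g_def by measurable
  have g_nn: "g \<xi> \<ge> 0" for \<xi> by (simp add: g_def)
  have g_int: "integrable lborel (\<lambda>\<xi>. (1 + \<xi>\<^sup>2) powr s * (g \<xi>)\<^sup>2)"
    using QH by (simp add: sobolev_H_def g_def)
  have m_int: "integrable lborel (\<lambda>\<xi>. ?m \<xi> * (f \<xi>)\<^sup>2)"
    if [measurable]: "f \<in> borel_measurable borel" and f: "integrable lborel (\<lambda>\<xi>. (1 + \<xi>\<^sup>2) powr s * (f \<xi>)\<^sup>2)" for f
  proof (rule integrable_dominated[OF integrable_mult_right[OF f, of C]])
    have "?m \<xi> * (f \<xi>)\<^sup>2 \<le> C * ((1 + \<xi>\<^sup>2) powr s * (f \<xi>)\<^sup>2)" for \<xi>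
      using mult_right_mono[OF mC[of \<xi>], of "(f \<xi>)\<^sup>2"] by (simp add: mult.assoc)
    moreover have "0 \<le> ?m \<xi> * (f \<xi>)\<^sup>2" for \<xi> using m0[of \<xi>] by simp
    ultimately show "AE \<xi> in lborel. norm (?m \<xi> * (f \<xi>)\<^sup>2) \<le> norm (C * ((1 + \<xi>\<^sup>2) powr s * (f \<xi>)\<^sup>2))"
      unfolding real_norm_def by (intro AE_I2) (smt (verit))
  qed simp
  have gnz: "\<not> (AE \<xi> in lborel. g \<xi> = 0)"
  proof
    assume "AE \<xi> in lborel. g \<xi> = 0"
    then have "nsq (fourier_L2 Q) = 0" by (subst nsq_zero_iff) (auto simp: g_def)
    then have "nsq Q = 0" using is_fourier_Plancherel[OF Q2 FQ] by simp
    with Qnz show False by (subst (asm) nsq_zero_iff) auto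
  qed
  define D where "D = (LINT \<xi>|lborel. ?m \<xi> * (g \<xi>)\<^sup>2)"
  have D_nn: "0 \<le> ?m \<xi> * (g \<xi>)\<^sup>2" for \<xi> using m0[of \<xi>] by simp
  have "D \<noteq> 0"
  proof
    assume "D = 0"
    then have "AE \<xi> in lborel. ?m \<xi> * (g \<xi>)\<^sup>2 = 0"
      unfolding D_def using integral_nonneg_eq_0_iff_AE[OF m_int[OF _ g_int]] D_nn by auto
    then have "AE \<xi> in lborel. g \<xi> = 0" by eventually_elim (use m0 in \<open>auto simp: less_le\<close>)
    with gnz show False by blast
  qed
  then have D: "D > 0" unfolding D_def using D_nn by (simp add: less_le integral_nonneg_AE)
  define NQ where "NQ = enn2real (?NQ)"
  let ?N = "\<lambda>f. \<integral>\<^sup>+x. (npow (\<lambda>x. ennreal (f x)) (Suc n) x)\<^sup>2 \<partial>lborel"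
  have ineq: "D ^ (Suc n + 1) * enn2real (?N f) \<le> (LINT \<xi>|lborel. ?m \<xi> * (f \<xi>)\<^sup>2) ^ (Suc n + 1) * NQ"
    if [measurable]: "f \<in> borel_measurable borel" and f: "integrable lborel (\<lambda>\<xi>. (1 + \<xi>\<^sup>2) powr s * (f \<xi>)\<^sup>2)"
      and "\<And>\<xi>. g \<xi> \<le> f \<xi>" for f
    using ground_state_inequality(1)[OF s Q p _ f] that(3) by (simp add: D_def NQ_def g_def)
  have N_fin: "?N f < \<infinity>" if [measurable]: "f \<in> borel_measurable borel"
      and f: "integrable lborel (\<lambda>\<xi>. (1 + \<xi>\<^sup>2) powr s * (f \<xi>)\<^sup>2)" and "\<And>\<xi>. f \<xi> \<ge> 0" for f
    by (rule npow_finite_of_sobolev[OF s _ f that(3)]) simp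
  have NQ_le: "?NQ \<le> ?N g"
    unfolding nsq_eq_nabs g_def by (intro nn_integral_mono power_mono cmod_cpow_le) auto
  \<comment> \<open>With the profile \<open>g\<close> the numerators on both sides coincide and are
    positive, so they cancel.\<close>
  have "enn2real (?N g) \<le> NQ"
    using ineq[OF _ g_int] D by (simp add: D_def[symmetric] del: npow.simps)
  then have "ennreal (enn2real (?N g)) \<le> ennreal NQ" by (rule ennreal_leI)
  moreover have "ennreal (enn2real (?N g)) = ?N g"
    by (rule ennreal_enn2real) (use N_fin[OF _ g_int g_nn] in \<open>simp del: npow.simps\<close>)
  moreover have "ennreal NQ = ?NQ"
    unfolding NQ_def
    by (rule ennreal_enn2real) (use sobolev_H_power_norm(2)[OF s QH, of "Suc n"] in \<open>simp del: cpow.simps\<close>)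
  ultimately have N_eq: "?NQ = ?N g"
    using NQ_le by (simp only: antisym)
  show "AE \<xi> in lborel. nabs (cpow (fourier_L2 Q) (Suc n)) \<xi> = npow (nabs (fourier_L2 Q)) (Suc n) \<xi>"
  proof -
    let ?a = "nabs (cpow (fourier_L2 Q) (Suc n))" and ?b = "npow (nabs (fourier_L2 Q)) (Suc n)"
    have le: "?a \<xi> \<le> ?b \<xi>" for \<xi> by (rule cmod_cpow_le)
    have [measurable]: "?a \<in> borel_measurable borel" "?b \<in> borel_measurable borel" by measurable
    have bfin: "(\<integral>\<^sup>+x. (?b x)\<^sup>2 \<partial>lborel) < \<infinity>" by (rule sobolev_H_power_norm(1)[OF s QH])
    \<comment> \<open>A pointwise inequality with equal finite integrals is an a.e. equality;
      finiteness is what permits subtraction in \<open>ennreal\<close>.\<close>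
    have "(\<integral>\<^sup>+x. (?b x)\<^sup>2 - (?a x)\<^sup>2 \<partial>lborel) = (\<integral>\<^sup>+x. (?b x)\<^sup>2 \<partial>lborel) - (\<integral>\<^sup>+x. (?a x)\<^sup>2 \<partial>lborel)"
      using N_eq bfin by (intro nn_integral_diff AE_I2 power_mono le) (auto simp: nsq_eq_nabs g_def simp del: npow.simps cpow.simps)
    also have "\<dots> = 0" using N_eq bfin by (simp add: nsq_eq_nabs g_def del: npow.simps cpow.simps)
    finally have "AE x in lborel. (?b x)\<^sup>2 - (?a x)\<^sup>2 = 0"
      by (subst (asm) nn_integral_0_iff_AE) measurable
    moreover have "AE x in lborel. ?b x < \<infinity>" by (rule AE_finite_of_sq[OF _ bfin]) measurable
    ultimately show ?thesis
    proof (eventually_elim)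
      case (elim x)
      then have "(?b x)\<^sup>2 \<le> (?a x)\<^sup>2" by (simp add: diff_eq_0_iff_ennreal del: npow.simps cpow.simps)
      then have "?b x \<le> ?a x" by (rule ennreal_power2_le_imp_le)
      with le[of x] show ?case by (rule antisym)
    qed
  qed
  have key: "(\<integral>\<^sup>+x. npow ?g (Suc n) x * nconv (indicator E) (npow ?g n) x \<partial>lborel) = 0"
    if E_def: "E = {x. g x = 0 \<and> \<bar>x\<bar> \<le> real R}" for E :: "real set" and R :: nat
  proof -
    have [measurable]: "E \<in> sets borel" unfolding E_def by measurable
    let ?e = "indicator E :: real \<Rightarrow> real"
    let ?C = "\<integral>\<^sup>+x. npow ?g (Suc n) x * nconv (indicator E) (npow ?g n) x \<partial>lborel"
    \<comment> \<open>The bound |x| at most \<open>R\<close> built into \<open>E\<close> makes its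
      indicator an admissible perturbation for every exponent \<open>s\<close>.\<close>
    have e_int: "integrable lborel (\<lambda>\<xi>. (1 + \<xi>\<^sup>2) powr s * (?e \<xi>)\<^sup>2)"
    proof (rule integrable_dominated)
      show "integrable lborel (\<lambda>\<xi>. (1 + (real R)\<^sup>2) powr s * indicator {- real R..real R} \<xi> :: real)"
        by (intro integrable_mult_right) (simp add: emeasure_lborel_Icc_eq)
      show "AE \<xi> in lborel. norm ((1 + \<xi>\<^sup>2) powr s * (?e \<xi>)\<^sup>2) \<le> norm ((1 + (real R)\<^sup>2) powr s * indicator {- real R..real R} \<xi> :: real)"
        using s by (intro AE_I2) (auto simp: E_def indicator_def abs_le_iff intro!: powr_mono2 add_left_mono power2_le_iff_abs_le[THEN iffD2])
    qed measurable
    \<comment> \<open>The cross term vanishes because \<open>E\<close> lies in the zero set of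
      \<open>g\<close>; hence the numerator has no term linear in \<open>t\<close>.\<close>
    have sq: "(g \<xi> + t * ?e \<xi>)\<^sup>2 = (g \<xi>)\<^sup>2 + t\<^sup>2 * (?e \<xi>)\<^sup>2" for t \<xi>
      by (auto simp: E_def indicator_def power_mult_distrib)
    have f_int: "integrable lborel (\<lambda>\<xi>. (1 + \<xi>\<^sup>2) powr s * (g \<xi> + t * ?e \<xi>)\<^sup>2)" for t
    proof -
      have "(\<lambda>\<xi>. (1 + \<xi>\<^sup>2) powr s * (g \<xi> + t * ?e \<xi>)\<^sup>2) = (\<lambda>\<xi>. (1 + \<xi>\<^sup>2) powr s * (g \<xi>)\<^sup>2 + t\<^sup>2 * ((1 + \<xi>\<^sup>2) powr s * (?e \<xi>)\<^sup>2))"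
        unfolding sq by (rule ext) (simp only: algebra_simps)
      then show ?thesis using g_int e_int by (simp only: Bochner_Integration.integrable_add integrable_mult_right)
    qed
    have D_t: "(LINT \<xi>|lborel. ?m \<xi> * (g \<xi> + t * ?e \<xi>)\<^sup>2) = D + t\<^sup>2 * (LINT \<xi>|lborel. ?m \<xi> * (?e \<xi>)\<^sup>2)" for t
    proof -
      have "(LINT \<xi>|lborel. ?m \<xi> * (g \<xi> + t * ?e \<xi>)\<^sup>2) = (LINT \<xi>|lborel. ?m \<xi> * (g \<xi>)\<^sup>2 + t\<^sup>2 * (?m \<xi> * (?e \<xi>)\<^sup>2))"
        unfolding sq by (rule arg_cong[where f="integral\<^sup>L lborel"], rule ext) (simp only: algebra_simps)
      also have "\<dots> = D + t\<^sup>2 * (LINT \<xi>|lborel. ?m \<xi> * (?e \<xi>)\<^sup>2)"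
        unfolding D_def
        by (subst Bochner_Integration.integral_add[OF m_int[OF _ g_int] integrable_mult_right[OF m_int[OF _ e_int]]]) auto
      finally show ?thesis .
    qed
    have N_t: "?N g + 2 * ennreal t * ?C \<le> ?N (\<lambda>x. g x + t * ?e x)" if "t > 0" for t
    proof -
      have "(\<lambda>x. ennreal (g x + t * ?e x)) = (\<lambda>x. ennreal (g x) + ennreal t * indicator E x)"
        using that g_nn by (auto simp: fun_eq_iff indicator_def ennreal_plus)
      then show ?thesis
        using npow_perturb_sq_ge[of "\<lambda>x. ennreal (g x)" "indicator E" n "ennreal t"] by (simp del: npow.simps)
    qed
    have N_t_fin: "?N (\<lambda>x. g x + t * ?e x) < \<infinity>" if "t > 0" for t
      by (rule N_fin[OF _ f_int]) (use that g_nn in \<open>auto simp: add_nonneg_nonneg\<close>)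
    \<comment> \<open>Finiteness of the linear coefficient is read off from the perturbation
      inequality at t = 1.\<close>
    have C_fin: "?C < \<infinity>"
      using le_less_trans[OF N_t[of 1] N_t_fin[of 1]] by (auto simp: ennreal_mult_less_top simp del: npow.simps)
    have N_g: "enn2real (?N g) = NQ" unfolding NQ_def N_eq ..
    have "enn2real ?C = 0"
    proof (rule first_order_zero[OF D enn2real_nonneg])
      fix t :: real assume t: "t > 0"
      have "enn2real (?N g + 2 * ennreal t * ?C) \<le> enn2real (?N (\<lambda>x. g x + t * ?e x))"
        using N_t[OF t] N_t_fin[OF t] by (intro enn2real_mono) auto
      also have "enn2real (?N g + 2 * ennreal t * ?C) = NQ + 2 * t * enn2real ?C"
        using C_fin N_fin[OF _ g_int g_nn] t N_g
        by (subst enn2real_plus) (auto simp: enn2real_mult ennreal_mult_less_top simp del: npow.simps)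
      finally have "D ^ (Suc n + 1) * (NQ + 2 * t * enn2real ?C) \<le> D ^ (Suc n + 1) * enn2real (?N (\<lambda>x. g x + t * ?e x))"
        using D by (intro mult_left_mono) auto
      also have "\<dots> \<le> (LINT \<xi>|lborel. ?m \<xi> * (g \<xi> + t * ?e \<xi>)\<^sup>2) ^ (Suc n + 1) * NQ"
        by (rule ineq[OF _ f_int]) (use t in auto)
      finally show "D ^ (Suc n + 1) * (NQ + 2 * t * enn2real ?C) \<le> (D + t\<^sup>2 * (LINT \<xi>|lborel. ?m \<xi> * (?e \<xi>)\<^sup>2)) ^ (Suc n + 1) * NQ"
        unfolding D_t .
    qed
    with C_fin show ?thesis by (auto simp: enn2real_eq_0_iff simp del: npow.simps)
  qed
  have "AE x in lborel. ?g x \<noteq> 0"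
  proof (rule AE_nonzero_of_correlation[where G="npow ?g n"])
    show "\<not> (AE x in lborel. ?g x = 0)" using gnz g_nn by (auto simp: ennreal_eq_0_iff antisym_conv elim!: eventually_mono)
    then show "\<not> (AE x in lborel. npow ?g n x = 0)" by (intro npow_not_AE_zero) auto
    have "AE y in lborel. g y = 0 \<and> \<bar>y\<bar> \<le> real R \<longrightarrow> (\<integral>\<^sup>+\<xi>. nconv ?g (npow ?g n) \<xi> * npow ?g n (\<xi> - y) \<partial>lborel) = 0" for R :: nat
    proof -
      define E where "E = {x. g x = 0 \<and> \<bar>x\<bar> \<le> real R}"
      have [measurable]: "E \<in> sets borel" unfolding E_def by measurable
      \<comment> \<open>Fubini rewrites the vanishing linear coefficient as an integral over
        \<open>E\<close>, so its integrand vanishes a.e. on \<open>E\<close>; the union over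
        \<open>R\<close> then covers all zeros.\<close>
      have "0 = (\<integral>\<^sup>+x. \<integral>\<^sup>+y. nconv ?g (npow ?g n) x * (indicator E y * npow ?g n (x - y)) \<partial>lborel \<partial>lborel)"
        using key[OF E_def] by (simp add: nn_integral_cmult nconv_def[of "indicator E"])
      also have "\<dots> = (\<integral>\<^sup>+y. \<integral>\<^sup>+x. nconv ?g (npow ?g n) x * (indicator E y * npow ?g n (x - y)) \<partial>lborel \<partial>lborel)"
        by (rule lborel_pair.Fubini') measurable
      also have "\<dots> = (\<integral>\<^sup>+y. indicator E y * (\<integral>\<^sup>+x. nconv ?g (npow ?g n) x * npow ?g n (x - y) \<partial>lborel) \<partial>lborel)"
        by (subst nn_integral_cmult[symmetric]) (auto simp: mult_ac)
      finally have "AE y in lborel. indicator E y * (\<integral>\<^sup>+x. nconv ?g (npow ?g n) x * npow ?g n (x - y) \<partial>lborel) = 0"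
        by (subst (asm) eq_commute, subst (asm) nn_integral_0_iff_AE) auto
      then show ?thesis by eventually_elim (auto simp: E_def indicator_def)
    qed
    then have "AE y in lborel. \<forall>R::nat. g y = 0 \<and> \<bar>y\<bar> \<le> real R \<longrightarrow> (\<integral>\<^sup>+\<xi>. nconv ?g (npow ?g n) \<xi> * npow ?g n (\<xi> - y) \<partial>lborel) = 0"
      unfolding AE_all_countable by blast
    then show "AE y in lborel. ?g y = 0 \<longrightarrow> (\<integral>\<^sup>+\<xi>. nconv ?g (npow ?g n) \<xi> * npow ?g n (\<xi> - y) \<partial>lborel) = 0"
    proof eventually_elim
      case (elim y)
      obtain R :: nat where "\<bar>y\<bar> \<le> real R" using real_arch_simple by blast
      with elim g_nn[of y] show ?case by (auto simp: ennreal_eq_0_iff)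
    qed
  qed auto
  then show "AE \<xi> in lborel. fourier_L2 Q \<xi> \<noteq> 0"
    by eventually_elim (auto simp: g_def)
qed

subsection \<open>The phase of the Fourier transform\<close>

text \<open>The equality case of the triangle inequality for integrals. After rotation by the
  conjugate phase, the majorant minus the real part of \<open>F\<close> is nonnegative with integral
  0, so the real part attains the majorant and leaves no room for an imaginary part.\<close>

lemma AE_eq_of_integral_norm_eq:
  fixes F :: "real \<Rightarrow> complex" and P :: "real \<Rightarrow> ennreal"
  assumes [measurable]: "F \<in> borel_measurable borel" "P \<in> borel_measurable borel"
    and le: "\<And>x. nabs F x \<le> P x" and eq: "ennreal (cmod (LINT x|lborel. F x)) = (\<integral>\<^sup>+x. P x \<partial>lborel)"
    and nz: "(LINT x|lborel. F x) \<noteq> 0"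
  shows "AE x in lborel. F x = sgn (LINT x|lborel. F x) * complex_of_real (enn2real (P x))"
proof -
  define I where "I = (LINT x|lborel. F x)"
  define \<theta> where "\<theta> = sgn I"
  have \<theta>: "cmod \<theta> = 1" using nz by (simp add: \<theta>_def norm_sgn I_def)
  have Pfin: "(\<integral>\<^sup>+x. P x \<partial>lborel) < \<infinity>" using eq by (metis ennreal_less_top infinity_ennreal_def)
  then have PAE: "AE x in lborel. P x \<noteq> \<infinity>" by (intro nn_integral_PInf_AE) auto
  have Peq: "(\<integral>\<^sup>+x. ennreal (enn2real (P x)) \<partial>lborel) = (\<integral>\<^sup>+x. P x \<partial>lborel)"
    by (rule nn_integral_cong_AE) (use PAE in \<open>auto elim!: eventually_mono simp: less_top\<close>)
  have Pint: "integrable lborel (\<lambda>x. enn2real (P x))"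
    using Pfin Peq by (simp add: integrable_iff_bounded)
  have Fle: "AE x in lborel. cmod (F x) \<le> enn2real (P x)"
    using PAE
  proof eventually_elim
    case (elim x)
    then show ?case using enn2real_mono[OF le[of x]] by (simp add: less_top)
  qed
  have Fint: "integrable lborel F"
    by (rule integrable_dominated[OF Pint]) (use Fle in auto)
  have zint: "integrable lborel (\<lambda>x. cnj \<theta> * F x)" using Fint by simp
  have "cnj \<theta> * I = complex_of_real (cmod I)"
    using nz unfolding \<theta>_def sgn_eq I_def[symmetric]
    by (simp add: complex_norm_square[symmetric] mult.commute[of "cnj I"] power2_eq_square)
  then have "(LINT x|lborel. Re (cnj \<theta> * F x)) = cmod I"
    using integral_Re[OF zint] by (simp add: I_def)
  moreover have "(LINT x|lborel. enn2real (P x)) = cmod I"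
    using integral_eq_nn_integral[of "\<lambda>x. enn2real (P x)" lborel] Peq eq by (simp add: I_def[symmetric] del: eq) (metis I_def enn2real_ennreal norm_ge_zero)
  ultimately have "(LINT x|lborel. enn2real (P x) - Re (cnj \<theta> * F x)) = 0"
    using Pint integrable_Re[OF zint] by (simp del: times_complex.sel)
  moreover have bd: "AE x in lborel. Re (cnj \<theta> * F x) \<le> enn2real (P x)"
    using Fle
  proof eventually_elim
    case (elim x)
    have "Re (cnj \<theta> * F x) \<le> cmod (cnj \<theta> * F x)" by (rule complex_Re_le_cmod)
    also have "\<dots> = cmod (F x)" by (simp add: norm_mult \<theta>)
    finally show ?case using elim by simp
  qed
  ultimately have "AE x in lborel. enn2real (P x) - Re (cnj \<theta> * F x) = 0"
    using Pint integrable_Re[OF zint]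
    by (subst (asm) integral_nonneg_eq_0_iff_AE) (auto simp del: times_complex.sel elim!: eventually_mono)
  with Fle show ?thesis
  proof eventually_elim
    case (elim x)
    let ?z = "cnj \<theta> * F x"
    have "(Re ?z)\<^sup>2 + (Im ?z)\<^sup>2 \<le> (Re ?z)\<^sup>2"
      using elim power_mono[of "cmod ?z" "Re ?z" 2] by (simp add: norm_mult \<theta> cmod_power2[symmetric] del: times_complex.sel)
    then have "Im ?z = 0" by simp
    then have "?z = complex_of_real (enn2real (P x))"
      using elim by (intro complex_eqI) (simp_all del: times_complex.sel)
    moreover have "\<theta> * ?z = F x"
      using complex_norm_square[of \<theta>] \<theta> by (simp add: mult.assoc[symmetric])
    ultimately show ?case by (simp add: \<theta>_def I_def)
  qed
qed

section \<open>Measurable solutions of the Pexider equation\<close>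

lemma continuous_AE_eq:
  fixes f g :: "real \<Rightarrow> complex"
  assumes f: "continuous_on UNIV f" and g: "continuous_on UNIV g" and eq: "AE x in lborel. f x = g x"
  shows "f x = g x"
proof (rule ccontr)
  assume "f x \<noteq> g x"
  moreover have "open {x. f x \<noteq> g x}" using f g by (rule open_Collect_neq)
  ultimately obtain e where e: "e > 0" "ball x e \<subseteq> {x. f x \<noteq> g x}"
    by (metis (mono_tags) mem_Collect_eq open_contains_ball)
  have "{x..<x + e} \<subseteq> ball x e" by (auto simp: dist_real_def)
  with e(2) have "AE y in lborel. y \<notin> {x..<x + e}"
    using eq by (auto elim!: eventually_mono)
  with not_AE_interval[of x "x + e"] e(1) show False by simp
qed

lemma moving_integral_continuous:
  fixes \<Theta> :: "real \<Rightarrow> complex"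
  assumes [measurable]: "\<Theta> \<in> borel_measurable borel" and bd: "\<And>x. cmod (\<Theta> x) \<le> 1"
  shows "continuous_on UNIV (\<lambda>y. LINT x|lborel. indicator {y..y + 1} x * \<Theta> x * cis (a * (x - y)))"
  unfolding continuous_on_eq_continuous_at[OF open_UNIV] continuous_at_sequentially o_def
proof (intro ballI allI impI)
  let ?K = "\<lambda>y x. indicator {y..y + 1} x * \<Theta> x * cis (a * (x - y))"
  fix y :: real and t :: "nat \<Rightarrow> real" assume t: "t \<longlonglongrightarrow> y"
  then obtain M where M: "\<And>n. \<bar>t n\<bar> \<le> M"
    using convergent_imp_Bseq[of t] by (auto simp: convergent_def Bseq_def)
  show "(\<lambda>n. LINT x|lborel. ?K (t n) x)
      \<longlonglongrightarrow> (LINT x|lborel. ?K y x)"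
  proof (rule integral_dominated_convergence[where w="indicator {- M..M + 1}"])
    show "integrable lborel (indicator {- M..M + 1} :: real \<Rightarrow> real)"
      by (auto simp: emeasure_lborel_Icc_eq)
    show "AE x in lborel. norm (?K (t n) x) \<le> indicator {- M..M + 1} x" for n
      using M[of n] bd by (intro AE_I2) (auto simp: norm_mult indicator_def abs_le_iff)
    \<comment> \<open>At its two endpoints the indicator of the moving interval need not converge;
      they form a null set.\<close>
    have "AE x in lborel. x \<noteq> y \<and> x \<noteq> y + 1"
      using AE_lborel_singleton[of y] AE_lborel_singleton[of "y + 1"] by eventually_elim simp
    then show "AE x in lborel. (\<lambda>n. ?K (t n) x)
        \<longlonglongrightarrow> ?K y x"
    proof eventually_elim
      case (elim x)
      have "(\<lambda>n. indicator {t n..t n + 1} x :: complex) \<longlonglongrightarrow> indicator {y..y + 1} x"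
      proof (rule tendsto_eventually)
        consider "x < y" | "y < x \<and> x < y + 1" | "x > y + 1" using elim by linarith
        then show "\<forall>\<^sub>F n in sequentially. (indicator {t n..t n + 1} x :: complex) = indicator {y..y + 1} x"
        proof cases
          case 1
          from order_tendstoD(1)[OF t this] show ?thesis
            by eventually_elim (use 1 in \<open>auto simp: indicator_def\<close>)
        next
          case 2
          then have "\<forall>\<^sub>F n in sequentially. x - 1 < t n" "\<forall>\<^sub>F n in sequentially. t n < x"
            by (auto intro!: order_tendstoD[OF t])
          then show ?thesis by eventually_elim (use 2 in \<open>auto simp: indicator_def\<close>)
        next
          case 3
          from order_tendstoD(2)[OF t, of "x - 1"] 3 show ?thesis
            by (auto elim!: eventually_mono simp: indicator_def)
        qed
      qed
      then show ?case by (intro tendsto_intros t)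
    qed
  qed measurable
qed

text \<open>By Plancherel some modulation \<open>\<integral>\<^bsub>[0,1]\<^esub> \<psi>(z) cis (-\<eta> z) dz\<close> is nonzero; integrating the equation against
  that kernel writes \<open>\<phi>\<close> as a moving integral.\<close>
lemma Pexider_AE_continuous:
  fixes \<phi> \<psi> \<Theta> :: "real \<Rightarrow> complex"
  assumes [measurable]: "\<phi> \<in> borel_measurable borel" "\<psi> \<in> borel_measurable borel" "\<Theta> \<in> borel_measurable borel"
    and bd: "\<And>x. cmod (\<psi> x) \<le> 1" "\<And>x. cmod (\<Theta> x) \<le> 1" and \<psi>1: "AE x in lborel. cmod (\<psi> x) = 1"
    and eq: "AE y in lborel. AE z in lborel. \<phi> y * \<psi> z = \<Theta> (y + z)"
  shows "\<exists>\<phi>1. continuous_on UNIV \<phi>1 \<and> (AE y in lborel. \<phi> y = \<phi>1 y)"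
proof -
  \<comment> \<open>A function of modulus 1 is not integrable on the line, so \<open>\<psi>\<close>
    is cut off to a unit interval before transforming.\<close>
  define f where "f z = indicator {0..1} z * \<psi> z" for z :: real
  have [measurable]: "f \<in> borel_measurable borel" unfolding f_def by measurable
  have le: "cmod (f z) \<le> cmod (indicator {- real 1..real 1} z)" for z
    using bd(1)[of z] by (auto simp: f_def indicator_def)
  have f_sq: "square_integrable f"
    by (rule square_integrable_bound[OF square_integrable_indicator[of 1]]) (use le in auto)
  have "f = trunc 1 f" by (rule ext) (auto simp: trunc_def f_def indicator_def)
  then have f_int: "integrable lborel f" using integrable_trunc[OF f_sq, of 1] by simp
  have "\<exists>\<eta>. fourier_L1 f \<eta> \<noteq> 0"
  proof (rule ccontr)
    assume "\<not> ?thesis"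
    then have "nsq (fourier_L1 f) = 0" by (simp add: nsq_def)
    then have "nsq f = 0" using fourier_Plancherel_L1[OF f_int f_sq] by simp
    then have "AE z in lborel. f z = 0" by (subst (asm) nsq_zero_iff) auto
    with \<psi>1 have "AE z in lborel. (z::real) \<notin> {0..<1}"
      by eventually_elim (auto simp: f_def indicator_def)
    with not_AE_interval[of 0 1] show False by simp
  qed
  then obtain \<eta> where \<eta>: "fourier_L1 f \<eta> \<noteq> 0" by blast
  define w where "w = (LINT z|lborel. f z * cis (- (\<eta> * z)))"
  have w: "w \<noteq> 0" using \<eta> by (auto simp: w_def fourier_L1_def)
  define B where "B y = (LINT x|lborel. indicator {y..y + 1} x * \<Theta> x * cis (- \<eta> * (x - y)))" for y
  have "continuous_on UNIV (\<lambda>y. B y / w)"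
    unfolding B_def using w by (intro continuous_intros moving_integral_continuous bd) auto
  moreover have "AE y in lborel. \<phi> y = B y / w"
    using eq
  proof eventually_elim
    case (elim y)
    have "\<phi> y * w = (LINT z|lborel. \<phi> y * (f z * cis (- (\<eta> * z))))" by (simp add: w_def)
    also have "\<dots> = (LINT z|lborel. indicator {y..y + 1} (y + z) * \<Theta> (y + z) * cis (- \<eta> * (y + z - y)))"
      by (rule integral_cong_AE) (use elim in \<open>auto elim!: eventually_mono simp: f_def indicator_def\<close>)
    also have "\<dots> = B y"
      unfolding B_def using lborel_integral_real_affine[of 1 "\<lambda>x. indicator {y..y + 1} x * \<Theta> x * cis (- \<eta> * (x - y))" y] by simp
    finally show ?case using w by (simp add: field_simps)
  qed
  ultimately show ?thesis by blast
qed

text \<open>Integrating the functional equation over a short interval expresses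
  \<open>\<kappa>\<close> through its primitive, so continuity upgrades to differentiability. Then
  \<open>\<kappa>\<close> solves a linear differential equation with constant coefficient
  \<open>k\<close>, and modulus 1 forces \<open>k\<close> to be imaginary.\<close>

lemma continuous_character:
  fixes \<kappa> :: "real \<Rightarrow> complex"
  assumes c: "continuous_on UNIV \<kappa>" and mult: "\<And>x y. \<kappa> (x + y) = \<kappa> x * \<kappa> y" and norm1: "\<And>x. cmod (\<kappa> x) = 1"
  shows "\<exists>l. \<forall>x. \<kappa> x = cis (l * x)"
proof -
  have cs: "continuous_on S \<kappa>" for S using c continuous_on_subset by blast
  have "\<kappa> 0 * \<kappa> 0 = \<kappa> 0" using mult[of 0 0] by simp
  moreover have "\<kappa> 0 \<noteq> 0" using norm1[of 0] by auto
  ultimately have one: "\<kappa> 0 = 1" by simp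
  have "isCont \<kappa> 0" using c by (simp add: continuous_on_eq_continuous_at)
  from iffD1[OF continuous_at_eps_delta this, rule_format, of "1/2"]
  obtain d0 where d0: "d0 > 0" "\<And>x. \<bar>x\<bar> < d0 \<Longrightarrow> cmod (\<kappa> x - 1) < 1/2"
    using one by (auto simp: dist_norm)
  \<comment> \<open>Below \<open>d0\<close> so that \<open>\<kappa>\<close> stays within 1/2 of 1 on
    [0,d], and below 1 so that x + d stays in the interval (-1,2), where \<open>X\<close> is
    differentiable, whenever |x| < 1.\<close>
  define d where "d = min (d0 / 2) (1 / 2)"
  have d: "d > 0" "d < 1" "d < d0" using d0(1) by (auto simp: d_def)
  define W where "W = integral {0..d} \<kappa>"
  \<comment> \<open>\<open>W\<close> differs from \<open>d\<close> by at most d/2.\<close>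
  have W: "W \<noteq> 0"
  proof
    assume "W = 0"
    have "cmod (integral {0..d} (\<lambda>x. \<kappa> x - 1)) \<le> 1/2 * (d - 0)"
      using d d0(2) by (intro integral_bound continuous_intros cs) (auto simp: less_imp_le)
    moreover have "integral {0..d} (\<lambda>x. \<kappa> x - 1) = W - complex_of_real d"
      unfolding W_def using d
      by (subst Henstock_Kurzweil_Integration.integral_diff) (auto intro!: integrable_continuous_interval cs simp: scaleR_conv_of_real)
    ultimately show False using \<open>W = 0\<close> d by simp
  qed
  define X where "X u = integral {-1..u} \<kappa>" for u
  have X': "(X has_vector_derivative \<kappa> u) (at u)" if "-1 < u" "u < 2" for u
  proof -
    have "((\<lambda>u. integral {-1..u} \<kappa>) has_vector_derivative \<kappa> u) (at u within {-1..2})"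
      by (rule integral_has_vector_derivative[OF cs]) (use that in auto)
    moreover have "at u within {-1..2} = at u" using that by (intro at_within_interior) auto
    ultimately show ?thesis by (simp add: X_def[abs_def])
  qed
  have rep: "\<kappa> x = (X (x + d) - X x) / W" if x: "-1 < x" "x < 1" for x
  proof -
    have "\<kappa> x * W = integral {0..d} (\<lambda>t. \<kappa> x * \<kappa> t)" by (simp add: W_def)
    also have "\<dots> = integral {0..d} (\<kappa> \<circ> (\<lambda>t. t + x))" by (simp add: o_def mult mult.commute)
    also have "\<dots> = integral {0 + x..d + x} \<kappa>" by (rule integral_shift) (rule cs)
    also have "\<dots> = X (x + d) - X x"
      using Henstock_Kurzweil_Integration.integral_combine[of "-1" x "x + d" \<kappa>] x d
      by (auto simp: X_def algebra_simps intro!: integrable_continuous_interval cs)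
    finally show ?thesis using W by (simp add: field_simps)
  qed
  define k where "k = (\<kappa> d - \<kappa> 0) / W"
  have "((\<lambda>x. (X (x + d) - X x) / W) has_vector_derivative k) (at 0)"
    unfolding k_def
  proof (intro has_vector_derivative_divide has_vector_derivative_diff)
    have "((X \<circ> (\<lambda>x. x + d)) has_vector_derivative 1 *\<^sub>R \<kappa> d) (at 0)"
      by (rule vector_diff_chain_at) (use X'[of d] d in \<open>auto intro!: derivative_eq_intros\<close>)
    then show "((\<lambda>x. X (x + d)) has_vector_derivative \<kappa> d) (at 0)" by (simp add: o_def)
    show "(X has_vector_derivative \<kappa> 0) (at 0)" by (rule X') auto
  qed
  then have d0': "(\<kappa> has_vector_derivative k) (at 0)"
    by (rule has_vector_derivative_transform_within_open[of _ _ _ "{-1<..<1}"]) (auto simp: rep)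
  have deriv: "(\<kappa> has_vector_derivative \<kappa> x * k) (at x)" for x
  proof -
    have "((\<kappa> \<circ> (\<lambda>u. u - x)) has_vector_derivative 1 *\<^sub>R k) (at x)"
      by (rule vector_diff_chain_at) (use d0' in \<open>auto intro!: derivative_eq_intros\<close>)
    then have "((\<lambda>u. \<kappa> x * \<kappa> (u - x)) has_vector_derivative \<kappa> x * k) (at x)"
      by (intro has_vector_derivative_mult_right) (simp add: o_def)
    then show ?thesis by (simp add: mult[symmetric])
  qed
  have ex: "((\<lambda>u. exp (- k * complex_of_real u)) has_vector_derivative - k * exp (- k * complex_of_real x)) (at x)" for x
  proof -
    have "((\<lambda>z. exp (- k * z)) has_field_derivative - k * exp (- k * complex_of_real x)) (at (complex_of_real x))"
      by (auto intro!: derivative_eq_intros)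
    from has_vector_derivative_real_field[OF this] show ?thesis by simp
  qed
  \<comment> \<open>The product with the exponential of opposite rate has derivative 0.\<close>
  have "\<exists>c. \<forall>x. \<kappa> x * exp (- k * complex_of_real x) = c"
  proof -
    have "((\<lambda>x. \<kappa> x * exp (- k * complex_of_real x)) has_vector_derivative 0) (at x)" for x
      using has_vector_derivative_mult[OF deriv ex, of x] by (simp add: algebra_simps)
    then have "((\<lambda>x. \<kappa> x * exp (- k * complex_of_real x)) has_derivative (\<lambda>h. 0)) (at x within UNIV)" for x
      by (simp add: has_vector_derivative_def)
    from has_derivative_zero_constant[OF convex_UNIV this] show ?thesis by blast
  qed
  then obtain c where cc: "\<And>x. \<kappa> x * exp (- k * complex_of_real x) = c" by blast
  have c1: "c = 1" using cc[of 0] one by simp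
  have eq: "\<kappa> x = exp (k * complex_of_real x)" for x
  proof -
    have "\<kappa> x = \<kappa> x * exp (- k * complex_of_real x) * exp (k * complex_of_real x)"
      by (simp add: mult.assoc exp_add[symmetric])
    then show ?thesis by (simp only: cc c1 mult_1)
  qed
  have "exp (Re k) = 1" using norm1[of 1] eq[of 1] by (simp add: norm_exp_eq_Re)
  then have "Re k = 0" by simp
  then have "k * complex_of_real x = \<i> * complex_of_real (Im k * x)" for x
    by (simp add: complex_eq_iff)
  then have "\<kappa> x = cis (Im k * x)" for x by (simp only: eq cis_conv_exp)
  then show ?thesis by blast
qed

text \<open>Once \<open>\<phi>\<close> and \<open>\<psi>\<close> are replaced by continuous
  representatives, the a.e. equation holds everywhere. It makes the two representatives
  proportional, and normalizing the first at 0 gives a continuous character of the line.\<close>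

lemma Pexider_AE:
  fixes \<phi> \<psi> \<Theta> :: "real \<Rightarrow> complex"
  assumes meas [measurable]: "\<phi> \<in> borel_measurable borel" "\<psi> \<in> borel_measurable borel" "\<Theta> \<in> borel_measurable borel"
    and bd: "\<And>x. cmod (\<phi> x) \<le> 1" "\<And>x. cmod (\<psi> x) \<le> 1" "\<And>x. cmod (\<Theta> x) \<le> 1"
    and norm1: "AE x in lborel. cmod (\<phi> x) = 1" "AE x in lborel. cmod (\<psi> x) = 1"
    and eq: "AE \<xi> in lborel. AE y in lborel. \<phi> y * \<psi> (\<xi> - y) = \<Theta> \<xi>"
  shows "\<exists>\<alpha> l. AE y in lborel. \<phi> y = cis (\<alpha> + l * y)"
proof -
  \<comment> \<open>Exchanging the two a.e. quantifiers and shifting gives an equation in which the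
    two factors play symmetric roles, so the regularity result applies to each.\<close>
  have "AE y in lborel. AE \<xi> in lborel. \<phi> y * \<psi> (\<xi> - y) = \<Theta> \<xi>"
    using eq by (subst lborel_pair.AE_commute) measurable
  then have eq1: "AE y in lborel. AE z in lborel. \<phi> y * \<psi> z = \<Theta> (y + z)"
  proof eventually_elim
    case (elim y)
    from AE_lborel_shift(2)[OF this, of y] show ?case by (simp add: add.commute)
  qed
  then have "AE z in lborel. AE y in lborel. \<phi> y * \<psi> z = \<Theta> (y + z)"
    by (subst lborel_pair.AE_commute) measurable
  then have eq2: "AE z in lborel. AE y in lborel. \<psi> z * \<phi> y = \<Theta> (z + y)"
    by (simp add: mult.commute add.commute)
  obtain f where f: "continuous_on UNIV f" "AE y in lborel. \<phi> y = f y"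
    using Pexider_AE_continuous[OF meas bd(2,3) norm1(2) eq1] by blast
  obtain g where g: "continuous_on UNIV g" "AE y in lborel. \<psi> y = g y"
    using Pexider_AE_continuous[OF meas(2,1,3) bd(1,3) norm1(1) eq2] by blast
  have f1: "cmod (f x) = 1" for x
  proof -
    have "complex_of_real (cmod (f x)) = 1"
    proof (rule continuous_AE_eq[where f="\<lambda>x. complex_of_real (cmod (f x))" and g="\<lambda>_. 1" and x=x])
      show "AE x in lborel. complex_of_real (cmod (f x)) = 1"
        using f(2) norm1(1) by eventually_elim auto
    qed (intro continuous_intros f(1) continuous_on_const)+
    then show ?thesis by simp
  qed
  have g1: "cmod (g x) = 1" for x
  proof -
    have "complex_of_real (cmod (g x)) = 1"
    proof (rule continuous_AE_eq[where f="\<lambda>x. complex_of_real (cmod (g x))" and g="\<lambda>_. 1" and x=x])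
      show "AE x in lborel. complex_of_real (cmod (g x)) = 1"
        using g(2) norm1(2) by eventually_elim auto
    qed (intro continuous_intros g(1) continuous_on_const)+
    then show ?thesis by simp
  qed
  have fg_cont1: "continuous_on UNIV (\<lambda>y. f y * g (\<xi> - y))" for \<xi>
    by (intro continuous_intros f(1) continuous_on_compose2[OF g(1)]) auto
  have fg_cont2: "continuous_on UNIV (\<lambda>\<xi>. f y * g (\<xi> - y))" for y
    by (intro continuous_intros continuous_on_compose2[OF g(1)]) auto
  \<comment> \<open>\<open>\<Theta>\<close> has no continuous representative at hand; it is
    eliminated by comparison with the value at y = 0.\<close>
  have "AE \<xi> in lborel. \<forall>y. f y * g (\<xi> - y) = f 0 * g \<xi>"
    using eq
  proof eventually_elim
    case (elim \<xi>)
    have "AE y in lborel. f y * g (\<xi> - y) = \<Theta> \<xi>"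
      using elim f(2) AE_lborel_shift(1)[OF g(2), of \<xi>] by eventually_elim auto
    then have "f y * g (\<xi> - y) = \<Theta> \<xi>" for y
      by (rule continuous_AE_eq[OF fg_cont1 continuous_on_const])
    from this this[of 0] show ?case by simp
  qed
  then have ae: "AE \<xi> in lborel. f y * g (\<xi> - y) = f 0 * g \<xi>" for y by eventually_elim blast
  have all: "f y * g (\<xi> - y) = f 0 * g \<xi>" for y \<xi>
    by (rule continuous_AE_eq[OF fg_cont2 _ ae]) (intro continuous_intros g(1))
  have nz: "f x \<noteq> 0" "g x \<noteq> 0" for x using f1[of x] g1[of x] by auto
  have mult: "f y * g z = f 0 * g (y + z)" for y z using all[of y "y + z"] by simp
  have gf: "g y = f y * g 0 / f 0" for y using mult[of y 0] nz by (simp add: field_simps)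
  have "f y * f z = f 0 * f (y + z)" for y z
  proof -
    have "f y * (f z * g 0 / f 0) = f 0 * (f (y + z) * g 0 / f 0)"
      using mult[of y z] by (simp only: gf[symmetric])
    then show ?thesis using nz by (simp add: field_simps)
  qed
  then have "f (x + y) / f 0 = f x / f 0 * (f y / f 0)" for x y
    using nz by (simp add: field_simps)
  moreover have "continuous_on UNIV (\<lambda>x. f x / f 0)" using nz by (intro continuous_intros f(1)) auto
  ultimately obtain l where l: "\<And>x. f x / f 0 = cis (l * x)"
    using continuous_character[of "\<lambda>x. f x / f 0"] f1 by (auto simp: norm_divide)
  have "f 0 = cis (Arg (f 0))"
    using cis_Arg[of "f 0"] nz[of 0] f1[of 0] by (simp add: sgn_eq)
  then have fy: "f y = cis (Arg (f 0) + l * y)" for y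
  proof -
    have "f y = f 0 * cis (l * y)" using l[of y] nz(1)[of 0] by (simp add: field_simps)
    also have "\<dots> = cis (Arg (f 0)) * cis (l * y)" using \<open>f 0 = cis (Arg (f 0))\<close> by simp
    finally show ?thesis by (simp only: cis_mult)
  qed
  from f(2) have "AE y in lborel. \<phi> y = cis (Arg (f 0) + l * y)"
    by eventually_elim (erule trans[OF _ fy])
  then show ?thesis by blast
qed

text \<open>Splitting one factor off the convolution power, equality of its modulus with the
  unsigned power is, for almost every \<open>\<xi>\<close>, the equality case of the triangle
  inequality in the integral over \<open>y\<close>. The integrand therefore has a phase that depends
  on \<open>\<xi>\<close> alone, which is the Pexider equation for the signs of \<open>u\<close> and
  \<open>H\<close>.\<close>

lemma ground_state_Fourier_phase:
  assumes s: "s \<ge> 1/2" and Q: "boosted_ground_state s p v \<omega> (Suc n) Q"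
    and p [measurable]: "p \<in> borel_measurable borel" and m0: "\<And>\<xi>. p \<xi> - v * \<xi> + \<omega> > 0"
    and mC: "\<And>\<xi>. p \<xi> - v * \<xi> + \<omega> \<le> C * (1 + \<xi>\<^sup>2) powr s"
  shows "\<exists>\<alpha> l. AE \<xi> in lborel. fourier_L2 Q \<xi> = cis (\<alpha> + l * \<xi>) * complex_of_real (cmod (fourier_L2 Q \<xi>))"
proof -
  define u where "u = fourier_L2 Q"
  have QH: "sobolev_H s Q" using Q by (auto simp: boosted_ground_state_def)
  then have "square_integrable Q" by (simp add: sobolev_H_def)
  from fourier_L2_measurable[OF this] have [measurable]: "u \<in> borel_measurable borel"
    by (simp add: u_def)
  note pos = ground_state_Fourier_positive[OF assms, folded u_def]
  define G where "G = npow (nabs u) n"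
  define H where "H = cpow u n"
  have [measurable]: "G \<in> borel_measurable borel" "H \<in> borel_measurable borel" by (simp_all add: G_def H_def)
  have nz: "AE x in lborel. nabs u x \<noteq> 0" using pos(1) by eventually_elim simp
  have G_nz: "AE x in lborel. G x \<noteq> 0" unfolding G_def by (rule npow_AE_nonzero[OF _ nz]) simp
  have G_fin: "AE x in lborel. G x < \<infinity>"
    by (rule AE_finite_of_sq) (use sobolev_H_power_norm(1)[OF s QH, of n] in \<open>simp_all add: G_def u_def[symmetric]\<close>)
  have GG: "npow (nabs u) (Suc n) = nconv (nabs u) G" by (simp add: G_def)
  have HH: "cpow u (Suc n) = cconv u H" by (simp add: H_def)
  define \<Theta> where "\<Theta> \<xi> = sgn (cconv u H \<xi>)" for \<xi>
  have [measurable]: "(\<lambda>x. sgn (u x)) \<in> borel_measurable borel" "(\<lambda>x. sgn (H x)) \<in> borel_measurable borel"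
    "\<Theta> \<in> borel_measurable borel"
    unfolding \<Theta>_def sgn_eq by measurable
  have e1: "AE \<xi> in lborel. AE y in lborel. sgn (u y) * sgn (H (\<xi> - y)) = \<Theta> \<xi>"
    using pos(2)[unfolded GG HH]
  proof eventually_elim
    case (elim \<xi>)
    have ne: "nconv (nabs u) G \<xi> \<noteq> 0" by (rule nconv_nonzero[OF _ _ nz G_nz]) auto
    with elim have I: "cconv u H \<xi> \<noteq> 0" by auto
    have "AE y in lborel. u y * H (\<xi> - y) = sgn (cconv u H \<xi>) * complex_of_real (enn2real (nabs u y * G (\<xi> - y)))"
      unfolding cconv_def
    proof (rule AE_eq_of_integral_norm_eq)
      show "ennreal (cmod (u y * H (\<xi> - y))) \<le> nabs u y * G (\<xi> - y)" for y
        unfolding norm_mult H_def G_def by (subst ennreal_mult) (auto intro!: mult_left_mono cmod_cpow_le)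
      show "ennreal (cmod (LINT y|lborel. u y * H (\<xi> - y))) = (\<integral>\<^sup>+y. nabs u y * G (\<xi> - y) \<partial>lborel)"
        using elim by (simp add: cconv_def nconv_def)
      show "(LINT y|lborel. u y * H (\<xi> - y)) \<noteq> 0" using I by (simp add: cconv_def)
    qed measurable
    with nz AE_lborel_shift(1)[OF G_nz, of \<xi>] AE_lborel_shift(1)[OF G_fin, of \<xi>]
    show ?case
    proof eventually_elim
      case (elim y)
      have "enn2real (nabs u y * G (\<xi> - y)) > 0"
        using elim by (auto simp: enn2real_positive_iff ennreal_mult_less_top zero_less_iff_neq_zero)
      then have "sgn (u y * H (\<xi> - y)) = \<Theta> \<xi>"
        unfolding elim \<Theta>_def by (simp add: sgn_mult sgn_of_real sgn_sgn)
      then show ?case by (simp add: sgn_mult)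
    qed
  qed
  have e2: "AE x in lborel. cmod (sgn (u x)) = 1" using pos(1) by eventually_elim (simp add: norm_sgn)
  \<comment> \<open>Nonvanishing of \<open>H\<close> is read off from the phase equation: its right
    side is nonzero for almost every \<open>\<xi>\<close>, and a single such \<open>\<xi>\<close>
    settles almost every argument of \<open>H\<close>.\<close>
  have e3: "AE x in lborel. cmod (sgn (H x)) = 1"
  proof -
    have "AE \<xi> in lborel. AE y in lborel. H (\<xi> - y) \<noteq> 0"
      using e1 pos(2)[unfolded GG HH]
    proof eventually_elim
      case (elim \<xi>)
      have "nconv (nabs u) G \<xi> \<noteq> 0" by (rule nconv_nonzero[OF _ _ nz G_nz]) auto
      with elim(2) have "\<Theta> \<xi> \<noteq> 0" by (auto simp: \<Theta>_def sgn_zero_iff)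
      with elim(1) show ?case by (auto elim!: eventually_mono)
    qed
    then obtain \<xi> where "AE y in lborel. H (\<xi> - y) \<noteq> 0"
      using not_AE_interval[of 0 1] by (metis (mono_tags, lifting) eventually_mono zero_less_one)
    from AE_lborel_shift(1)[OF this, of \<xi>] show ?thesis by eventually_elim (simp add: norm_sgn)
  qed
  have le: "cmod (sgn z) \<le> 1" for z :: complex by (simp add: norm_sgn)
  have "cmod (\<Theta> \<xi>) \<le> 1" for \<xi> unfolding \<Theta>_def by (rule le)
  then obtain \<alpha> l where "AE y in lborel. sgn (u y) = cis (\<alpha> + l * y)"
    using Pexider_AE[OF _ _ _ le le _ e2 e3 e1] by auto
  then have "AE \<xi> in lborel. u \<xi> = cis (\<alpha> + l * \<xi>) * complex_of_real (cmod (u \<xi>))"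
  proof eventually_elim
    case (elim \<xi>)
    have "u \<xi> = sgn (u \<xi>) * complex_of_real (cmod (u \<xi>))" by (simp add: sgn_eq)
    then show ?case by (simp only: elim)
  qed
  then show ?thesis unfolding u_def by blast
qed

subsection \<open>Symmetry of ground states\<close>

lemma is_fourier_input_cong_AE:
  assumes [measurable]: "u \<in> borel_measurable borel" "u' \<in> borel_measurable borel"
    and eq: "AE x in lborel. u x = u' x" and F: "is_fourier u U"
  shows "is_fourier u' U"
proof -
  have "fourier_L1 (trunc R u) \<xi> = fourier_L1 (trunc R u') \<xi>" for R \<xi>
  proof -
    have "(LINT x|lborel. trunc R u x * cis (- (\<xi> * x))) = (LINT x|lborel. trunc R u' x * cis (- (\<xi> * x)))"
    proof (rule integral_cong_AE)
      show "AE x in lborel. trunc R u x * cis (- (\<xi> * x)) = trunc R u' x * cis (- (\<xi> * x))"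
        using eq by eventually_elim (simp add: trunc_def)
    qed measurable
    then show ?thesis unfolding fourier_L1_def by simp
  qed
  then show ?thesis using F by (simp add: is_fourier_iff)
qed

text \<open>The affine phase splits into a constant factor and a translation of the transform; these
  become the constants of the theorem.\<close>

lemma is_fourier_modulate:
  assumes [measurable]: "u \<in> borel_measurable borel" and F: "is_fourier u U"
  shows "is_fourier (\<lambda>x. cis (a + l * x) * u x) (\<lambda>\<xi>. cis a * U (\<xi> - l))"
proof -
  have U: "square_integrable U" using F by (rule is_fourier_square_integrable)
  note [measurable] = square_integrable_measurable[OF U]
  have "fourier_L1 (trunc R (\<lambda>x. cis (a + l * x) * u x)) \<xi> = cis a * fourier_L1 (trunc R u) (\<xi> - l)" for R \<xi>
  proof -
    have "(LINT x|lborel. trunc R (\<lambda>x. cis (a + l * x) * u x) x * cis (- (\<xi> * x)))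
        = (LINT x|lborel. cis a * (trunc R u x * cis (- ((\<xi> - l) * x))))"
    proof (intro lebesgue_integral_cong refl)
      fix x
      have "cis (a + l * x) * cis (- (\<xi> * x)) = cis a * cis (- ((\<xi> - l) * x))"
        by (simp add: cis_mult algebra_simps)
      then show "trunc R (\<lambda>x. cis (a + l * x) * u x) x * cis (- (\<xi> * x)) = cis a * (trunc R u x * cis (- ((\<xi> - l) * x)))"
        by (simp add: trunc_def mult_ac)
    qed
    then show ?thesis unfolding fourier_L1_def by simp
  qed
  then have "nsq (\<lambda>\<xi>. cis a * U (\<xi> - l) - fourier_L1 (trunc R (\<lambda>x. cis (a + l * x) * u x)) \<xi>)
      = nsq (\<lambda>\<xi>. U (\<xi> - l) - fourier_L1 (trunc R u) (\<xi> - l))" for R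
    using nsq_cmult[of "\<lambda>\<xi>. U (\<xi> - l) - fourier_L1 (trunc R u) (\<xi> - l)" "cis a"] by (simp add: right_diff_distrib)
  moreover have "nsq (\<lambda>\<xi>. U (\<xi> - l) - fourier_L1 (trunc R u) (\<xi> - l)) = nsq (\<lambda>\<xi>. U \<xi> - fourier_L1 (trunc R u) \<xi>)" for R
    using nsq_shift[of "\<lambda>\<xi>. U \<xi> - fourier_L1 (trunc R u) \<xi>" "- l"] by simp
  moreover have "square_integrable (\<lambda>\<xi>. cis a * U (\<xi> - l))"
    using U nsq_shift[of U "- l"] by (intro square_integrable_cmult) (simp add: square_integrable_iff)
  ultimately show ?thesis using F by (simp add: is_fourier_iff)
qed

lemma is_fourier_cnj:
  assumes [measurable]: "u \<in> borel_measurable borel" and F: "is_fourier u U"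
  shows "is_fourier (\<lambda>x. cnj (u x)) (\<lambda>\<xi>. cnj (U (- \<xi>)))"
proof -
  have U: "square_integrable U" using F by (rule is_fourier_square_integrable)
  note [measurable] = square_integrable_measurable[OF U]
  have "fourier_L1 (trunc R (\<lambda>x. cnj (u x))) \<xi> = cnj (fourier_L1 (trunc R u) (- \<xi>))" for R \<xi>
  proof -
    have "(LINT x|lborel. trunc R (\<lambda>x. cnj (u x)) x * cis (- (\<xi> * x))) = (LINT x|lborel. cnj (trunc R u x * cis (- (- \<xi> * x))))"
      by (intro lebesgue_integral_cong refl) (simp add: trunc_def indicator_def cis_cnj)
    also have "\<dots> = cnj (LINT x|lborel. trunc R u x * cis (- (- \<xi> * x)))"
      by (rule Bochner_Integration.integral_cnj)
    finally show ?thesis unfolding fourier_L1_def by (simp only: complex_cnj_mult complex_cnj_complex_of_real)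
  qed
  then have "nsq (\<lambda>\<xi>. cnj (U (- \<xi>)) - fourier_L1 (trunc R (\<lambda>x. cnj (u x))) \<xi>)
      = nsq (\<lambda>\<xi>. U (- \<xi>) - fourier_L1 (trunc R u) (- \<xi>))" for R
    by (simp add: nsq_def complex_cnj_diff[symmetric] del: complex_cnj_diff)
  moreover have "nsq (\<lambda>\<xi>. U (- \<xi>) - fourier_L1 (trunc R u) (- \<xi>)) = nsq (\<lambda>\<xi>. U \<xi> - fourier_L1 (trunc R u) \<xi>)" for R
    using nsq_reflect[of "\<lambda>\<xi>. U \<xi> - fourier_L1 (trunc R u) \<xi>"] by simp
  ultimately show ?thesis
    using F square_integrable_cnj[OF square_integrable_reflect[OF U]] by (simp add: is_fourier_iff)
qed

text \<open>Boundedness below is what makes the real infimum a genuine lower bound. For s = 1/2 the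
  drift and the symbol both grow linearly, so |v| < A is needed; for larger \<open>s\<close> the
  symbol wins far out.\<close>

lemma symbol_bdd_below:
  fixes s A c v :: real and p :: "real \<Rightarrow> real"
  assumes s: "s \<ge> 1/2" and A: "A > 0" and p: "\<And>\<xi>. A * \<bar>\<xi>\<bar> powr (2 * s) + c \<le> p \<xi>"
    and v: "s = 1/2 \<Longrightarrow> \<bar>v\<bar> < A"
  shows "bdd_below (range (\<lambda>\<xi>. p \<xi> - v * \<xi>))"
proof (cases "s = 1/2")
  case True
  show ?thesis
  proof (rule bdd_belowI2[of _ c])
    fix \<xi>
    have "v * \<xi> \<le> \<bar>v\<bar> * \<bar>\<xi>\<bar>" by (metis abs_ge_self abs_mult)
    also have "\<dots> \<le> A * \<bar>\<xi>\<bar>" using v[OF True] by (intro mult_right_mono) auto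
    finally show "c \<le> p \<xi> - v * \<xi>" using p[of \<xi>] True by simp
  qed
next
  case False
  then have e: "2 * s - 1 > 0" using s by simp
  \<comment> \<open>Beyond this radius A |x|^(2s) dominates |v| |x|; it solves A T^(2s-1) =
    |v|.\<close>
  define T where "T = (\<bar>v\<bar> / A) powr (1 / (2 * s - 1))"
  have T: "T powr (2 * s - 1) = \<bar>v\<bar> / A" using e A by (simp add: T_def powr_powr)
  have T0: "T \<ge> 0" by (simp add: T_def)
  show ?thesis
  proof (rule bdd_belowI2[of _ "c - \<bar>v\<bar> * T"])
    fix \<xi>
    have le: "v * \<xi> \<le> \<bar>v\<bar> * \<bar>\<xi>\<bar>" by (metis abs_ge_self abs_mult)
    show "c - \<bar>v\<bar> * T \<le> p \<xi> - v * \<xi>"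
    proof (cases "\<bar>\<xi>\<bar> \<le> T")
      case True
      then have "\<bar>v\<bar> * \<bar>\<xi>\<bar> \<le> \<bar>v\<bar> * T" by (intro mult_left_mono) auto
      moreover have "0 \<le> A * \<bar>\<xi>\<bar> powr (2 * s)" using A by simp
      ultimately show ?thesis using le p[of \<xi>] by linarith
    next
      case False
      have "\<bar>v\<bar> / A \<le> \<bar>\<xi>\<bar> powr (2 * s - 1)"
        unfolding T[symmetric] using False e T0 by (intro powr_mono2) auto
      then have "\<bar>v\<bar> \<le> A * \<bar>\<xi>\<bar> powr (2 * s - 1)" using A by (simp add: field_simps)
      then have "\<bar>v\<bar> * \<bar>\<xi>\<bar> \<le> A * \<bar>\<xi>\<bar> powr (2 * s - 1) * \<bar>\<xi>\<bar>" by (rule mult_right_mono) simp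
      also have "\<dots> = A * \<bar>\<xi>\<bar> powr (2 * s)"
        using False T0 by (simp add: powr_diff)
      finally have "\<bar>v\<bar> * \<bar>\<xi>\<bar> \<le> A * \<bar>\<xi>\<bar> powr (2 * s)" .
      moreover have "0 \<le> \<bar>v\<bar> * T" using T0 by simp
      ultimately show ?thesis using le p[of \<xi>] by linarith
    qed
  qed
qed

theorem theorem1p3:
  fixes s A B c v \<omega> :: real and p :: "real \<Rightarrow> real" and \<sigma> :: nat
    and Q :: "real \<Rightarrow> complex"
  assumes "s \<ge> 1/2"
    and "continuous_on UNIV p"
    and "A > 0" and "B > 0"
    and "\<And>\<xi>. A * \<bar>\<xi>\<bar> powr (2 * s) + c \<le> p \<xi>"
    and "\<And>\<xi>. p \<xi> \<le> B * \<bar>\<xi>\<bar> powr (2 * s)"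
    and "s = 1/2 \<Longrightarrow> \<bar>v\<bar> < A"
    and "\<omega> > - (INF \<xi>. p \<xi> - v * \<xi>)"
    and "0 < \<sigma>"
    and "boosted_ground_state s p v \<omega> \<sigma> Q"
  shows "\<exists>\<alpha> x0 :: real.
           (AE x in lborel. Q x = cis \<alpha> * bullet Q (x + x0)) \<and>
           (AE x in lborel. cis (- \<alpha>) * Q (x - x0) = cnj (cis (- \<alpha>) * Q (- x - x0)))"
proof -
  obtain n where n: "\<sigma> = Suc n" using assms(9) by (cases \<sigma>) auto
  have p [measurable]: "p \<in> borel_measurable borel" by (rule borel_measurable_continuous_onI[OF assms(2)])
  have bdd: "bdd_below (range (\<lambda>\<xi>. p \<xi> - v * \<xi>))"
    by (rule symbol_bdd_below[OF assms(1,3,5,7)])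
  have m0: "p \<xi> - v * \<xi> + \<omega> > 0" for \<xi>
    using cINF_lower[OF bdd, of \<xi>] assms(8) by simp
  \<comment> \<open>The three summands of the constant bound the symbol, the drift and the frequency
    separately by the Sobolev weight.\<close>
  have mC: "p \<xi> - v * \<xi> + \<omega> \<le> (B + 2 * \<bar>v\<bar> + \<bar>\<omega>\<bar>) * (1 + \<xi>\<^sup>2) powr s" for \<xi>
  proof -
    let ?W = "(1 + \<xi>\<^sup>2) powr s"
    have "p \<xi> \<le> B * ?W"
      using assms(4,6) sobolev_weight_ge(3)[OF assms(1), of \<xi>] by (meson mult_left_mono less_imp_le order_trans)
    moreover have "- (v * \<xi>) \<le> 2 * \<bar>v\<bar> * ?W"
    proof -
      have "- (v * \<xi>) \<le> \<bar>v\<bar> * \<bar>\<xi>\<bar>" by (metis abs_ge_minus_self abs_mult)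
      also have "\<dots> \<le> \<bar>v\<bar> * (2 * ?W)"
        using sobolev_weight_ge(1)[OF assms(1), of \<xi>] by (intro mult_left_mono) auto
      finally show ?thesis by simp
    qed
    moreover have "\<omega> \<le> \<bar>\<omega>\<bar> * ?W"
      using mult_left_mono[OF sobolev_weight_ge(2)[OF assms(1), of \<xi>], of "\<bar>\<omega>\<bar>"] by linarith
    ultimately show ?thesis by (simp add: algebra_simps)
  qed
  obtain \<alpha> l where phase: "AE \<xi> in lborel. fourier_L2 Q \<xi> = cis (\<alpha> + l * \<xi>) * complex_of_real (cmod (fourier_L2 Q \<xi>))"
    using ground_state_Fourier_phase[OF assms(1) assms(10)[unfolded n] p m0 mC] by blast
  have Q2: "square_integrable Q" using assms(10) by (simp add: boosted_ground_state_def sobolev_H_def)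
  note [measurable] = square_integrable_measurable[OF Q2]
  define u where "u = fourier_L2 Q"
  have Fu: "is_fourier Q u" unfolding u_def by (rule is_fourier_fourier_L2[OF Q2])
  have u2: "square_integrable u" by (rule is_fourier_square_integrable[OF Fu])
  note [measurable] = square_integrable_measurable[OF u2]
  \<comment> \<open>The reflection matches \<open>fourier_inv_L2\<close>, so that
    \<open>bullet Q\<close> is literally \<open>fourier_L2 g\<close>.\<close>
  define g where "g \<xi> = complex_of_real (cmod (u (- \<xi>)))" for \<xi>
  have [measurable]: "g \<in> borel_measurable borel" unfolding g_def by measurable
  have "square_integrable g"
    by (rule square_integrable_bound[OF square_integrable_reflect[OF u2]]) (auto simp: g_def)
  then have Fb: "is_fourier g (bullet Q)"
    unfolding bullet_def fourier_inv_L2_def u_def[symmetric] g_def[symmetric] by (rule is_fourier_fourier_L2)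
  then have [measurable]: "bullet Q \<in> borel_measurable borel" by (simp add: is_fourier_iff square_integrable_iff)
  have FQ: "is_fourier (\<lambda>\<xi>. u (- \<xi>)) Q" by (rule is_fourier_inversion[OF Q2 Fu])
  \<comment> \<open>Inversion presents \<open>Q\<close> as a transform of the reflected
    \<open>u\<close>, so the phase is read at the reflected frequency; the sign of \<open>l\<close>
    flips and the resulting translation is by +l.\<close>
  have "AE \<xi> in lborel. cis (\<alpha> + (- l) * \<xi>) * g \<xi> = u (- \<xi>)"
    using AE_lborel_shift(3)[OF phase] by eventually_elim (simp add: g_def u_def)
  then have "is_fourier (\<lambda>\<xi>. u (- \<xi>)) (\<lambda>x. cis \<alpha> * bullet Q (x - (- l)))"
    by (rule is_fourier_input_cong_AE[rotated 2, OF _ is_fourier_modulate[OF _ Fb]]) measurable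
  then have main: "AE x in lborel. Q x = cis \<alpha> * bullet Q (x + l)"
    using is_fourier_unique[OF _ FQ] by simp
  \<comment> \<open>Since \<open>g\<close> is real, conjugating and reflecting
    \<open>bullet Q\<close> gives another transform of \<open>g\<close>; uniqueness then yields the
    symmetry.\<close>
  have "is_fourier g (\<lambda>x. cnj (bullet Q (- x)))"
  proof -
    have "(\<lambda>x. cnj (g x)) = g" by (simp add: g_def fun_eq_iff)
    then show ?thesis using is_fourier_cnj[OF _ Fb] by simp
  qed
  then have sym: "AE x in lborel. bullet Q x = cnj (bullet Q (- x))"
    by (rule is_fourier_unique[OF _ Fb, rotated]) simp
  have bQ: "AE x in lborel. cis (- \<alpha>) * Q (x - l) = bullet Q x"
    using AE_lborel_shift(2)[OF main, of "- l"] by eventually_elim (simp add: mult.assoc[symmetric] cis_mult)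
  have "AE x in lborel. cis (- \<alpha>) * Q (x - l) = cnj (cis (- \<alpha>) * Q (- x - l))"
    using bQ AE_lborel_shift(3)[OF bQ] sym
  proof eventually_elim
    case (elim x)
    show ?case unfolding elim(1,2) by (rule elim(3))
  qed
  with main show ?thesis by blast
qed

end
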